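(* Let $\beta\in(\beta_c,\infty)$, where $e^{-2\beta_c}=\sqrt2-1$, and let $x_e=e^{-2\beta}$ for every edge $e$ of $\mathbb Z^{2*}$. For fixed $u,v\in\mathbb Z^2$ with $u\ne v$, the series $\sum_r f^u_r(x)$ and $\sum_r f^{uv}_r(x)$ converge absolutely and \[ \lim_{G\to\mathbb Z^2}\langle\sigma_u\rangle^+_{G,\beta}=\exp\Big(-2\sum_{r=1}^\infty f^u_r(x)\Big)>0,\qquad \lim_{G\to\mathbb Z^2}\langle\sigma_u\sigma_v\rangle^+_{G,\beta}=\exp\Big(-2\sum_{r=1}^\infty f^{uv}_r(x)\Big)>0 . \] These limits are denoted $\langle\sigma_u\rangle^+_{\mathbb Z^2,\beta}$ and $\langle\sigma_u\sigma_v\rangle^+_{\mathbb Z^2,\beta}$.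
   Context: Finite rectangles $G=(V,E)$ in $\mathbb Z^2$: all lattice points of a rectangle $[a,b]\times[c,d]$, edges between points at $L^1$-distance $1$; $\partial G$ = vertices of $G$ with a neighbour outside $V$. $\Omega^+_G=\{\sigma\in\{-1,1\}^V:\sigma_w=1\ \forall w\in\partial G\}$; $P^+_{G,\beta}(\sigma)\propto\prod_{xy\in E}e^{\beta\sigma_x\sigma_y}$ on $\Omega^+_G$, with expectation $\langle\cdot\rangle^+_{G,\beta}$. $G\to\mathbb Z^2$ means along rectangles eventually containing every finite subset. $\mathbb Z^{2*}=\mathbb Z^2+(\tfrac12,\tfrac12)$ with edges between points at $L^1$-distance $1$ (each dual edge crosses exactly one edge of $\mathbb Z^2$). Loops in $\mathbb Z^{2*}$: a path $(v_0,\dots,v_{n-1})$ has consecutive vertices adjacent and $v_{i+2}\ne v_i$; closed if all rotations are paths; a loop is a closed path lexicographically smallest among rotations of itself and its reversal; $m(\ell)$ = steps / smallest period; winding angle = sum over $i$ mod $n$ of turning angles in $(-\pi,\pi)$; $\operatorname{sgn}(\ell)=-e^{i\alpha(\ell)/2}$; $w(\ell;x)=\frac{\operatorname{sgn}(\ell)}{m(\ell)}\prod_i x_{v_iv_{i+1}}$. The number of crossings of a loop with a path $\gamma$ of $\mathbb Z^2$ is the number of $i\in\{0,\dots,n-1\}$ such that the dual edge $v_iv_{i+1}$ crosses an edge of $\gamma$. A loop is $uv$-odd if it crosses a self-avoiding path $\gamma$ in $\mathbb Z^2$ from $u$ to $v$ an odd number of times, and $u$-odd if it crosses an infinite self-avoiding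 path in $\mathbb Z^2$ from $u$ to $\infty$ an odd number of times (both independent of the choice of $\gamma$). $f^u_r(x)$, resp. $f^{uv}_r(x)$, is the sum of $w(\ell;x)$ over $u$-odd, resp. $uv$-odd, loops of $r$ steps in $\mathbb Z^{2*}$ (finite sums). *)

theory Defs
  imports "HOL-Analysis.Analysis"
begin

type_synonym pt = "int \<times> int"

text \<open>Adjacency at L1-distance 1 (used both for Z^2 and for the dual lattice).
  A dual vertex (i+1/2, j+1/2) of Z^2* is encoded by the integer pair (i,j).\<close>
definition adj :: "pt \<Rightarrow> pt \<Rightarrow> bool" where
  "adj p q \<longleftrightarrow> \<bar>fst p - fst q\<bar> + \<bar>snd p - snd q\<bar> = 1"

definition rect_V :: "int \<Rightarrow> int \<Rightarrow> int \<Rightarrow> int \<Rightarrow> pt set" where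
  "rect_V a b c d = {(i,j). a \<le> i \<and> i \<le> b \<and> c \<le> j \<and> j \<le> d}"

definition rect_E :: "int \<Rightarrow> int \<Rightarrow> int \<Rightarrow> int \<Rightarrow> pt set set" where
  "rect_E a b c d = {{x,y} | x y. x \<in> rect_V a b c d \<and> y \<in> rect_V a b c d \<and> adj x y}"

definition rect_bdry :: "int \<Rightarrow> int \<Rightarrow> int \<Rightarrow> int \<Rightarrow> pt set" where
  "rect_bdry a b c d = {w \<in> rect_V a b c d. \<exists>w'. adj w w' \<and> w' \<notin> rect_V a b c d}"

text \<open>Configurations in Omega^+_G; a configuration on V is encoded as a function on Z^2
  that is 1 outside V (so that the set of configurations is in bijection with
  {-1,1}^V restricted to plus boundary values).\<close>
definition Omega_plus :: "int \<Rightarrow> int \<Rightarrow> int \<Rightarrow> int \<Rightarrow> (pt \<Rightarrow> real) set" where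
  "Omega_plus a b c d = {\<sigma>. (\<forall>w \<in> rect_V a b c d. \<sigma> w \<in> {-1, 1})
       \<and> (\<forall>w. w \<notin> rect_V a b c d \<longrightarrow> \<sigma> w = 1)
       \<and> (\<forall>w \<in> rect_bdry a b c d. \<sigma> w = 1)}"

definition ising_weight :: "real \<Rightarrow> int \<Rightarrow> int \<Rightarrow> int \<Rightarrow> int \<Rightarrow> (pt \<Rightarrow> real) \<Rightarrow> real" where
  "ising_weight \<beta> a b c d \<sigma> = (\<Prod>e \<in> rect_E a b c d. exp (\<beta> * (\<Prod>z \<in> e. \<sigma> z)))"

definition ising_exp :: "real \<Rightarrow> int \<Rightarrow> int \<Rightarrow> int \<Rightarrow> int \<Rightarrow> ((pt \<Rightarrow> real) \<Rightarrow> real) \<Rightarrow> real" where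
  "ising_exp \<beta> a b c d F =
     (\<Sum>\<sigma> \<in> Omega_plus a b c d. F \<sigma> * ising_weight \<beta> a b c d \<sigma>) /
     (\<Sum>\<sigma> \<in> Omega_plus a b c d. ising_weight \<beta> a b c d \<sigma>)"

text \<open>Limit as the rectangle [a,b]x[c,d] tends to Z^2 (eventually containing every
  finite subset, equivalently every box [-N,N]^2).\<close>
definition rect_tendsto :: "(int \<Rightarrow> int \<Rightarrow> int \<Rightarrow> int \<Rightarrow> real) \<Rightarrow> real \<Rightarrow> bool" where
  "rect_tendsto F L \<longleftrightarrow> (\<forall>\<epsilon>>0. \<exists>N::int. \<forall>a b c d.
      a \<le> -N \<and> N \<le> b \<and> c \<le> -N \<and> N \<le> d \<longrightarrow> \<bar>F a b c d - L\<bar> < \<epsilon>)"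

definition beta_c :: real where
  "beta_c = - ln (sqrt 2 - 1) / 2"

definition cv :: "pt list \<Rightarrow> nat \<Rightarrow> pt" where
  "cv l i = l ! (i mod length l)"

definition closed_path :: "pt list \<Rightarrow> bool" where
  "closed_path l \<longleftrightarrow> l \<noteq> [] \<and>
     (\<forall>i < length l. adj (cv l i) (cv l (i+1)) \<and> cv l (i+2) \<noteq> cv l i)"

definition pt_less :: "pt \<Rightarrow> pt \<Rightarrow> bool" where
  "pt_less p q \<longleftrightarrow> fst p < fst q \<or> (fst p = fst q \<and> snd p < snd q)"

definition lex_le :: "pt list \<Rightarrow> pt list \<Rightarrow> bool" where
  "lex_le l l' \<longleftrightarrow> l = l' \<or> (l, l') \<in> lexord {(p, q). pt_less p q}"

definition is_loop :: "pt list \<Rightarrow> bool" where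
  "is_loop l \<longleftrightarrow> closed_path l \<and>
     (\<forall>k < length l. lex_le l (rotate k l) \<and> lex_le l (rotate k (rev l)))"

definition loop_mult :: "pt list \<Rightarrow> real" where
  "loop_mult l = real (length l) / real (LEAST p. 0 < p \<and> rotate p l = l)"

definition to_complex :: "pt \<Rightarrow> complex" where
  "to_complex p = Complex (of_int (fst p)) (of_int (snd p))"

definition step_vec :: "pt list \<Rightarrow> nat \<Rightarrow> complex" where
  "step_vec l i = to_complex (cv l (i+1)) - to_complex (cv l i)"

text \<open>Turning angle from direction d1 to direction d2 (in (-pi,pi) for non-backtracking steps).\<close>
definition turn_angle :: "complex \<Rightarrow> complex \<Rightarrow> real" where
  "turn_angle d1 d2 = Arg (d2 / d1)"

definition winding :: "pt list \<Rightarrow> real" where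
  "winding l = (\<Sum>i < length l. turn_angle (step_vec l i) (step_vec l (i+1)))"

definition loop_sgn :: "pt list \<Rightarrow> complex" where
  "loop_sgn l = - exp (\<i> * complex_of_real (winding l / 2))"

definition loop_w :: "pt list \<Rightarrow> (pt set \<Rightarrow> real) \<Rightarrow> complex" where
  "loop_w l x = loop_sgn l / complex_of_real (loop_mult l) *
      complex_of_real (\<Prod>i < length l. x {cv l i, cv l (i+1)})"

text \<open>The dual edge between dual points p,q (i.e. (p+(1/2,1/2)),(q+(1/2,1/2))) crosses the
  primal edge (a,b) iff both edges have the same midpoint.\<close>
definition crosses :: "pt \<Rightarrow> pt \<Rightarrow> pt \<times> pt \<Rightarrow> bool" where
  "crosses p q e \<longleftrightarrow> fst p + fst q + 1 = fst (fst e) + fst (snd e)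
                    \<and> snd p + snd q + 1 = snd (fst e) + snd (snd e)"

definition crossings :: "pt list \<Rightarrow> (pt \<times> pt) set \<Rightarrow> nat" where
  "crossings l E = card {i. i < length l \<and> (\<exists>e \<in> E. crosses (cv l i) (cv l (i+1)) e)}"

definition sa_path :: "pt \<Rightarrow> pt \<Rightarrow> pt list \<Rightarrow> bool" where
  "sa_path u v g \<longleftrightarrow> g \<noteq> [] \<and> distinct g \<and> hd g = u \<and> last g = v \<and>
     (\<forall>k. k + 1 < length g \<longrightarrow> adj (g ! k) (g ! (k+1)))"

definition path_edges :: "pt list \<Rightarrow> (pt \<times> pt) set" where
  "path_edges g = {(g ! k, g ! (k+1)) | k. k + 1 < length g}"

definition inf_sa_path :: "pt \<Rightarrow> (nat \<Rightarrow> pt) \<Rightarrow> bool" where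
  "inf_sa_path u g \<longleftrightarrow> inj g \<and> g 0 = u \<and> (\<forall>k. adj (g k) (g (Suc k)))"

definition inf_path_edges :: "(nat \<Rightarrow> pt) \<Rightarrow> (pt \<times> pt) set" where
  "inf_path_edges g = {(g k, g (Suc k)) | k. True}"

definition uv_odd :: "pt \<Rightarrow> pt \<Rightarrow> pt list \<Rightarrow> bool" where
  "uv_odd u v l \<longleftrightarrow> (\<exists>g. sa_path u v g \<and> odd (crossings l (path_edges g)))"

definition u_odd :: "pt \<Rightarrow> pt list \<Rightarrow> bool" where
  "u_odd u l \<longleftrightarrow> (\<exists>g. inf_sa_path u g \<and> odd (crossings l (inf_path_edges g)))"

definition f_u :: "pt \<Rightarrow> nat \<Rightarrow> (pt set \<Rightarrow> real) \<Rightarrow> complex" where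
  "f_u u r x = (\<Sum>l \<in> {l. is_loop l \<and> length l = r \<and> u_odd u l}. loop_w l x)"

definition f_uv :: "pt \<Rightarrow> pt \<Rightarrow> nat \<Rightarrow> (pt set \<Rightarrow> real) \<Rightarrow> complex" where
  "f_uv u v r x = (\<Sum>l \<in> {l. is_loop l \<and> length l = r \<and> uv_odd u v l}. loop_w l x)"

end

theory Submission
  imports Defs
begin

text \<open>Contours of a spin configuration are the even subgraphs of the dual rectangle, so each correlation is
  a ratio of even-subgraph sums in which some edge weights have been negated. An even-subgraph sum is a
  Grassmann integral: at every vertex the indicator of an even set of half-edges is a Wick functional with a
  real antisymmetric covariance, which is the Kac--Ward matrix in a real gauge. Scaling all edge weights by
  \<open>t\<close>, Wick's theorem gives a linear differential equation for the sum as a function of \<open>t\<close>, with solution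
  \<open>exp (- 1/2 * (\<Sum>r. tr (M ^ r) / r))\<close>; neither determinants nor Pfaffians are needed. The covariance at a vertex
  has norm \<open>1 + sqrt 2\<close>, so \<open>M\<close> has norm at most \<open>x * (1 + sqrt 2) < 1\<close> below the critical temperature. The traces are
  sums over closed paths, hence over loops, and only loops of odd parity survive in the ratio. An odd loop of
  \<open>r\<close> steps stays within distance \<open>r\<close> of \<open>u\<close> or \<open>v\<close>, so its contribution is bounded by the traces on a box of
  side \<open>O(r)\<close>, uniformly in the rectangle, and dominated convergence applies.\<close>

section \<open>Grassmann operators\<close>

text \<open>The threshold is exactly \<open>beta_c\<close> because \<open>1 + sqrt 2\<close> is both
  the norm of the sign matrix \<open>Am\<close> and the reciprocal of
  \<open>sqrt 2 - 1 = exp (-2 * beta_c)\<close>. The obstacle is sign control: Grassmann monomials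
  are ordered, and an edge between distant half-edges must pass everything that lies between them.
  Planarity enters there: in row-by-row order, with horizontal edges placed first, a horizontal edge
  picks up no sign and a vertical one always the same sign, which is absorbed into its weight. A
  second obstacle is that the trace bound grows with the area of the rectangle, so it is useless in
  the limit for a single partition function; only the difference of two traces is local. The
  exponent \<open>-2\<close> arises as follows: the trace formula has a factor \<open>-1/2\<close>,
  the trace difference counts every odd path with a factor \<open>2\<close>, and a loop of
  \<open>r\<close> steps and multiplicity \<open>m\<close> comes from \<open>2 * r / m\<close>
  paths.\<close>

locale grassmann =
  fixes lt :: "'h \<Rightarrow> 'h \<Rightarrow> bool"
  assumes lt_asym: "lt a b \<Longrightarrow> \<not> lt b a"
    and lt_total: "a \<noteq> b \<Longrightarrow> lt a b \<or> lt b a"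
begin

lemma lt_irrefl [simp]: "\<not> lt a a"
  using lt_asym by blast

text \<open>The sign of moving \<open>h\<close> to its place in an increasing monomial: one factor
  \<open>-1\<close> per smaller generator (Jordan--Wigner sign).\<close>

definition sg :: "'h \<Rightarrow> 'h set \<Rightarrow> real" where
  "sg h T = (\<Prod>k\<in>T. if lt k h then -1 else 1)"

text \<open>Functions on sets are coefficient families of Grassmann polynomials:
  \<open>cre h\<close> is left multiplication by the generator \<open>h\<close>, and
  \<open>ann h\<close> is the left derivative. Both are zero on infinite sets, where the product in
  \<open>sg\<close> counts nothing, so the relations below for distinct generators hold at every
  \<open>T\<close>.\<close>

definition cre :: "'h \<Rightarrow> ('h set \<Rightarrow> real) \<Rightarrow> 'h set \<Rightarrow> real" where
  "cre h f T = (if finite T \<and> h \<in> T then sg h T * f (T - {h}) else 0)"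

definition ann :: "'h \<Rightarrow> ('h set \<Rightarrow> real) \<Rightarrow> 'h set \<Rightarrow> real" where
  "ann h f T = (if finite T \<and> h \<notin> T then sg h T * f (insert h T) else 0)"

lemma sg_empty [simp]: "sg h {} = 1"
  by (simp add: sg_def)

lemma sg_insert:
  "finite T \<Longrightarrow> k \<notin> T \<Longrightarrow> sg h (insert k T) = (if lt k h then -1 else 1) * sg h T"
  by (simp add: sg_def)

lemma sg_remove:
  assumes "finite T" "k \<in> T"
  shows "sg h (T - {k}) = (if lt k h then -1 else 1) * sg h T"
  using sg_insert[of "T - {k}" k h] assms by (auto simp: insert_absorb)

lemma sg_square [simp]: "sg h T * sg h T = 1"
proof -
  have "sg h T * sg h T = (\<Prod>k\<in>T. (if lt k h then -1 else 1) * (if lt k h then -1 else 1))"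
    unfolding sg_def by (rule prod.distrib[symmetric])
  also have "\<dots> = 1" by (rule prod.neutral) auto
  finally show ?thesis .
qed

lemma cre_same: "cre h (cre h f) = (\<lambda>T. 0)"
  by (auto simp: cre_def)

lemma cre_cre:
  assumes "h \<noteq> k" shows "cre h (cre k f) = (\<lambda>T. - cre k (cre h f) T)"
proof
  fix T
  have "T - {h} - {k} = T - {k} - {h}" by auto
  then show "cre h (cre k f) T = - cre k (cre h f) T"
    using assms lt_asym lt_total[OF assms] by (auto simp: cre_def sg_remove)
qed

lemma ann_cre:
  assumes "h \<noteq> k" shows "ann h (cre k f) = (\<lambda>T. - cre k (ann h f) T)"
proof
  fix T
  have "insert h T - {k} = insert h (T - {k})" using assms by auto
  then show "ann h (cre k f) T = - cre k (ann h f) T"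
    using assms lt_asym lt_total[OF assms] by (auto simp: cre_def ann_def sg_remove sg_insert)
qed

text \<open>The canonical anticommutation relation. \<open>f\<close> must vanish on infinite sets
  because the left side does.\<close>

lemma ann_cre_same:
  assumes "\<And>T. infinite T \<Longrightarrow> f T = 0"
  shows "ann h (cre h f) = (\<lambda>T. f T - cre h (ann h f) T)"
proof
  fix T
  show "ann h (cre h f) T = f T - cre h (ann h f) T"
    using assms[of T] sg_square[of h T]
    by (auto simp: cre_def ann_def sg_remove sg_insert insert_absorb simp flip: mult.assoc)
qed

lemma cre_infinite: "infinite T \<Longrightarrow> cre h f T = 0"
  by (simp add: cre_def)

lemma cre_add: "cre h (\<lambda>T. f T + c * g T) = (\<lambda>T. cre h f T + c * cre h g T)"
  by (auto simp: cre_def algebra_simps)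

lemma cre_scale: "cre h (\<lambda>T. c * g T) = (\<lambda>T. c * cre h g T)"
  by (auto simp: cre_def algebra_simps)

lemma cre_uminus: "cre h (\<lambda>T. - g T) = (\<lambda>T. - cre h g T)"
  by (auto simp: cre_def algebra_simps)

lemma cre_zero: "cre h (\<lambda>T. 0) = (\<lambda>T. 0)"
  by (auto simp: cre_def)

lemma ann_add: "ann h (\<lambda>T. f T + c * g T) = (\<lambda>T. ann h f T + c * ann h g T)"
  by (auto simp: ann_def algebra_simps)

section \<open>Commuting pairs of generators and the exponential of the edge terms\<close>

lemma cre_cre_commute3:
  assumes "h \<noteq> a" "h \<noteq> b"
  shows "cre h (cre a (cre b f)) = cre a (cre b (cre h f))"
proof -
  have "cre h (cre a (cre b f)) = (\<lambda>T. - cre a (cre h (cre b f)) T)"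
    using assms by (subst cre_cre) auto
  also have "cre h (cre b f) = (\<lambda>T. - cre b (cre h f) T)"
    using assms by (subst cre_cre) auto
  finally show ?thesis by (simp add: cre_uminus)
qed

lemma ann_cre_commute3:
  assumes "h \<noteq> a" "h \<noteq> b"
  shows "ann h (cre a (cre b f)) = cre a (cre b (ann h f))"
proof -
  have "ann h (cre a (cre b f)) = (\<lambda>T. - cre a (ann h (cre b f)) T)"
    using assms by (subst ann_cre) auto
  also have "ann h (cre b f) = (\<lambda>T. - cre b (ann h f) T)"
    using assms by (subst ann_cre) auto
  finally show ?thesis by (simp add: cre_uminus)
qed

text \<open>The product of the factors \<open>1 + y a b\<close> over the list, the head acting last.
  It is the exponential of the sum of the terms \<open>y a b\<close>, since these commute and square
  to zero.\<close>

primrec edge_exp :: "('h \<times> 'h \<times> real) list \<Rightarrow> 'h set \<Rightarrow> real" where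
  "edge_exp [] = (\<lambda>T. of_bool (T = {}))"
| "edge_exp (e # es) = (\<lambda>T. edge_exp es T +
     snd (snd e) * cre (fst e) (cre (fst (snd e)) (edge_exp es)) T)"

definition halves :: "('h \<times> 'h \<times> real) list \<Rightarrow> 'h list" where
  "halves es = concat (map (\<lambda>(a, b, y). [a, b]) es)"

lemma halves_simps [simp]:
  "halves [] = []" "halves ((a, b, y) # es) = a # b # halves es"
  by (simp_all add: halves_def)

lemma halves_mem:
  assumes "(a, b, y) \<in> set es" shows "a \<in> set (halves es)" "b \<in> set (halves es)"
  using assms by (force simp: halves_def)+

lemma in_halvesE:
  assumes "k \<in> set (halves es)"
  obtains a b w where "(a, b, w) \<in> set es" "k = a \<or> k = b"
  using assms by (auto simp: halves_def)

lemma edge_exp_infinite: "infinite T \<Longrightarrow> edge_exp es T = 0"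
  by (induction es) (auto simp: cre_infinite)

lemma ann_edge_exp_zero:
  "k \<notin> set (halves es) \<Longrightarrow> ann k (edge_exp es) = (\<lambda>T. 0)"
proof (induction es)
  case Nil
  then show ?case by (auto simp: ann_def)
next
  case (Cons e es)
  obtain a b y where e: "e = (a, b, y)" by (cases e)
  show ?case using Cons by (simp add: e ann_add ann_cre_commute3 cre_zero)
qed

text \<open>Differentiating the exponential brings down the partner of the generator. The factor
  \<open>1 + y a b\<close> yields \<open>y b\<close> rather than \<open>y b (1 + y a b)\<close>; the
  two agree because \<open>b\<close> squares to zero.\<close>

lemma ann_edge_exp:
  assumes "distinct (halves es)" "(a, b, y) \<in> set es"
  shows "ann a (edge_exp es) = (\<lambda>T. y * cre b (edge_exp es) T) \<and>
    ann b (edge_exp es) = (\<lambda>T. - y * cre a (edge_exp es) T)"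
  using assms
proof (induction es)
  case Nil
  then show ?case by simp
next
  case (Cons e es)
  obtain c d z where e: "e = (c, d, z)" by (cases e)
  have cd: "c \<noteq> d" "c \<notin> set (halves es)" "d \<notin> set (halves es)" "distinct (halves es)"
    using Cons.prems e by auto
  let ?E = "edge_exp es"
  have E: "edge_exp (e # es) = (\<lambda>T. ?E T + z * cre c (cre d ?E) T)"
    by (simp add: e)
  show ?case
  proof (cases "(a, b, y) = e")
    case True
    then have abc: "c = a" "d = b" "z = y" using e by auto
    have ann0: "ann a ?E = (\<lambda>T. 0)" "ann b ?E = (\<lambda>T. 0)"
      using cd abc by (auto intro: ann_edge_exp_zero)
    have "ann a (cre a (cre b ?E)) = (\<lambda>T. cre b ?E T - cre a (ann a (cre b ?E)) T)"
      by (rule ann_cre_same) (simp add: cre_infinite)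
    also have "ann a (cre b ?E) = (\<lambda>T. 0)"
      using cd abc by (simp add: ann_cre ann0 cre_zero)
    finally have 1: "ann a (cre a (cre b ?E)) = cre b ?E" by (simp add: cre_zero)
    have "ann b (cre a (cre b ?E)) = (\<lambda>T. - cre a (ann b (cre b ?E)) T)"
      using cd abc by (subst ann_cre) auto
    also have "ann b (cre b ?E) = (\<lambda>T. ?E T - cre b (ann b ?E) T)"
      by (rule ann_cre_same) (simp add: edge_exp_infinite)
    finally have 2: "ann b (cre a (cre b ?E)) = (\<lambda>T. - cre a ?E T)"
      by (simp add: ann0 cre_zero)
    have 3: "cre b (cre a (cre b ?E)) = (\<lambda>T. 0)"
      using cd abc by (subst cre_cre) (auto simp: cre_same cre_zero)
    have 4: "cre a (cre a (cre b ?E)) = (\<lambda>T. 0)"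
      by (simp add: cre_same)
    show ?thesis
      unfolding E abc by (simp add: ann_add cre_add ann0 1 2 3 4)
  next
    case False
    then have mem: "(a, b, y) \<in> set es" using Cons.prems by auto
    then have ne: "a \<noteq> c" "a \<noteq> d" "b \<noteq> c" "b \<noteq> d"
      using cd halves_mem[OF mem] by auto
    note IH = Cons.IH[OF cd(4) mem]
    show ?thesis
      unfolding E using ne
      by (simp add: ann_add cre_add ann_cre_commute3 IH cre_scale cre_uminus cre_cre_commute3[of a c d]
            cre_cre_commute3[of b c d] algebra_simps)
  qed
qed

definition scaled :: "real \<Rightarrow> ('h \<times> 'h \<times> real) list \<Rightarrow> ('h \<times> 'h \<times> real) list" where
  "scaled t = map (\<lambda>(a, b, y). (a, b, t * y))"

lemma halves_scaled [simp]: "halves (scaled t es) = halves es"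
  by (induction es) (auto simp: scaled_def)

lemma scaled_mem: "(a, b, y) \<in> set es \<Longrightarrow> (a, b, t * y) \<in> set (scaled t es)"
  by (force simp: scaled_def)

lemma scaled_one [simp]: "scaled 1 es = es"
  by (induction es) (auto simp: scaled_def)

lemma cre_sum_list:
  "cre h (\<lambda>T. \<Sum>x\<leftarrow>xs. c x * g x T) = (\<lambda>T. \<Sum>x\<leftarrow>xs. c x * cre h (g x) T)"
proof (induction xs)
  case Nil
  then show ?case by (simp add: cre_zero)
next
  case (Cons x xs)
  show ?case
    using Cons cre_add[of h "\<lambda>T. \<Sum>x\<leftarrow>xs. c x * g x T" "c x" "g x"] by (simp add: add.commute)
qed

lemma cre_has_derivative:
  assumes "\<And>T. ((\<lambda>t. f t T) has_real_derivative f' T) (at t)"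
  shows "((\<lambda>t. cre h (f t) T) has_real_derivative cre h f' T) (at t)"
  using assms by (auto simp: cre_def intro!: derivative_eq_intros)

text \<open>A factor \<open>1 + t y c\<close> differentiates to \<open>y c\<close>, where \<open>c\<close> creates both halves of the edge, and the factor
  itself may be put back because \<open>c\<close> squares to zero.\<close>
lemma edge_exp_derivative:
  assumes "distinct (halves es)"
  shows "((\<lambda>t. edge_exp (scaled t es) T) has_real_derivative
    (\<Sum>e\<leftarrow>es. snd (snd e) * cre (fst e) (cre (fst (snd e)) (edge_exp (scaled t es))) T)) (at t)"
  using assms
proof (induction es arbitrary: T)
  case Nil
  then show ?case by (simp add: scaled_def)
next
  case (Cons e es)
  obtain a b y where e: "e = (a, b, y)" by (cases e)
  have ab: "a \<noteq> b" "a \<notin> set (halves es)" "b \<notin> set (halves es)" "distinct (halves es)"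
    using Cons.prems e by auto
  let ?E = "\<lambda>t. edge_exp (scaled t es)"
  define D where "D T = (\<Sum>e\<leftarrow>es. snd (snd e) * cre (fst e) (cre (fst (snd e)) (?E t)) T)" for T
  have E: "edge_exp (scaled t (e # es)) = (\<lambda>T. ?E t T + t * y * cre a (cre b (?E t)) T)" for t
    by (simp add: e scaled_def)
  have IH: "((\<lambda>t. ?E t T) has_real_derivative D T) (at t)" for T
    unfolding D_def using Cons.IH ab by blast
  have "((\<lambda>t. cre a (cre b (?E t)) T) has_real_derivative cre a (cre b D) T) (at t)"
    by (intro cre_has_derivative IH)
  then have "((\<lambda>t. edge_exp (scaled t (e # es)) T) has_real_derivative
      D T + (y * cre a (cre b (?E t)) T + t * y * cre a (cre b D) T)) (at t)"
    unfolding E by (auto intro!: derivative_eq_intros IH)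
  moreover have "cre a (cre b (edge_exp (scaled t (e # es)))) T = cre a (cre b (?E t)) T"
  proof -
    have z: "cre b (cre a (cre b (?E t))) = (\<lambda>T. 0)"
      using ab by (subst cre_cre) (auto simp: cre_same cre_zero)
    show ?thesis by (simp add: E cre_add z cre_zero)
  qed
  moreover have "(\<Sum>f\<leftarrow>es. snd (snd f) * cre (fst f) (cre (fst (snd f)) (edge_exp (scaled t (e # es)))) T)
      = D T + t * y * cre a (cre b D) T"
  proof -
    have 1: "cre (fst f) (cre (fst (snd f)) (edge_exp (scaled t (e # es)))) T =
       cre (fst f) (cre (fst (snd f)) (?E t)) T
        + t * y * cre a (cre b (cre (fst f) (cre (fst (snd f)) (?E t)))) T"
      if "f \<in> set es" for f
    proof -
      obtain c d z where f: "f = (c, d, z)" by (cases f)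
      have "c \<noteq> a" "c \<noteq> b" "d \<noteq> a" "d \<noteq> b"
        using halves_mem[of c d z es] that f ab by auto
      then show ?thesis by (simp add: f E cre_add cre_cre_commute3)
    qed
    have "(\<Sum>f\<leftarrow>es. snd (snd f) * cre (fst f) (cre (fst (snd f)) (edge_exp (scaled t (e # es)))) T)
      = (\<Sum>f\<leftarrow>es. snd (snd f) * cre (fst f) (cre (fst (snd f)) (?E t)) T
         + t * y * (snd (snd f) * cre a (cre b (cre (fst f) (cre (fst (snd f)) (?E t)))) T))"
      by (rule arg_cong[where f = sum_list], rule map_cong) (auto simp: 1 algebra_simps)
    also have "\<dots> = D T + t * y * cre a (cre b D) T"
    proof -
      have "cre a (cre b D) T =
        (\<Sum>f\<leftarrow>es. snd (snd f) * cre a (cre b (cre (fst f) (cre (fst (snd f)) (?E t)))) T)"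
        by (simp add: D_def[abs_def] cre_sum_list)
      then show ?thesis
        by (simp add: D_def sum_list_addf sum_list_const_mult)
    qed
    finally show ?thesis .
  qed
  ultimately show ?case
    by (simp add: e add_ac mult_ac)
qed

lemma edge_exp_scaled_zero: "edge_exp (scaled 0 es) = edge_exp []"
  by (induction es) (auto simp: scaled_def)

end

section \<open>Wick functional and trace formula\<close>

primrec mpow :: "'h set \<Rightarrow> ('h \<Rightarrow> 'h \<Rightarrow> real) \<Rightarrow> nat \<Rightarrow> 'h \<Rightarrow> 'h \<Rightarrow> real" where
  "mpow H M 0 = (\<lambda>h k. of_bool (h = k))"
| "mpow H M (Suc n) = (\<lambda>h k. \<Sum>g\<in>H. M h g * mpow H M n g k)"

definition mtrace :: "'h set \<Rightarrow> ('h \<Rightarrow> 'h \<Rightarrow> real) \<Rightarrow> nat \<Rightarrow> real" where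
  "mtrace H M n = (\<Sum>h\<in>H. mpow H M n h h)"

text \<open>The \<open>k\<close>-th column of the power starts as a unit vector, and each
  multiplication by \<open>M\<close> scales its Euclidean norm by at most \<open>\<rho>\<close>; an
  entry is bounded by the norm of its column.\<close>

lemma mpow_bound:
  assumes "finite H" "0 \<le> \<rho>"
    and M: "\<And>f. (\<Sum>h\<in>H. (\<Sum>g\<in>H. M h g * f g)\<^sup>2) \<le> \<rho>\<^sup>2 * (\<Sum>g\<in>H. (f g)\<^sup>2)"
    and "h \<in> H" "k \<in> H"
  shows "\<bar>mpow H M n h k\<bar> \<le> \<rho> ^ n"
proof -
  have "(\<Sum>h\<in>H. (mpow H M n h k)\<^sup>2) \<le> (\<rho> ^ n)\<^sup>2"
  proof (induction n)
    case 0
    have "(\<Sum>h\<in>H. (of_bool (h = k) :: real)\<^sup>2) = (\<Sum>h\<in>H. if h = k then 1 else 0)"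
      by (intro sum.cong) auto
    then show ?case using assms by simp
  next
    case (Suc n)
    have "(\<Sum>h\<in>H. (mpow H M (Suc n) h k)\<^sup>2) \<le> \<rho>\<^sup>2 * (\<Sum>g\<in>H. (mpow H M n g k)\<^sup>2)"
      using M[of "\<lambda>g. mpow H M n g k"] by simp
    also have "\<dots> \<le> \<rho>\<^sup>2 * (\<rho> ^ n)\<^sup>2"
      using Suc by (intro mult_left_mono) auto
    finally show ?case by (simp add: power_mult_distrib)
  qed
  moreover have "(mpow H M n h k)\<^sup>2 \<le> (\<Sum>h\<in>H. (mpow H M n h k)\<^sup>2)"
    using assms by (intro member_le_sum) auto
  ultimately have "(mpow H M n h k)\<^sup>2 \<le> (\<rho> ^ n)\<^sup>2" by linarith
  then show ?thesis using assms(2) by (simp add: abs_le_square_iff[symmetric])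
qed

lemma mtrace_bound:
  assumes "finite H" "0 \<le> \<rho>"
    and M: "\<And>f. (\<Sum>h\<in>H. (\<Sum>g\<in>H. M h g * f g)\<^sup>2) \<le> \<rho>\<^sup>2 * (\<Sum>g\<in>H. (f g)\<^sup>2)"
  shows "\<bar>mtrace H M n\<bar> \<le> real (card H) * \<rho> ^ n"
proof -
  have "\<bar>mtrace H M n\<bar> \<le> (\<Sum>h\<in>H. \<bar>mpow H M n h h\<bar>)"
    unfolding mtrace_def by (rule sum_abs)
  also have "\<dots> \<le> (\<Sum>h\<in>H. \<rho> ^ n)"
    by (intro sum_mono mpow_bound assms)
  finally show ?thesis by simp
qed

text \<open>\<open>wick_local\<close> expands \<open>F\<close> along one generator, the contraction
  of \<open>h\<close> with \<open>k\<close> being \<open>A h k\<close>. It also covers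
  \<open>h\<close> in \<open>T\<close>, where the left side is zero because \<open>h\<close> squares
  to zero: \<open>Phi_cre\<close> applies it to every subset \<open>T\<close>.\<close>

locale wick = grassmann lt for lt :: "'h \<Rightarrow> 'h \<Rightarrow> bool" +
  fixes H :: "'h set" and F :: "'h set \<Rightarrow> real" and A :: "'h \<Rightarrow> 'h \<Rightarrow> real"
  assumes finite_H: "finite H" and F_empty: "F {} = 1"
    and wick_local: "\<And>T h. T \<subseteq> H \<Longrightarrow> h \<in> H \<Longrightarrow>
      (if h \<notin> T then sg h T * F (insert h T) else 0) = (\<Sum>k\<in>T. A h k * sg k T * F (T - {k}))"
begin

definition Phi :: "('h set \<Rightarrow> real) \<Rightarrow> real" where
  "Phi f = (\<Sum>T\<in>Pow H. F T * f T)"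

lemma Phi_add: "Phi (\<lambda>T. f T + g T) = Phi f + Phi g"
  and Phi_scale: "Phi (\<lambda>T. c * f T) = c * Phi f"
  by (simp_all add: Phi_def sum.distrib algebra_simps sum_distrib_left)

lemma Phi_vacuum: "Phi (edge_exp []) = 1"
proof -
  have "Phi (edge_exp []) = (\<Sum>T\<in>Pow H. if T = {} then F T else 0)"
    unfolding Phi_def by (intro sum.cong) auto
  then show ?thesis using finite_H by (simp add: F_empty)
qed

lemma sum_Pow_split_insert:
  assumes "h \<in> H"
  shows "(\<Sum>T\<in>Pow H. if h \<in> T then q T else 0) = (\<Sum>T\<in>Pow H. if h \<notin> T then q (insert h T) else (0::real))"
proof -
  have "(\<Sum>T\<in>Pow H. if h \<in> T then q T else 0) = (\<Sum>T\<in>{T\<in>Pow H. h \<in> T}. q T)"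
    by (rule sum.inter_filter[symmetric]) (simp add: finite_H)
  also have "\<dots> = (\<Sum>T\<in>{T\<in>Pow H. h \<notin> T}. q (insert h T))"
    by (rule sum.reindex_bij_witness[of _ "insert h" "\<lambda>T. T - {h}"]) (use assms in \<open>auto simp: insert_absorb\<close>)
  also have "\<dots> = (\<Sum>T\<in>Pow H. if h \<notin> T then q (insert h T) else 0)"
    by (rule sum.inter_filter) (simp add: finite_H)
  finally show ?thesis .
qed

text \<open>Gaussian integration by parts, the form of Wick's theorem used here: a generator under
  the functional becomes a covariance-weighted sum of derivatives.\<close>

lemma Phi_cre:
  assumes h: "h \<in> H"
  shows "Phi (cre h f) = (\<Sum>k\<in>H. A h k * Phi (ann k f))"
proof -
  have fin: "finite T" if "T \<in> Pow H" for T using that finite_H finite_subset by blast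
  have "Phi (cre h f) = (\<Sum>T\<in>Pow H. if h \<in> T then F T * sg h T * f (T - {h}) else 0)"
    unfolding Phi_def cre_def using fin by (intro sum.cong) auto
  also have "\<dots> = (\<Sum>T\<in>Pow H. if h \<notin> T then F (insert h T) * sg h (insert h T) * f (insert h T - {h}) else 0)"
    by (rule sum_Pow_split_insert[OF h])
  also have "\<dots> = (\<Sum>T\<in>Pow H. (if h \<notin> T then sg h T * F (insert h T) else 0) * f T)"
    using fin by (intro sum.cong) (auto simp: sg_insert)
  also have "\<dots> = (\<Sum>T\<in>Pow H. (\<Sum>k\<in>T. A h k * sg k T * F (T - {k})) * f T)"
    using h by (intro sum.cong) (auto simp: wick_local)
  also have "\<dots> = (\<Sum>T\<in>Pow H. \<Sum>k\<in>H. if k \<in> T then A h k * sg k T * F (T - {k}) * f T else 0)"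
  proof (intro sum.cong refl)
    fix T assume "T \<in> Pow H"
    then have "H \<inter> T = T" by auto
    then have "(\<Sum>k\<in>H. if k \<in> T then A h k * sg k T * F (T - {k}) * f T else 0)
        = (\<Sum>k\<in>T. A h k * sg k T * F (T - {k}) * f T)"
      using finite_H by (simp flip: sum.inter_restrict)
    then show "(\<Sum>k\<in>T. A h k * sg k T * F (T - {k})) * f T
      = (\<Sum>k\<in>H. if k \<in> T then A h k * sg k T * F (T - {k}) * f T else 0)"
      by (simp add: sum_distrib_right)
  qed
  also have "\<dots> = (\<Sum>k\<in>H. \<Sum>T\<in>Pow H. if k \<in> T then A h k * sg k T * F (T - {k}) * f T else 0)"
    by (rule sum.swap)
  also have "\<dots> = (\<Sum>k\<in>H. A h k * Phi (ann k f))"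
  proof (intro sum.cong refl)
    fix k assume k: "k \<in> H"
    have "(\<Sum>T\<in>Pow H. if k \<in> T then A h k * sg k T * F (T - {k}) * f T else 0) =
      (\<Sum>T\<in>Pow H. if k \<notin> T then A h k * sg k (insert k T) * F (insert k T - {k}) * f (insert k T) else 0)"
      by (rule sum_Pow_split_insert[OF k])
    also have "\<dots> = (\<Sum>T\<in>Pow H. A h k * (F T * ann k f T))"
      using fin by (intro sum.cong) (auto simp: sg_insert ann_def)
    finally show "(\<Sum>T\<in>Pow H. if k \<in> T then A h k * sg k T * F (T - {k}) * f T else 0) = A h k * Phi (ann k f)"
      by (simp add: Phi_def sum_distrib_left)
  qed
  finally show ?thesis .
qed

end

text \<open>The opposite signs of \<open>y\<close> at the two halves are those of
  \<open>ann_edge_exp\<close>: the derivatives in \<open>a\<close> and \<open>b\<close> give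
  \<open>w b\<close> and \<open>- w a\<close>. Half-edges without a partner get
  \<open>y = 0\<close>, so that \<open>pr\<close> may take any value there.\<close>

locale wick_edges = wick lt H F A for lt :: "'h \<Rightarrow> 'h \<Rightarrow> bool" and H F A +
  fixes es :: "('h \<times> 'h \<times> real) list" and pr :: "'h \<Rightarrow> 'h" and y :: "'h \<Rightarrow> real" and \<rho> :: real
  assumes distinct_halves: "distinct (halves es)" and halves_sub: "set (halves es) \<subseteq> H"
    and edge: "\<And>a b w. (a, b, w) \<in> set es \<Longrightarrow> pr a = b \<and> pr b = a \<and> y a = w \<and> y b = - w"
    and no_edge: "\<And>k. k \<in> H \<Longrightarrow> k \<notin> set (halves es) \<Longrightarrow> y k = 0"
    and rho: "0 \<le> \<rho>" "\<rho> < 1"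
    and norm_bound: "\<And>f. (\<Sum>h\<in>H. (\<Sum>g\<in>H. (\<Sum>k\<in>H. A h k * y k * of_bool (pr k = g)) * f g)\<^sup>2)
       \<le> \<rho>\<^sup>2 * (\<Sum>g\<in>H. (f g)\<^sup>2)"
begin

section \<open>Two-point function and its Neumann series\<close>

definition step_matrix :: "'h \<Rightarrow> 'h \<Rightarrow> real" where
  "step_matrix h g = (\<Sum>k\<in>H. A h k * y k * of_bool (pr k = g))"

definition Z :: "real \<Rightarrow> real" where
  "Z t = Phi (edge_exp (scaled t es))"

definition G :: "real \<Rightarrow> 'h \<Rightarrow> 'h \<Rightarrow> real" where
  "G t h l = Phi (cre h (cre l (edge_exp (scaled t es))))"

lemma ann_edge_exp_pr:
  assumes "k \<in> H"
  shows "ann k (edge_exp (scaled t es)) = (\<lambda>T. t * y k * cre (pr k) (edge_exp (scaled t es)) T)"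
proof (cases "k \<in> set (halves es)")
  case True
  then obtain a b w where e: "(a, b, w) \<in> set es" "k = a \<or> k = b" by (rule in_halvesE)
  note * = ann_edge_exp[of "scaled t es" a b "t * w"]
  show ?thesis
    using e * scaled_mem[OF e(1), of t] distinct_halves edge[OF e(1)] by auto
next
  case False
  then show ?thesis using no_edge[OF assms] by (simp add: ann_edge_exp_zero)
qed

lemma pr_H: "k \<in> H \<Longrightarrow> y k \<noteq> 0 \<Longrightarrow> pr k \<in> H"
  using no_edge edge halves_sub halves_mem by (metis in_halvesE subsetD)

lemma sum_y_pr:
  assumes "k \<in> H"
  shows "y k * f (pr k) = y k * (\<Sum>g\<in>H. of_bool (pr k = g) * f g)"
proof (cases "y k = 0")
  case False
  have "(\<Sum>g\<in>H. of_bool (pr k = g) * f g) = (\<Sum>g\<in>H. if pr k = g then f g else 0)"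
    by (intro sum.cong) auto
  then show ?thesis using pr_H[OF assms False] finite_H by simp
qed auto

lemma step_matrix_apply: "(\<Sum>g\<in>H. step_matrix h g * f g) = (\<Sum>k\<in>H. A h k * y k * f (pr k))"
proof -
  have "(\<Sum>g\<in>H. step_matrix h g * f g) = (\<Sum>g\<in>H. \<Sum>k\<in>H. A h k * y k * of_bool (pr k = g) * f g)"
    by (simp add: step_matrix_def sum_distrib_right)
  also have "\<dots> = (\<Sum>k\<in>H. A h k * (y k * (\<Sum>g\<in>H. of_bool (pr k = g) * f g)))"
    by (subst sum.swap) (simp add: sum_distrib_left mult_ac)
  also have "\<dots> = (\<Sum>k\<in>H. A h k * (y k * f (pr k)))"
    by (intro sum.cong refl) (simp add: sum_y_pr)
  finally show ?thesis by (simp add: mult_ac)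
qed

text \<open>A Schwinger--Dyson equation: when \<open>h\<close> is integrated by parts, the
  derivative hits either \<open>l\<close>, giving the covariance, or the exponential, which returns
  \<open>G\<close> with its first argument moved across an edge.\<close>

lemma G_equation:
  assumes "h \<in> H" "l \<in> H"
  shows "G t h l = A h l * Z t + t * (\<Sum>g\<in>H. step_matrix h g * G t g l)"
proof -
  let ?E = "edge_exp (scaled t es)"
  have *: "ann k (cre l ?E) = (\<lambda>T. of_bool (k = l) * ?E T + t * y k * cre (pr k) (cre l ?E) T)"
    if k: "k \<in> H" for k
  proof (cases "k = l")
    case True
    have "ann k (cre l ?E) = (\<lambda>T. ?E T - cre l (ann l ?E) T)"
      unfolding True by (rule ann_cre_same) (simp add: edge_exp_infinite)
    also have "cre l (ann l ?E) = (\<lambda>T. t * y l * cre l (cre (pr l) ?E) T)"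
      using k True by (simp add: ann_edge_exp_pr cre_scale)
    finally have 1: "ann k (cre l ?E) = (\<lambda>T. ?E T - t * y l * cre l (cre (pr l) ?E) T)" .
    show ?thesis
    proof (cases "y l = 0")
      case False
      \<comment> \<open>\<open>pr l = l\<close> would give \<open>y l = - y l\<close>, hence
        \<open>y l = 0\<close>.\<close>
      then have "pr l \<noteq> l"
        using edge no_edge True k distinct_halves
        by (metis equation_minus_iff in_halvesE neg_equal_zero)
      then have 2: "cre l (cre (pr l) ?E) = (\<lambda>T. - cre (pr l) (cre l ?E) T)"
        by (intro cre_cre) auto
      show ?thesis unfolding 1 2 using True by simp
    qed (use 1 True in simp)
  next
    case False
    have "ann k (cre l ?E) = (\<lambda>T. - cre l (ann k ?E) T)" using False by (rule ann_cre)
    also have "cre l (ann k ?E) = (\<lambda>T. t * y k * cre l (cre (pr k) ?E) T)"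
      using k by (simp add: ann_edge_exp_pr cre_scale)
    finally have 1: "ann k (cre l ?E) = (\<lambda>T. - (t * y k * cre l (cre (pr k) ?E) T))" .
    show ?thesis
    \<comment> \<open>If they coincide, both terms vanish, a generator squaring to zero; otherwise
      the two generators anticommute.\<close>
    proof (cases "pr k = l")
      case True
      then show ?thesis unfolding 1 using False by (simp add: cre_same)
    next
      case False
      have 2: "cre l (cre (pr k) ?E) = (\<lambda>T. - cre (pr k) (cre l ?E) T)"
        by (rule cre_cre) (use False in auto)
      show ?thesis unfolding 1 2 using \<open>k \<noteq> l\<close> by simp
    qed
  qed
  have "G t h l = (\<Sum>k\<in>H. A h k * Phi (ann k (cre l ?E)))"
    unfolding G_def by (rule Phi_cre[OF assms(1)])
  also have "\<dots> = (\<Sum>k\<in>H. A h k * (of_bool (k = l) * Z t + t * y k * G t (pr k) l))"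
    by (intro sum.cong refl) (simp add: * Phi_add Phi_scale Z_def G_def)
  also have "\<dots> = (\<Sum>k\<in>H. if k = l then A h l * Z t else 0) + t * (\<Sum>k\<in>H. A h k * y k * G t (pr k) l)"
    by (simp add: sum.distrib[symmetric] sum_distrib_left algebra_simps) (intro sum.cong refl, auto)
  finally show ?thesis using assms finite_H by (simp add: step_matrix_apply)
qed

lemma mpow_trans_bound: "h \<in> H \<Longrightarrow> k \<in> H \<Longrightarrow> \<bar>mpow H step_matrix n h k\<bar> \<le> \<rho> ^ n"
  using norm_bound by (intro mpow_bound[OF finite_H rho(1)]) (simp_all add: step_matrix_def)

text \<open>Iterating the equation for \<open>G\<close>, instead of inverting
  \<open>1 - t M\<close>, gives the Neumann series with an explicit remainder.\<close>

lemma G_iterate: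
  assumes "h \<in> H" "l \<in> H"
  shows "G t h l = (\<Sum>r<n. t ^ r * (\<Sum>g\<in>H. mpow H step_matrix r h g * A g l)) * Z t
     + t ^ n * (\<Sum>g\<in>H. mpow H step_matrix n h g * G t g l)"
  using assms(1)
proof (induction n arbitrary: h)
  case 0
  have "(\<Sum>g\<in>H. of_bool (h = g) * G t g l) = (\<Sum>g\<in>H. if h = g then G t g l else 0)"
    by (intro sum.cong) auto
  then show ?case using 0 finite_H by simp
next
  case (Suc n)
  let ?P = "mpow H step_matrix" and ?M = step_matrix
  have mat: "(\<Sum>g\<in>H. ?M h g * (\<Sum>k\<in>H. ?P r g k * q k)) = (\<Sum>k\<in>H. ?P (Suc r) h k * q k)" for r q
    by (simp add: sum_distrib_left sum_distrib_right mult_ac) (rule sum.swap)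
  have "G t h l = A h l * Z t + t * (\<Sum>g\<in>H. ?M h g * G t g l)"
    by (rule G_equation[OF Suc.prems assms(2)])
  also have "(\<Sum>g\<in>H. ?M h g * G t g l) = (\<Sum>g\<in>H. ?M h g *
     ((\<Sum>r<n. t ^ r * (\<Sum>k\<in>H. ?P r g k * A k l)) * Z t + t ^ n * (\<Sum>k\<in>H. ?P n g k * G t k l)))"
    using Suc.IH by (intro sum.cong) auto
  also have "\<dots> = (\<Sum>g\<in>H. \<Sum>r<n. t ^ r * (?M h g * (\<Sum>k\<in>H. ?P r g k * A k l))) * Z t
      + t ^ n * (\<Sum>g\<in>H. ?M h g * (\<Sum>k\<in>H. ?P n g k * G t k l))"
    by (simp add: algebra_simps sum.distrib sum_distrib_left sum_distrib_right)
  also have "\<dots> = (\<Sum>r<n. t ^ r * (\<Sum>k\<in>H. ?P (Suc r) h k * A k l)) * Z t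
      + t ^ n * (\<Sum>k\<in>H. ?P (Suc n) h k * G t k l)"
    by (subst sum.swap) (simp only: sum_distrib_left[symmetric] mat)
  finally have "G t h l = A h l * Z t + t * ((\<Sum>r<n. t ^ r * (\<Sum>k\<in>H. ?P (Suc r) h k * A k l)) * Z t
      + t ^ n * (\<Sum>k\<in>H. ?P (Suc n) h k * G t k l))" .
  moreover have "(\<Sum>g\<in>H. ?P 0 h g * A g l) = A h l"
  proof -
    have "(\<Sum>g\<in>H. ?P 0 h g * A g l) = (\<Sum>g\<in>H. if h = g then A g l else 0)"
      by (intro sum.cong) auto
    then show ?thesis using Suc.prems finite_H by simp
  qed
  ultimately show ?case
    unfolding sum.lessThan_Suc_shift
    by (simp add: algebra_simps sum_distrib_left del: mpow.simps)
qed

text \<open>The remainder is at most \<open>\<rho> ^ n\<close> times a quantity that does not depend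
  on \<open>n\<close>, which suffices without any bound on \<open>G\<close>.\<close>

lemma G_series:
  assumes "h \<in> H" "l \<in> H" "0 \<le> t" "t \<le> 1"
  shows "(\<lambda>r. t ^ r * (\<Sum>g\<in>H. mpow H step_matrix r h g * A g l) * Z t) sums G t h l"
proof -
  have 1: "\<bar>t ^ n * (\<Sum>g\<in>H. mpow H step_matrix n h g * G t g l)\<bar> \<le> \<rho> ^ n * (\<Sum>g\<in>H. \<bar>G t g l\<bar>)" for n
  proof -
    have "\<bar>\<Sum>g\<in>H. mpow H step_matrix n h g * G t g l\<bar> \<le> (\<Sum>g\<in>H. \<bar>mpow H step_matrix n h g * G t g l\<bar>)"
      by (rule sum_abs)
    also have "\<dots> \<le> (\<Sum>g\<in>H. \<rho> ^ n * \<bar>G t g l\<bar>)"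
      using assms by (intro sum_mono) (auto simp: abs_mult intro!: mult_right_mono mpow_trans_bound)
    finally have "\<bar>\<Sum>g\<in>H. mpow H step_matrix n h g * G t g l\<bar> \<le> \<rho> ^ n * (\<Sum>g\<in>H. \<bar>G t g l\<bar>)"
      by (simp add: sum_distrib_left)
    moreover have "\<bar>t ^ n\<bar> \<le> 1" using assms by (simp add: power_le_one)
    ultimately show ?thesis
      unfolding abs_mult by (meson abs_ge_zero mult_left_le_one_le order_trans)
  qed
  have "(\<lambda>n. \<rho> ^ n * (\<Sum>g\<in>H. \<bar>G t g l\<bar>)) \<longlonglongrightarrow> 0"
    using rho by (intro tendsto_mult_left_zero LIMSEQ_power_zero) auto
  then have "(\<lambda>n. t ^ n * (\<Sum>g\<in>H. mpow H step_matrix n h g * G t g l)) \<longlonglongrightarrow> 0"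
    by (rule Lim_null_comparison[rotated]) (use 1 in auto)
  then have "(\<lambda>n. G t h l - t ^ n * (\<Sum>g\<in>H. mpow H step_matrix n h g * G t g l)) \<longlonglongrightarrow> G t h l - 0"
    by (intro tendsto_intros)
  moreover have "G t h l - t ^ n * (\<Sum>g\<in>H. mpow H step_matrix n h g * G t g l)
     = (\<Sum>r<n. t ^ r * (\<Sum>g\<in>H. mpow H step_matrix r h g * A g l) * Z t)" for n
    using G_iterate[OF assms(1,2), of t n] by (simp add: sum_distrib_right)
  ultimately show ?thesis by (simp add: sums_def)
qed

lemma sum_list_halves:
  "(\<Sum>k\<leftarrow>halves fs. q k) = (\<Sum>e\<leftarrow>fs. q (fst e) + q (fst (snd e)))"
  by (induction fs) (auto simp: add.assoc)

text \<open>Each edge is counted from both of its halves. The opposite signs of \<open>y\<close> and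
  the antisymmetry of \<open>G\<close> make the two terms equal, whence the factor
  \<open>- 1/2\<close>.\<close>

lemma Z_derivative:
  "(Z has_real_derivative (- (1/2) * (\<Sum>k\<in>H. y k * G t (pr k) k))) (at t)"
proof -
  let ?E = "edge_exp (scaled t es)"
  have "(Z has_real_derivative (\<Sum>T\<in>Pow H. F T *
     (\<Sum>e\<leftarrow>es. snd (snd e) * cre (fst e) (cre (fst (snd e)) ?E) T))) (at t)"
    unfolding Z_def[abs_def] Phi_def
    by (intro DERIV_sum DERIV_cmult edge_exp_derivative distinct_halves)
  moreover have "(\<Sum>T\<in>Pow H. F T * (\<Sum>e\<leftarrow>fs. snd (snd e) * cre (fst e) (cre (fst (snd e)) ?E) T))
     = (\<Sum>e\<leftarrow>fs. snd (snd e) * G t (fst e) (fst (snd e)))" for fs :: "('h \<times> 'h \<times> real) list"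
    by (induction fs) (simp_all add: distrib_left sum.distrib Phi_def G_def sum_distrib_left mult_ac)
  moreover have "(\<Sum>k\<in>H. y k * G t (pr k) k) = -2 * (\<Sum>e\<leftarrow>es. snd (snd e) * G t (fst e) (fst (snd e)))"
  proof -
    have "(\<Sum>k\<in>H. y k * G t (pr k) k) = (\<Sum>k\<in>set (halves es). y k * G t (pr k) k)"
      using finite_H halves_sub no_edge by (intro sum.mono_neutral_right) auto
    also have "\<dots> = (\<Sum>k\<leftarrow>halves es. y k * G t (pr k) k)"
      using distinct_halves by (simp add: sum_list_distinct_conv_sum_set)
    also have "\<dots> = (\<Sum>e\<leftarrow>es. y (fst e) * G t (pr (fst e)) (fst e)
        + y (fst (snd e)) * G t (pr (fst (snd e))) (fst (snd e)))"
      by (rule sum_list_halves)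
    also have "\<dots> = (\<Sum>e\<leftarrow>es. -2 * (snd (snd e) * G t (fst e) (fst (snd e))))"
    proof (rule arg_cong[where f = sum_list], rule map_cong[OF refl])
      fix e assume e: "e \<in> set es"
      obtain a b w where [simp]: "e = (a, b, w)" by (cases e)
      have ab: "pr a = b" "pr b = a" "y a = w" "y b = - w" using edge e by auto
      have "G t b a = - G t a b"
      proof (cases "a = b")
        case True
        then show ?thesis by (simp add: G_def cre_same Phi_def)
      next
        case False
        then have "cre b (cre a ?E) = (\<lambda>T. -1 * cre a (cre b ?E) T)"
          by (subst cre_cre) auto
        then show ?thesis unfolding G_def by (simp add: Phi_def sum_negf)
      qed
      then show "y (fst e) * G t (pr (fst e)) (fst e) + y (fst (snd e)) * G t (pr (fst (snd e))) (fst (snd e))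
          = -2 * (snd (snd e) * G t (fst e) (fst (snd e)))"
        using ab by simp
    qed
    finally show ?thesis by (simp only: sum_list_const_mult)
  qed
  ultimately show ?thesis by simp
qed

lemma mtrace_trans_bound: "\<bar>mtrace H step_matrix n\<bar> \<le> real (card H) * \<rho> ^ n"
  using norm_bound by (intro mtrace_bound[OF finite_H rho(1)]) (simp_all add: step_matrix_def)

text \<open>Putting \<open>l = k\<close> and summing closes the chain: the edge factor
  \<open>y k\<close> and the last covariance form one more step, so the power \<open>r\<close> of
  the matrix becomes the trace of the power \<open>Suc r\<close>.\<close>

lemma trace_G_series:
  assumes "0 \<le> t" "t \<le> 1"
  shows "(\<lambda>r. t ^ r * mtrace H step_matrix (Suc r) * Z t) sums (\<Sum>k\<in>H. y k * G t (pr k) k)"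
proof -
  let ?P = "mpow H step_matrix"
  have 1: "(\<lambda>r. y k * (t ^ r * (\<Sum>g\<in>H. ?P r (pr k) g * A g k) * Z t)) sums (y k * G t (pr k) k)"
    if "k \<in> H" for k
  proof (cases "y k = 0")
    case False
    show ?thesis by (intro sums_mult G_series pr_H that False assms)
  qed simp
  have "(\<lambda>r. \<Sum>k\<in>H. y k * (t ^ r * (\<Sum>g\<in>H. ?P r (pr k) g * A g k) * Z t)) sums (\<Sum>k\<in>H. y k * G t (pr k) k)"
    by (intro sums_sum 1)
  moreover have "(\<Sum>k\<in>H. y k * (t ^ r * (\<Sum>g\<in>H. ?P r (pr k) g * A g k) * Z t)) = t ^ r * mtrace H step_matrix (Suc r) * Z t" for r
  proof -
    have "mtrace H step_matrix (Suc r) = (\<Sum>h\<in>H. \<Sum>k\<in>H. A h k * y k * ?P r (pr k) h)"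
      unfolding mtrace_def by (simp add: step_matrix_apply)
    also have "\<dots> = (\<Sum>k\<in>H. y k * (\<Sum>g\<in>H. ?P r (pr k) g * A g k))"
      by (subst sum.swap) (simp add: sum_distrib_left mult_ac)
    finally show ?thesis by (simp add: sum_distrib_left sum_distrib_right mult_ac)
  qed
  ultimately show ?thesis by simp
qed

text \<open>With \<open>S\<close> the series of traces divided by their order,
  \<open>Z * exp (S / 2)\<close> has derivative zero by \<open>Z_derivative\<close> and therefore
  keeps its value at \<open>t = 0\<close>. This never divides by \<open>Z\<close>.\<close>

theorem Z_trace_formula:
  "summable (\<lambda>r. mtrace H step_matrix (Suc r) / real (Suc r))"
  "Z 1 = exp (- (1/2) * (\<Sum>r. mtrace H step_matrix (Suc r) / real (Suc r)))"
proof -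
  define c where "c n = (if n = 0 then 0 else mtrace H step_matrix n / real n)" for n
  have cb: "\<bar>c n\<bar> \<le> real (card H) * \<rho> ^ n" for n
  proof (cases "n = 0")
    case False
    have "\<bar>mtrace H step_matrix n\<bar> / real n \<le> \<bar>mtrace H step_matrix n\<bar> / 1"
      using False by (intro divide_left_mono) auto
    then show ?thesis using mtrace_trans_bound[of n] False by (simp add: c_def)
  qed (simp add: c_def)
  \<comment> \<open>Convergence at some \<open>K\<close> beyond \<open>1\<close> allows termwise
    differentiation up to and including \<open>t = 1\<close>.\<close>
  obtain K where K: "1 < K" "\<rho> * K < 1"
  proof (cases "\<rho> = 0")
    case False
    then have "1 < 1 / \<rho>" using rho by simp
    then obtain K where "1 < K" "K < 1 / \<rho>" using dense by blast
    then show ?thesis using that[of K] False rho by (simp add: field_simps)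
  qed (use that[of 2] in simp)
  have sK: "summable (\<lambda>n. c n * K ^ n)"
  proof (rule summable_comparison_test')
    show "summable (\<lambda>n. real (card H) * (\<rho> * K) ^ n)"
      using K rho by (intro summable_mult summable_geometric) (auto simp: abs_mult)
    show "norm (c n * K ^ n) \<le> real (card H) * (\<rho> * K) ^ n" if "n \<ge> 0" for n
    proof -
      have "norm (c n * K ^ n) = \<bar>c n\<bar> * K ^ n" using K by (simp add: abs_mult)
      also have "\<dots> \<le> (real (card H) * \<rho> ^ n) * K ^ n" using K by (intro mult_right_mono cb) auto
      finally show ?thesis by (simp add: power_mult_distrib mult_ac)
    qed
  qed
  define S where "S t = (\<Sum>n. c n * t ^ n)" for t
  have dS: "(S has_real_derivative (\<Sum>n. diffs c n * t ^ n)) (at t)" if "\<bar>t\<bar> < K" for t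
    unfolding S_def[abs_def] using that K by (intro termdiffs_strong[OF sK]) auto
  have diffs: "diffs c n = mtrace H step_matrix (Suc n)" for n
    by (simp add: diffs_def c_def)
  have dh: "((\<lambda>t. Z t * exp (1/2 * S t)) has_real_derivative 0) (at t)" if t: "0 \<le> t" "t \<le> 1" for t
  proof -
    have "(\<lambda>r. mtrace H step_matrix (Suc r) * t ^ r) sums (\<Sum>n. diffs c n * t ^ n)"
      using termdiff_converges[of t K c] t K summable_sums[of "\<lambda>n. diffs c n * t ^ n"]
        powser_inside[OF sK] by (auto simp: diffs)
    then have "(\<lambda>r. mtrace H step_matrix (Suc r) * t ^ r * Z t) sums ((\<Sum>n. diffs c n * t ^ n) * Z t)"
      by (rule sums_mult2)
    then have "(\<Sum>k\<in>H. y k * G t (pr k) k) = (\<Sum>n. diffs c n * t ^ n) * Z t"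
      using trace_G_series[OF t] by (simp add: sums_iff mult_ac)
    then have dZ: "(Z has_real_derivative (- (1/2) * ((\<Sum>n. diffs c n * t ^ n) * Z t))) (at t)"
      using Z_derivative[of t] by simp
    have "\<bar>t\<bar> < K" using t K by simp
    from dS[OF this] dZ show ?thesis
      by (auto intro!: derivative_eq_intros simp: algebra_simps)
  qed
  have "Z 1 * exp (1/2 * S 1) = Z 0 * exp (1/2 * S 0)"
  proof (rule DERIV_isconst2[where a = 0 and b = "1::real"])
    show "continuous_on {0..1} (\<lambda>t. Z t * exp (1/2 * S t))"
      using dh by (auto intro!: continuous_at_imp_continuous_on DERIV_isCont)
  qed (use dh in auto)
  moreover have "S 0 = 0" unfolding S_def by (simp add: powser_zero) (simp add: c_def)
  moreover have "Z 0 = 1" by (simp add: Z_def edge_exp_scaled_zero Phi_vacuum del: edge_exp.simps)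
  ultimately have Z1: "Z 1 = exp (- (1/2) * S 1)"
    by (simp add: exp_minus field_simps)
  have s1: "summable c" using powser_inside[OF sK, of 1] K by simp
  then show "summable (\<lambda>r. mtrace H step_matrix (Suc r) / real (Suc r))"
    by (subst (asm) summable_Suc_iff[symmetric]) (simp add: c_def)
  have "S 1 = (\<Sum>r. mtrace H step_matrix (Suc r) / real (Suc r))"
  proof -
    have "S 1 = suminf c" by (simp add: S_def)
    moreover have "c 0 = 0" "c (Suc r) = mtrace H step_matrix (Suc r) / real (Suc r)" for r
      by (simp_all add: c_def)
    ultimately show ?thesis using suminf_split_head[OF s1] by simp
  qed
  with Z1 show "Z 1 = exp (- (1/2) * (\<Sum>r. mtrace H step_matrix (Suc r) / real (Suc r)))" by simp
qed

end

section \<open>Half-edges of the dual lattice\<close>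

type_synonym half = "pt \<times> nat"

text \<open>A half-edge is a dual vertex with a direction: 0 is left, 1 down, 2 right, 3 up. This is the
  counterclockwise order, cut open to the left; the Kac--Ward phases depend on it.\<close>
definition opp :: "nat \<Rightarrow> nat" where
  "opp e = (e + 2) mod 4"

definition nbr :: "pt \<Rightarrow> nat \<Rightarrow> pt" where
  "nbr v e = (if e = 0 then (fst v - 1, snd v) else if e = 1 then (fst v, snd v - 1)
     else if e = 2 then (fst v + 1, snd v) else (fst v, snd v + 1))"

definition pair :: "half \<Rightarrow> half" where
  "pair h = (nbr (fst h) (snd h), opp (snd h))"

text \<open>The half-edges at one vertex are consecutive in this order, so another vertex affects a
  sign only through the parity of its half-edges; this is what \<open>sg_local\<close>
  exploits.\<close>

definition hlt :: "half \<Rightarrow> half \<Rightarrow> bool" where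
  "hlt h k \<longleftrightarrow> snd (fst h) < snd (fst k) \<or> snd (fst h) = snd (fst k) \<and>
     (fst (fst h) < fst (fst k) \<or> fst (fst h) = fst (fst k) \<and> snd h < snd k)"

interpretation hg: grassmann hlt
  by unfold_locales (auto simp: hlt_def prod_eq_iff)

definition Hs :: "pt set \<Rightarrow> half set" where
  "Hs R = R \<times> {0, 1, 2, 3}"

text \<open>Iterated equality of Booleans is a parity: it holds iff an even number of the four
  memberships hold.\<close>

definition even_at :: "half set \<Rightarrow> pt \<Rightarrow> bool" where
  "even_at T v \<longleftrightarrow> (((v, 0) \<in> T) = ((v, 1) \<in> T)) = (((v, 2) \<in> T) = ((v, 3) \<in> T))"

definition evenT :: "half set \<Rightarrow> bool" where
  "evenT T \<longleftrightarrow> (\<forall>v. even_at T v)"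

text \<open>The antisymmetric matrix with ones above the diagonal. All its Pfaffians of even order
  are \<open>1\<close>, so its Wick functional is the indicator of the even sets.\<close>

definition Am :: "half \<Rightarrow> half \<Rightarrow> real" where
  "Am h k = (if fst h = fst k then (if snd h < snd k then 1 else if snd k < snd h then -1 else 0) else 0)"

abbreviation sgb :: "bool \<Rightarrow> real" where
  "sgb P \<equiv> (if P then -1 else 1)"

lemma prod_Hs:
  fixes f :: "half \<Rightarrow> real"
  assumes "finite R" "T \<subseteq> Hs R"
  shows "(\<Prod>k\<in>T. f k) = (\<Prod>w\<in>R. \<Prod>e\<in>{0,1,2,3}. if (w, e) \<in> T then f (w, e) else 1)"
proof -
  have "(\<Prod>k\<in>T. f k) = (\<Prod>k\<in>Hs R. if k \<in> T then f k else 1)"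
    using assms by (intro prod.mono_neutral_cong_left) (auto simp: Hs_def)
  also have "\<dots> = (\<Prod>w\<in>R. \<Prod>e\<in>{0,1,2,3}. if (w, e) \<in> T then f (w, e) else 1)"
    unfolding Hs_def by (rule prod.cartesian_product')
  finally show ?thesis .
qed

lemma sg_local:
  assumes R: "finite R" "T \<subseteq> Hs R" "v \<in> R"
    and ev: "\<And>w. w \<noteq> v \<Longrightarrow> even_at T w"
  shows "hg.sg (v, e) T = (\<Prod>e'\<in>{0,1,2,3}. sgb ((v, e') \<in> T \<and> e' < e))"
proof -
  let ?f = "\<lambda>w. \<Prod>e'\<in>{0,1,2,3}. if (w, e') \<in> T then sgb (hlt (w, e') (v, e)) else 1"
  have "hg.sg (v, e) T = (\<Prod>w\<in>R. ?f w)"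
    unfolding hg.sg_def by (rule prod_Hs[OF R(1,2)])
  also have "\<dots> = ?f v * (\<Prod>w\<in>R - {v}. ?f w)"
    using R by (simp add: prod.remove)
  also have "(\<Prod>w\<in>R - {v}. ?f w) = 1"
  proof (rule prod.neutral, rule ballI)
    fix w assume "w \<in> R - {v}"
    then have w: "w \<noteq> v" by auto
    have "hlt (w, e') (v, e) = hlt (w, 0) (v, 0)" for e'
      using w by (auto simp: hlt_def prod_eq_iff)
    then show "?f w = 1" using ev[OF w] by (auto simp: even_at_def)
  qed
  also have "?f v = (\<Prod>e'\<in>{0,1,2,3}. sgb ((v, e') \<in> T \<and> e' < e))"
    by (intro prod.cong refl) (simp add: hlt_def)
  finally show ?thesis by (simp only: mult_1_right)
qed

text \<open>Removing the elements of an odd set one at a time gives alternating signs with sum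
  \<open>1\<close>. Elements below \<open>e\<close> enter with the opposite sign, and subtracting
  their part twice leaves the sign of \<open>e\<close>, or zero if \<open>e\<close> belongs to the
  set. With four directions this is a finite check.\<close>

lemma wick_Am_local:
  fixes p :: "nat \<Rightarrow> bool"
  assumes "e \<in> {0, 1, 2, 3}"
  shows "(if \<not> p e then (\<Prod>f\<in>{0,1,2,3}. sgb (p f \<and> f < e)) *
        of_bool ((((p(e := True)) 0) = ((p(e := True)) 1)) = (((p(e := True)) 2) = ((p(e := True)) 3))) else 0) =
      (\<Sum>e'\<in>{0,1,2,3}. if p e' then (if e < e' then 1 else if e' < e then -1 else 0) *
        (\<Prod>f\<in>{0,1,2,3}. sgb (p f \<and> f < e')) *
        of_bool ((((p(e' := False)) 0) = ((p(e' := False)) 1)) = (((p(e' := False)) 2) = ((p(e' := False)) 3))) else 0)"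
proof -
  consider "e = 0" | "e = 1" | "e = 2" | "e = 3" using assms by auto
  then show ?thesis
    by cases (cases "p 0"; cases "p 1"; cases "p 2"; cases "p 3"; simp)+
qed

text \<open>Both sides vanish if a vertex other than that of \<open>h\<close> is odd; otherwise only
  the four half-edges at that vertex matter.\<close>

lemma wick_Am:
  assumes R: "finite R" and T: "T \<subseteq> Hs R" and h: "h \<in> Hs R"
  shows "(if h \<notin> T then hg.sg h T * of_bool (evenT (insert h T)) else 0) =
    (\<Sum>k\<in>T. Am h k * hg.sg k T * of_bool (evenT (T - {k})))"
proof -
  obtain v e where ve: "h = (v, e)" "v \<in> R" "e \<in> {0,1,2,3}" using h by (auto simp: Hs_def)
  have "finite T" using T R finite_subset unfolding Hs_def by blast
  have "(\<Sum>k\<in>T. Am h k * hg.sg k T * of_bool (evenT (T - {k}))) =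
    (\<Sum>k\<in>{v} \<times> {0,1,2,3}. if k \<in> T then Am h k * hg.sg k T * of_bool (evenT (T - {k})) else 0)"
    using T ve R \<open>finite T\<close> by (intro sum.mono_neutral_cong) (auto simp: Hs_def Am_def)
  also have "\<dots> = (\<Sum>e'\<in>{0,1,2,3}. if (v, e') \<in> T then Am h (v, e') * hg.sg (v, e') T * of_bool (evenT (T - {(v, e')})) else 0)"
    unfolding sum.cartesian_product' by simp
  finally have S: "(\<Sum>k\<in>T. Am h k * hg.sg k T * of_bool (evenT (T - {k}))) =
    (\<Sum>e'\<in>{0,1,2,3}. if (v, e') \<in> T then Am h (v, e') * hg.sg (v, e') T * of_bool (evenT (T - {(v, e')})) else 0)" .
  show ?thesis
  proof (cases "\<forall>w. w \<noteq> v \<longrightarrow> even_at T w")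
    case True
    have loc: "evenT X \<longleftrightarrow> even_at X v" if "\<And>w e'. w \<noteq> v \<Longrightarrow> (w, e') \<in> X \<longleftrightarrow> (w, e') \<in> T" for X
    proof -
      have "even_at X w = even_at T w" if "w \<noteq> v" for w
        using that \<open>\<And>w e'. w \<noteq> v \<Longrightarrow> (w, e') \<in> X \<longleftrightarrow> (w, e') \<in> T\<close> by (simp add: even_at_def)
      then show ?thesis unfolding evenT_def using True by metis
    qed
    have ins: "evenT (insert (v, e) T) \<longleftrightarrow> even_at (insert (v, e) T) v"
      by (rule loc) auto
    have rem: "evenT (T - {(v, e')}) \<longleftrightarrow> even_at (T - {(v, e')}) v" for e'
      by (rule loc) auto
    have sg: "hg.sg (v, e') T = (\<Prod>f\<in>{0,1,2,3}. sgb ((v, f) \<in> T \<and> f < e'))" for e'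
      using True by (intro sg_local[OF R T ve(2)]) auto
    have evi: "even_at (insert (v, e) T) v \<longleftrightarrow> (let q = (\<lambda>f. (v, f) \<in> T)(e := True) in (q 0 = q 1) = (q 2 = q 3))"
      by (simp only: even_at_def Let_def fun_upd_def insert_iff prod.inject) simp
    have evr: "even_at (T - {(v, e')}) v \<longleftrightarrow> (let q = (\<lambda>f. (v, f) \<in> T)(e' := False) in (q 0 = q 1) = (q 2 = q 3))" for e'
      by (simp only: even_at_def Let_def fun_upd_def Diff_iff singleton_iff prod.inject) simp
    have Am': "Am (v, e) (v, e') = (if e < e' then 1 else if e' < e then -1 else 0)" for e'
      by (simp add: Am_def)
    show ?thesis
      unfolding S unfolding ve(1) ins rem sg evi evr Am' Let_def
      by (rule wick_Am_local[OF ve(3), of "\<lambda>f. (v, f) \<in> T"])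
  next
    case False
    then obtain w where w: "w \<noteq> v" "\<not> even_at T w" by blast
    have "even_at (insert (v, e) T) w = even_at T w" "even_at (T - {(v, e')}) w = even_at T w" for e'
      using w(1) by (simp_all add: even_at_def)
    then have "\<not> evenT (insert (v, e) T)" "\<not> evenT (T - {(v, e')})" for e'
      unfolding evenT_def using w(2) by blast+
    then show ?thesis unfolding S unfolding ve(1) by simp
  qed
qed

text \<open>The vertices decouple, and \<open>1 + sqrt 2\<close>, the cotangent of
  \<open>pi / 8\<close>, is the largest singular value of the four by four sign matrix.\<close>

lemma Am_norm:
  fixes f :: "half \<Rightarrow> real"
  assumes R: "finite R"
  shows "(\<Sum>h\<in>Hs R. (\<Sum>k\<in>Hs R. Am h k * f k)\<^sup>2) \<le> (1 + sqrt 2)\<^sup>2 * (\<Sum>k\<in>Hs R. (f k)\<^sup>2)"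
proof -
  have 1: "(\<Sum>k\<in>Hs R. Am (v, e) k * f k) = (\<Sum>e'\<in>{0,1,2,3}. Am (v, e) (v, e') * f (v, e'))"
    if "v \<in> R" for v e
  proof -
    have "(\<Sum>k\<in>Hs R. Am (v, e) k * f k) = (\<Sum>k\<in>{v} \<times> {0,1,2,3}. Am (v, e) k * f k)"
      using that R by (intro sum.mono_neutral_right) (auto simp: Hs_def Am_def)
    also have "\<dots> = (\<Sum>e'\<in>{0,1,2,3}. Am (v, e) (v, e') * f (v, e'))"
      unfolding sum.cartesian_product' by simp
    finally show ?thesis .
  qed
  have sos: "(q1 + q2 + q3)\<^sup>2 + (- q0 + q2 + q3)\<^sup>2 + (- q0 - q1 + q3)\<^sup>2 + (- q0 - q1 - q2)\<^sup>2
     \<le> (1 + sqrt 2)\<^sup>2 * (q0\<^sup>2 + q1\<^sup>2 + q2\<^sup>2 + q3\<^sup>2)" for q0 q1 q2 q3 :: real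
  proof -
    define s where "s = sqrt 2"
    have s: "s * s = 2" "s \<ge> 0" by (simp_all add: s_def)
    \<comment> \<open>The gap between the two sides of the claim is exactly \<open>s\<close> times
      this sum of two squares.\<close>
    have "0 \<le> s * ((q0 + q2 - s * q1)\<^sup>2 + (q2 - q0 - s * q3)\<^sup>2)"
      using s by (intro mult_nonneg_nonneg add_nonneg_nonneg) auto
    also have "\<dots> = 2 * s * (q0\<^sup>2 + q2\<^sup>2) + s * (s * s) * (q1\<^sup>2 + q3\<^sup>2)
        - 2 * (s * s) * (q0 * q1 + q1 * q2 + q2 * q3 - q0 * q3)"
      by (simp add: power2_eq_square algebra_simps)
    also have "\<dots> = (1 + 2 * s + s * s) * (q0\<^sup>2 + q1\<^sup>2 + q2\<^sup>2 + q3\<^sup>2)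
        - ((q1 + q2 + q3)\<^sup>2 + (- q0 + q2 + q3)\<^sup>2 + (- q0 - q1 + q3)\<^sup>2 + (- q0 - q1 - q2)\<^sup>2)"
      unfolding s(1) by (simp add: power2_eq_square algebra_simps)
    finally show ?thesis unfolding s_def[symmetric] by (simp add: power2_eq_square algebra_simps)
  qed
  have sum_Hs: "(\<Sum>k\<in>Hs R. q k) = (\<Sum>v\<in>R. \<Sum>e\<in>{0,1,2,3}. q (v, e))" for q :: "half \<Rightarrow> real"
    unfolding Hs_def by (rule sum.cartesian_product')
  have "(\<Sum>e\<in>{0,1,2,3}. (\<Sum>k\<in>Hs R. Am (v, e) k * f k)\<^sup>2)
       \<le> (1 + sqrt 2)\<^sup>2 * (\<Sum>e\<in>{0,1,2,3}. (f (v, e))\<^sup>2)" if v: "v \<in> R" for v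
  proof -
    have "(\<Sum>e\<in>{0,1,2,3}. (\<Sum>k\<in>Hs R. Am (v, e) k * f k)\<^sup>2) =
      (f (v, 1) + f (v, 2) + f (v, 3))\<^sup>2 + (- f (v, 0) + f (v, 2) + f (v, 3))\<^sup>2
       + (- f (v, 0) - f (v, 1) + f (v, 3))\<^sup>2 + (- f (v, 0) - f (v, 1) - f (v, 2))\<^sup>2"
      unfolding 1[OF v] by (simp add: Am_def power2_eq_square algebra_simps)
    then show ?thesis using sos[of "f (v, 1)" "f (v, 2)" "f (v, 3)" "f (v, 0)"] by (simp add: add_ac)
  qed
  then have "(\<Sum>v\<in>R. \<Sum>e\<in>{0,1,2,3}. (\<Sum>k\<in>Hs R. Am (v, e) k * f k)\<^sup>2)
       \<le> (\<Sum>v\<in>R. (1 + sqrt 2)\<^sup>2 * (\<Sum>e\<in>{0,1,2,3}. (f (v, e))\<^sup>2))"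
    by (rule sum_mono)
  then show ?thesis
    by (simp only: sum_Hs[of "\<lambda>h. (\<Sum>k\<in>Hs R. Am h k * f k)\<^sup>2"] sum_Hs[of "\<lambda>k. (f k)\<^sup>2"]
        sum_distrib_left)
qed

section \<open>Pairing of half-edges and the norm of the Kac--Ward matrix\<close>

lemma direction_cases:
  assumes "e < (4::nat)" obtains "e = 0" | "e = 1" | "e = 2" | "e = 3"
  using assms by linarith

lemma pair_pair: "snd k < 4 \<Longrightarrow> pair (pair k) = k"
  by (cases k, elim direction_cases) (auto simp: pair_def nbr_def opp_def)

lemma Hs_snd: "k \<in> Hs R \<Longrightarrow> snd k < 4"
  by (auto simp: Hs_def)

text \<open>\<open>pair\<close> permutes the half-edges whose partner lies in \<open>Hs R\<close>,
  and \<open>y\<close> vanishes on the others.\<close>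

lemma pair_norm:
  assumes R: "finite R" and y: "\<And>k. \<bar>y k\<bar> \<le> x"
    and y0: "\<And>k. k \<in> Hs R \<Longrightarrow> pair k \<notin> Hs R \<Longrightarrow> y k = 0"
  shows "(\<Sum>k\<in>Hs R. (y k * f (pair k))\<^sup>2) \<le> x\<^sup>2 * (\<Sum>k\<in>Hs R. (f k :: real)\<^sup>2)"
proof -
  have fin: "finite (Hs R)" using R by (simp add: Hs_def)
  have pp: "pair (pair k) = k" if "k \<in> Hs R" for k
    using Hs_snd pair_pair that by blast
  let ?P = "{k \<in> Hs R. pair k \<in> Hs R}"
  have "(\<Sum>k\<in>Hs R. (y k * f (pair k))\<^sup>2) = (\<Sum>k\<in>?P. (y k * f (pair k))\<^sup>2)"
    using fin y0 by (intro sum.mono_neutral_right) auto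
  also have "\<dots> \<le> (\<Sum>k\<in>?P. x\<^sup>2 * (f (pair k))\<^sup>2)"
    using y by (intro sum_mono) (auto simp: power_mult_distrib abs_le_square_iff[symmetric] intro!: mult_right_mono order_trans[OF y])
  also have "\<dots> = (\<Sum>k\<in>?P. x\<^sup>2 * (f k)\<^sup>2)"
    by (rule sum.reindex_bij_witness[of _ pair pair]) (auto simp: pp simp del: split_paired_All)
  also have "\<dots> \<le> (\<Sum>k\<in>Hs R. x\<^sup>2 * (f k)\<^sup>2)"
    using fin by (intro sum_mono2) auto
  finally show ?thesis by (simp add: sum_distrib_left)
qed

text \<open>Vertical edges get a negative sign from their lower half; it cancels the sign found in
  \<open>vertical_sign\<close> below.\<close>
definition bsgn :: "nat \<Rightarrow> real" where
  "bsgn e = (if e = 1 \<or> e = 2 then 1 else -1)"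

definition yw :: "pt set \<Rightarrow> (half \<Rightarrow> real) \<Rightarrow> half \<Rightarrow> real" where
  "yw R x k = (if pair k \<in> Hs R then bsgn (snd k) * x k else 0)"

text \<open>Indices are arrivals: from \<open>h\<close> the path turns to another half-edge
  \<open>k\<close> of the same vertex and arrives at \<open>pair k\<close>. Since
  \<open>Am h h = 0\<close>, it cannot turn back.\<close>

definition kw :: "pt set \<Rightarrow> (half \<Rightarrow> real) \<Rightarrow> half \<Rightarrow> half \<Rightarrow> real" where
  "kw R x h g = (\<Sum>k\<in>Hs R. Am h k * yw R x k * of_bool (pair k = g))"

lemma kw_norm:
  assumes R: "finite R" and x: "\<And>k. \<bar>x k\<bar> \<le> x0"
  shows "(\<Sum>h\<in>Hs R. (\<Sum>g\<in>Hs R. kw R x h g * f g)\<^sup>2) \<le> (x0 * (1 + sqrt 2))\<^sup>2 * (\<Sum>g\<in>Hs R. (f g)\<^sup>2)"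
proof -
  have x0: "0 \<le> x0" using x[of undefined] by linarith
  have fin: "finite (Hs R)" using R by (simp add: Hs_def)
  have 1: "(\<Sum>g\<in>Hs R. kw R x h g * f g) = (\<Sum>k\<in>Hs R. Am h k * (yw R x k * f (pair k)))" for h
  proof -
    have 0: "(\<Sum>g\<in>Hs R. yw R x k * of_bool (pair k = g) * f g) = yw R x k * f (pair k)" for k
    proof -
      have "(\<Sum>g\<in>Hs R. yw R x k * of_bool (pair k = g) * f g) = (\<Sum>g\<in>Hs R. if pair k = g then yw R x k * f g else 0)"
        by (intro sum.cong) auto
      then show ?thesis using fin by (simp add: yw_def)
    qed
    have "(\<Sum>g\<in>Hs R. kw R x h g * f g) = (\<Sum>k\<in>Hs R. Am h k * (\<Sum>g\<in>Hs R. yw R x k * of_bool (pair k = g) * f g))"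
      unfolding kw_def sum_distrib_right sum_distrib_left by (subst sum.swap) (simp add: mult_ac)
    then show ?thesis by (simp only: 0)
  qed
  have "(\<Sum>h\<in>Hs R. (\<Sum>g\<in>Hs R. kw R x h g * f g)\<^sup>2) \<le> (1 + sqrt 2)\<^sup>2 * (\<Sum>k\<in>Hs R. (yw R x k * f (pair k))\<^sup>2)"
    unfolding 1 by (rule Am_norm[OF R])
  also have "\<dots> \<le> (1 + sqrt 2)\<^sup>2 * (x0\<^sup>2 * (\<Sum>k\<in>Hs R. (f k)\<^sup>2))"
    using x x0 by (intro mult_left_mono pair_norm R) (auto simp: yw_def bsgn_def abs_mult)
  finally show ?thesis by (simp add: power_mult_distrib mult_ac)
qed

section \<open>Even subgraphs of a rectangle\<close>

context grassmann
begin

section \<open>Coefficients of the edge exponential\<close>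

lemma edge_exp_support: "edge_exp es T \<noteq> 0 \<Longrightarrow> T \<subseteq> set (halves es)"
proof (induction es arbitrary: T)
  case Nil
  then show ?case by (auto split: if_splits)
next
  case (Cons e es)
  obtain a b y where e: "e = (a, b, y)" by (cases e)
  from Cons.prems have "edge_exp es T \<noteq> 0 \<or> cre a (cre b (edge_exp es)) T \<noteq> 0"
    by (auto simp: e)
  then show ?case
  proof
    assume "edge_exp es T \<noteq> 0"
    from Cons.IH[OF this] show ?thesis by (auto simp: e)
  next
    assume "cre a (cre b (edge_exp es)) T \<noteq> 0"
    then have "edge_exp es (T - {a} - {b}) \<noteq> 0" by (auto simp: cre_def split: if_splits)
    from Cons.IH[OF this] show ?thesis by (auto simp: e)
  qed
qed

lemma edge_exp_closed:
  assumes "edge_exp es T \<noteq> 0" "distinct (halves es)" "(a, b, y) \<in> set es"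
  shows "a \<in> T \<longleftrightarrow> b \<in> T"
  using assms
proof (induction es arbitrary: T)
  case Nil
  then show ?case by simp
next
  case (Cons e es)
  obtain c d z where e: "e = (c, d, z)" by (cases e)
  from Cons.prems have "edge_exp es T \<noteq> 0 \<or> cre c (cre d (edge_exp es)) T \<noteq> 0"
    by (auto simp: e)
  then show ?case
  proof
    assume nz: "edge_exp es T \<noteq> 0"
    show ?thesis
    proof (cases "(a, b, y) \<in> set es")
      case True
      then show ?thesis using Cons.IH[OF nz] Cons.prems e by auto
    next
      case False
      then have "a = c" "b = d" using Cons.prems e by auto
      then show ?thesis using edge_exp_support[OF nz] Cons.prems(2) e by auto
    qed
  next
    assume nz: "cre c (cre d (edge_exp es)) T \<noteq> 0"
    then have cd: "c \<in> T" "d \<in> T" and nz': "edge_exp es (T - {c} - {d}) \<noteq> 0"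
      by (auto simp: cre_def split: if_splits)
    show ?thesis
    proof (cases "(a, b, y) \<in> set es")
      case True
      then have "a \<in> T - {c} - {d} \<longleftrightarrow> b \<in> T - {c} - {d}"
        using Cons.IH[OF nz'] Cons.prems e by auto
      moreover have "a \<noteq> c" "a \<noteq> d" "b \<noteq> c" "b \<noteq> d"
        using halves_mem[OF True] Cons.prems(2) e by auto
      ultimately show ?thesis by auto
    next
      case False
      then have "a = c" "b = d" using Cons.prems e by auto
      then show ?thesis using cd by simp
    qed
  qed
qed

text \<open>The larger half \<open>b\<close> does not precede \<open>a\<close>, and \<open>a\<close>
  has been removed when \<open>b\<close> acts, so both signs can be counted in the rest of
  \<open>T\<close>.\<close>

lemma edge_exp_Cons_in:
  assumes "finite T" "a \<in> T" "b \<in> T" "lt a b" "a \<notin> set (halves es)"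
  shows "edge_exp ((a, b, y) # es) T =
    y * (sg a (T - {a, b}) * sg b (T - {a, b})) * edge_exp es (T - {a, b})"
proof -
  have ne: "a \<noteq> b" using assms by auto
  have "edge_exp es T = 0" using edge_exp_support[of es T] assms by auto
  moreover have "T - {a, b} = T - {a} - {b}" by auto
  moreover have "sg a T = sg a (T - {a} - {b})"
    using assms ne lt_asym[OF assms(4)] by (simp add: sg_remove)
  moreover have "sg b (T - {a}) = sg b (T - {a} - {b})"
    using assms ne by (simp add: sg_remove)
  ultimately show ?thesis using assms ne by (simp add: cre_def)
qed

lemma edge_exp_Cons_notin:
  "a \<notin> T \<Longrightarrow> edge_exp ((a, b, y) # es) T = edge_exp es T"
  by (simp add: cre_def)

end

lemma ex_sorted_list:
  assumes "finite S" and tr: "\<And>x y z. lt x y \<Longrightarrow> lt y z \<Longrightarrow> lt x z"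
    and tot: "\<And>x y. x \<noteq> y \<Longrightarrow> lt x y \<or> lt y x"
  shows "\<exists>xs. set xs = S \<and> distinct xs \<and> sorted_wrt lt xs"
  using assms(1)
proof (induction S)
  case empty
  then show ?case by simp
next
  case (insert x S)
  then obtain xs where xs: "set xs = S" "distinct xs" "sorted_wrt lt xs" by blast
  let ?ys = "filter (\<lambda>y. lt y x) xs @ x # filter (\<lambda>y. \<not> lt y x) xs"
  have "set ?ys = insert x S" using xs by auto
  moreover have "distinct ?ys" using xs insert by auto
  moreover have "sorted_wrt lt ?ys"
  proof -
    have "lt x y" if "y \<in> S" "\<not> lt y x" for y using tot[of x y] that insert by auto
    then show ?thesis using xs tr by (auto simp: sorted_wrt_append intro: sorted_wrt_filter)
  qed
  ultimately show ?case by blast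
qed

definition evens :: "pt set \<Rightarrow> half set set" where
  "evens R = {T. T \<subseteq> Hs R \<and> evenT T \<and> (\<forall>k\<in>T. pair k \<in> T)}"

text \<open>Weights are read at right and up half-edges only, so that every edge is counted
  once.\<close>

definition even_sum :: "pt set \<Rightarrow> (half \<Rightarrow> real) \<Rightarrow> real" where
  "even_sum R x = (\<Sum>T\<in>evens R. (\<Prod>v | (v, 2) \<in> T. x (v, 2)) * (\<Prod>v | (v, 3) \<in> T. x (v, 3)))"

lemma evens_even_at: "T \<in> evens R \<Longrightarrow> even_at T w"
  unfolding evens_def evenT_def by blast

lemma evens_pair:
  assumes "T \<in> evens R" "snd k < 4" shows "pair k \<in> T \<longleftrightarrow> k \<in> T"
  using assms pair_pair[OF assms(2)] by (force simp: evens_def)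

lemma evens_sides:
  assumes "T \<in> evens R"
  shows "((i + 1, j), 0) \<in> T \<longleftrightarrow> ((i, j), 2) \<in> T" "((i, j + 1), 1) \<in> T \<longleftrightarrow> ((i, j), 3) \<in> T"
  using evens_pair[OF assms, of "((i, j), 2)"] evens_pair[OF assms, of "((i, j), 3)"]
  by (simp_all add: pair_def nbr_def opp_def)

lemma rect_V_iff: "(i, j) \<in> rect_V a b c d \<longleftrightarrow> a \<le> i \<and> i \<le> b \<and> c \<le> j \<and> j \<le> d"
  by (simp add: rect_V_def)

lemma rect_V_times: "rect_V a b c d = {a..b} \<times> {c..d}"
  by (auto simp: rect_V_def)

lemma finite_rect_V [simp]: "finite (rect_V a b c d)"
  by (simp add: rect_V_times)

lemma evens_in:
  assumes "T \<in> evens R" "k \<in> T" shows "fst k \<in> R" "nbr (fst k) (snd k) \<in> R"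
proof -
  have "k \<in> Hs R" "pair k \<in> Hs R" using assms by (auto simp: evens_def)
  then show "fst k \<in> R" "nbr (fst k) (snd k) \<in> R" by (auto simp: Hs_def pair_def)
qed

lemma sgb_even_at:
  "even_at T v \<Longrightarrow> sgb ((v, 2) \<in> T) = sgb ((v, 0) \<in> T) * (sgb ((v, 3) \<in> T) * sgb ((v, 1) \<in> T))"
  by (auto simp: even_at_def)

text \<open>Multiply the vertex parities over the part of row \<open>j\<close> left of
  \<open>i\<close>: a horizontal edge inside it occurs twice, and the one leaving it balances the
  vertical edges.\<close>

lemma row_cut:
  assumes T: "T \<in> evens (rect_V a b c d)" and "a \<le> i"
  shows "(\<Prod>p\<in>{a..<i}. sgb (((p, j), 3) \<in> T) * sgb (((p, j), 1) \<in> T)) = sgb (((i, j), 0) \<in> T)"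
  using assms(2)
proof (induction i rule: int_ge_induct)
  case base
  have "((a, j), 0) \<notin> T" using evens_in[OF T, of "((a, j), 0)"] by (auto simp: nbr_def rect_V_iff)
  then show ?case by simp
next
  case (step i)
  have "{a..<i + 1} = insert i {a..<i}" using step by auto
  moreover have "even_at T (i, j)" using T by (rule evens_even_at)
  ultimately show ?case
    using step sgb_even_at[of T "(i, j)"] evens_sides(1)[OF T, of i j] by (simp add: mult_ac)
qed

text \<open>No horizontal edge leaves a full row, so its upward and downward edges have the same
  parity. The induction starts at the bottom row, below which there are none.\<close>

lemma row_even:
  assumes T: "T \<in> evens (rect_V a b c d)" and "a \<le> b"
  shows "(\<Prod>p\<in>{a..b}. sgb (((p, j), 3) \<in> T)) = 1"
proof (cases "c \<le> j")
  case False
  have "((p, j), 3) \<notin> T" for p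
    using evens_in[OF T, of "((p, j), 3)"] False by (auto simp: nbr_def rect_V_iff)
  then show ?thesis by simp
next
  case True
  have full: "(\<Prod>p\<in>{a..b}. sgb (((p, j), 3) \<in> T)) = (\<Prod>p\<in>{a..b}. sgb (((p, j), 1) \<in> T))" for j
  proof -
    have eq: "{a..b} = {a..<b + 1}" by auto
    have "((b + 1, j), 0) \<notin> T"
      using evens_in[OF T, of "((b + 1, j), 0)"] by (auto simp: nbr_def rect_V_iff)
    then have 1: "(\<Prod>p\<in>{a..b}. sgb (((p, j), 3) \<in> T)) * (\<Prod>p\<in>{a..b}. sgb (((p, j), 1) \<in> T)) = 1"
      using row_cut[OF T, of "b + 1" j] assms(2) unfolding eq prod.distrib by simp
    have 2: "(\<Prod>p\<in>{a..b}. sgb (((p, j), 1) \<in> T)) * (\<Prod>p\<in>{a..b}. sgb (((p, j), 1) \<in> T)) = 1"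
      unfolding prod.distrib[symmetric] by (rule prod.neutral) simp
    have "u = d" if "u * d = 1" "d * d = 1" for u d :: real
    proof -
      have "u = u * d * d" using that(2) by (simp add: mult.assoc)
      then show ?thesis using that(1) by simp
    qed
    then show ?thesis using 1 2 by blast
  qed
  from True show ?thesis
  proof (induction j rule: int_ge_induct)
    case base
    have "((p, c), 1) \<notin> T" for p
      using evens_in[OF T, of "((p, c), 1)"] by (auto simp: nbr_def rect_V_iff)
    then show ?case by (simp add: full)
  next
    case (step j)
    then show ?case by (simp add: full[of "j + 1"] evens_sides(2)[OF T, unfolded One_nat_def])
  qed
qed

lemma finite_evens_elem: "T \<in> evens (rect_V a b c d) \<Longrightarrow> finite T"
  unfolding evens_def Hs_def by (auto intro: finite_subset)

text \<open>The half-edges lying between the two ends of a vertical edge are, up to even numbers of them at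
  each vertex, the other edges crossing the same row; there is an odd number of them.\<close>
lemma vertical_sign:
  assumes T: "T \<in> evens (rect_V a b c d)" and z: "((i, j), 3) \<in> T"
  defines "S \<equiv> {k \<in> T. snd k = 0 \<or> snd k = 2 \<or> (snd k = 3 \<and> hlt (fst k, 0) ((i, j), 0)) \<or>
       (snd k = 1 \<and> hlt (nbr (fst k) 1, 0) ((i, j), 0))}"
  shows "hg.sg ((i, j), 3) S * hg.sg ((i, j + 1), 1) S = -1"
proof -
  let ?R = "rect_V a b c d"
  let ?U = "\<lambda>w. sgb ((w, 3) \<in> T)"
  let ?f = "\<lambda>k. sgb (hlt k ((i, j), 3)) * sgb (hlt k ((i, j + 1), 1))"
  \<comment> \<open>The sign contributed by the vertex \<open>w\<close>. To the right of
    \<open>i\<close> in row \<open>j\<close>, and to the left of \<open>i\<close> in row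
    \<open>j + 1\<close>, the set \<open>S\<close> omits only the upper half-edge of
    \<open>w\<close>, and by evenness the other three have its parity. At \<open>(i, j + 1)\<close>
    only the left half-edge lies before the direction \<open>1\<close>.\<close>
  define C where "C w = (if snd w = j \<and> i < fst w \<or> snd w = j + 1 \<and> fst w < i then ?U w
      else if w = (i, j + 1) then sgb ((w, 0) \<in> T) else 1)" for w
  have zR: "(i, j) \<in> ?R" "(i, j + 1) \<in> ?R"
    using evens_in[OF T z] by (simp_all add: nbr_def)
  have "S \<subseteq> Hs ?R" using T by (auto simp: S_def evens_def)
  have "hg.sg ((i, j), 3) S * hg.sg ((i, j + 1), 1) S = (\<Prod>k\<in>S. ?f k)"
    unfolding hg.sg_def by (rule prod.distrib[symmetric])
  also have "\<dots> = (\<Prod>w\<in>?R. \<Prod>e\<in>{0,1,2,3}. if (w, e) \<in> S then ?f (w, e) else 1)"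
    by (rule prod_Hs) (use \<open>S \<subseteq> Hs ?R\<close> in auto)
  also have "\<dots> = (\<Prod>w\<in>?R. C w)"
  proof (rule prod.cong[OF refl])
    fix w assume "w \<in> ?R"
    obtain p q where w: "w = (p, q)" by (cases w)
    have ev: "even_at T w" using T by (rule evens_even_at)
    have mem: "(w, 0) \<in> S \<longleftrightarrow> (w, 0) \<in> T" "(w, 2) \<in> S \<longleftrightarrow> (w, 2) \<in> T"
      "(w, 3) \<in> S \<longleftrightarrow> (w, 3) \<in> T \<and> (q < j \<or> q = j \<and> p < i)"
      "(w, 1) \<in> S \<longleftrightarrow> (w, 1) \<in> T \<and> (q < j + 1 \<or> q = j + 1 \<and> p < i)"
      by (auto simp: S_def w hlt_def nbr_def)
    have lt: "hlt (w, e) ((i, j), 3) \<longleftrightarrow> q < j \<or> q = j \<and> (p < i \<or> p = i \<and> e < 3)"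
      "hlt (w, e) ((i, j + 1), 1) \<longleftrightarrow> q < j + 1 \<or> q = j + 1 \<and> (p < i \<or> p = i \<and> e < 1)" for e
      by (auto simp: w hlt_def)
    have Cw: "C w = (if q = j \<and> i < p \<or> q = j + 1 \<and> p < i then sgb t3 else if q = j + 1 \<and> p = i then sgb t0 else 1)"
      if "t0 = ((w, 0) \<in> T)" "t3 = ((w, 3) \<in> T)" for t0 t3
      using that by (auto simp: C_def w)
    have loc: "(if t0 then sgb (q < j \<or> q = j \<and> (p < i \<or> p = i)) * sgb (q < j + 1 \<or> q = j + 1 \<and> (p < i \<or> p = i)) else 1) *
       ((if t1 \<and> (q < j + 1 \<or> q = j + 1 \<and> p < i) then sgb (q < j \<or> q = j \<and> (p < i \<or> p = i)) * sgb (q < j + 1 \<or> q = j + 1 \<and> p < i) else 1) *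
       ((if t2 then sgb (q < j \<or> q = j \<and> (p < i \<or> p = i)) * sgb (q < j + 1 \<or> q = j + 1 \<and> p < i) else 1) *
        (if t3 \<and> (q < j \<or> q = j \<and> p < i) then sgb (q < j \<or> q = j \<and> p < i) * sgb (q < j + 1 \<or> q = j + 1 \<and> p < i) else 1)))
     = (if q = j \<and> i < p \<or> q = j + 1 \<and> p < i then sgb t3 else if q = j + 1 \<and> p = i then sgb t0 else 1)"
      if "(t0 = t1) = (t2 = t3)" for t0 t1 t2 t3
    proof -
      consider "q < j" | "q = j" | "q = j + 1" | "j + 1 < q" by linarith
      then show ?thesis
      proof cases
        case 1 then show ?thesis by simp
      next
        case 2
        consider "p < i" | "p = i" | "i < p" by linarith
        then show ?thesis using that by cases (simp_all add: 2, auto)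
      next
        case 3
        consider "p < i" | "p = i" | "i < p" by linarith
        then show ?thesis using that by cases (simp_all add: 3, auto)
      next
        case 4 then show ?thesis by simp
      qed
    qed
    show "(\<Prod>e\<in>{0,1,2,3}. if (w, e) \<in> S then ?f (w, e) else 1) = C w"
      using loc[OF ev[unfolded even_at_def]] unfolding Cw[OF refl refl] lt
      by (simp add: mem mem[unfolded One_nat_def] cong: if_cong)
  qed
  also have "\<dots> = (\<Prod>p\<in>{a..b}. \<Prod>q\<in>{c..d}. C (p, q))"
    unfolding rect_V_times by (rule prod.cartesian_product')
  also have "\<dots> = (\<Prod>p\<in>{a..b}. C (p, j) * C (p, j + 1))"
  proof (rule prod.cong[OF refl])
    fix p
    have "(\<Prod>q\<in>{c..d}. C (p, q)) = (\<Prod>q\<in>{j, j + 1}. C (p, q))"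
      using zR by (intro prod.mono_neutral_right) (auto simp: C_def rect_V_iff)
    then show "(\<Prod>q\<in>{c..d}. C (p, q)) = C (p, j) * C (p, j + 1)" by simp
  qed
  also have "{a..b} = {a..<i} \<union> insert i {i<..b}"
    using zR by (auto simp: rect_V_iff)
  also have "(\<Prod>p\<in>{a..<i} \<union> insert i {i<..b}. C (p, j) * C (p, j + 1)) =
    (\<Prod>p\<in>{a..<i}. ?U (p, j + 1)) * (sgb (((i, j + 1), 0) \<in> T) * (\<Prod>p\<in>{i<..b}. ?U (p, j)))"
    by (subst prod.union_disjoint) (auto simp: C_def intro!: arg_cong2[where f = "(*)"] prod.cong)
  \<comment> \<open>This trades the left half-edge for the vertical edges above and below row
    \<open>j + 1\<close> to the left of \<open>i\<close>; those above then occur twice and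
    cancel.\<close>
  also have "sgb (((i, j + 1), 0) \<in> T) = (\<Prod>p\<in>{a..<i}. ?U (p, j + 1)) * (\<Prod>p\<in>{a..<i}. ?U (p, j))"
    using row_cut[OF T, of i "j + 1"] zR by (simp add: prod.distrib evens_sides[OF T] evens_sides(2)[OF T, unfolded One_nat_def] rect_V_iff)
  also have "(\<Prod>p\<in>{a..<i}. ?U (p, j + 1)) * ((\<Prod>p\<in>{a..<i}. ?U (p, j + 1)) * (\<Prod>p\<in>{a..<i}. ?U (p, j))
      * (\<Prod>p\<in>{i<..b}. ?U (p, j))) = (\<Prod>p\<in>{a..<i}. ?U (p, j)) * (\<Prod>p\<in>{i<..b}. ?U (p, j))"
  proof -
    have "(\<Prod>p\<in>{a..<i}. ?U (p, j + 1)) * (\<Prod>p\<in>{a..<i}. ?U (p, j + 1)) = 1"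
      unfolding prod.distrib[symmetric] by (rule prod.neutral) simp
    then show ?thesis by (simp add: mult.assoc[symmetric])
  qed
  \<comment> \<open>What remains is the row of vertical edges at level \<open>j\<close> without the
    edge itself, and the full row is even.\<close>
  also have "\<dots> = -1"
  proof -
    have "1 = (\<Prod>p\<in>{a..b}. ?U (p, j))"
      using row_even[OF T, of j] zR by (simp add: rect_V_iff)
    also have "{a..b} = {a..<i} \<union> insert i {i<..b}"
      using zR by (auto simp: rect_V_iff)
    also have "(\<Prod>p\<in>{a..<i} \<union> insert i {i<..b}. ?U (p, j)) =
       (\<Prod>p\<in>{a..<i}. ?U (p, j)) * (?U (i, j) * (\<Prod>p\<in>{i<..b}. ?U (p, j)))"
      by (subst prod.union_disjoint) auto
    finally show ?thesis using z by simp
  qed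
  finally show ?thesis .
qed


section \<open>Ordered product over the edges of the rectangle\<close>

definition hedge :: "pt set \<Rightarrow> (half \<Rightarrow> real) \<Rightarrow> pt \<Rightarrow> half \<times> half \<times> real" where
  "hedge R x v = ((v, 2), pair (v, 2), yw R x (v, 2))"

definition vedge :: "pt set \<Rightarrow> (half \<Rightarrow> real) \<Rightarrow> pt \<Rightarrow> half \<times> half \<times> real" where
  "vedge R x v = ((v, 3), pair (v, 3), yw R x (v, 3))"

lemma pair_simps [simp]:
  "pair ((i, j), 2) = ((i + 1, j), 0)" "pair ((i, j), 3) = ((i, j + 1), 1)"
  "pair ((i, j), 0) = ((i - 1, j), 2)" "pair ((i, j), Suc 0) = ((i, j - 1), 3)"
  by (simp_all add: pair_def nbr_def opp_def)

lemma halves_hedge_Cons [simp]: "hg.halves (hedge R x (i, j) # es) = ((i, j), 2) # ((i + 1, j), 0) # hg.halves es"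
  by (simp add: hedge_def)

lemma halves_vedge_Cons [simp]: "hg.halves (vedge R x (i, j) # es) = ((i, j), 3) # ((i, j + 1), 1) # hg.halves es"
  by (simp add: vedge_def)

lemma set_halves_hedge: "((p, q), e) \<in> set (hg.halves (map (hedge R x) vs)) \<longleftrightarrow>
    e = 2 \<and> (p, q) \<in> set vs \<or> e = 0 \<and> (p - 1, q) \<in> set vs"
proof (induction vs)
  case (Cons v vs)
  then show ?case by (cases v) auto
qed simp

lemma set_halves_vedge: "((p, q), e) \<in> set (hg.halves (map (vedge R x) vs)) \<longleftrightarrow>
    e = 3 \<and> (p, q) \<in> set vs \<or> e = 1 \<and> (p, q - 1) \<in> set vs"
proof (induction vs)
  case (Cons v vs)
  then show ?case by (cases v) auto
qed simp

lemma halves_append: "hg.halves (xs @ ys) = hg.halves xs @ hg.halves ys"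
  by (simp add: hg.halves_def)

lemma distinct_halves_edges:
  assumes "distinct vs" "distinct hs"
  shows "distinct (hg.halves (map (vedge R x) vs @ map (hedge R x) hs))"
proof -
  have "distinct (hg.halves (map (vedge R x) vs))"
    using assms(1)
  proof (induction vs)
    case (Cons v vs)
    then show ?case by (cases v) (auto simp: set_halves_vedge)
  qed simp
  moreover have "distinct (hg.halves (map (hedge R x) hs))"
    using assms(2)
  proof (induction hs)
    case (Cons v vs)
    then show ?case by (cases v) (auto simp: set_halves_hedge)
  qed simp
  moreover have "set (hg.halves (map (vedge R x) vs)) \<inter> set (hg.halves (map (hedge R x) hs)) = {}"
    by (auto simp: set_halves_vedge set_halves_hedge)
  ultimately show ?thesis
    unfolding halves_append distinct_append by blast
qed

lemma edge_exp_Cons_evens: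
  assumes T: "T \<in> evens (rect_V a b c d)" and k: "snd k < 4" "hlt k (pair k)"
    and new: "k \<notin> set (hg.halves es)" "pair k \<notin> set (hg.halves es)"
  defines "T' \<equiv> T \<inter> set (hg.halves es)"
  shows "hg.edge_exp ((k, pair k, y) # es) (T \<inter> set (hg.halves ((k, pair k, y) # es))) =
    (if k \<in> T then y * (hg.sg k T' * hg.sg (pair k) T') else 1) * hg.edge_exp es T'"
proof -
  let ?T = "T \<inter> set (hg.halves ((k, pair k, y) # es))"
  have sides: "pair k \<in> T \<longleftrightarrow> k \<in> T" by (rule evens_pair[OF T k(1)])
  show ?thesis
  proof (cases "k \<in> T")
    case False
    then have eq: "?T = T'" unfolding T'_def using sides by auto
    have "k \<notin> T'" using False by (simp add: T'_def)
    from hg.edge_exp_Cons_notin[OF this] show ?thesis unfolding eq using False by simp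
  next
    case True
    have "?T - {k, pair k} = T'" unfolding T'_def using new by auto
    moreover have "finite ?T" using finite_evens_elem[OF T] by simp
    ultimately show ?thesis
      using hg.edge_exp_Cons_in[of ?T k "pair k" es y] True sides k(2) new(1) by simp
  qed
qed

text \<open>\<open>edge_exp\<close> places the tail of its list first. Hence all horizontal edges
  are placed before the vertical ones, and these in increasing order of their lower ends, since
  \<open>vs\<close> is sorted downwards. The half-edges already placed then form the set
  \<open>S\<close> of \<open>vertical_sign\<close>.\<close>

locale rect_edges =
  fixes a b c d :: int and x :: "half \<Rightarrow> real" and vs hs :: "pt list"
  assumes vs: "set vs = {v \<in> rect_V a b c d. nbr v 3 \<in> rect_V a b c d}" "distinct vs"
      "sorted_wrt (\<lambda>v w. hlt (w, 0) (v, 0)) vs"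
    and hs: "set hs = {v \<in> rect_V a b c d. nbr v 2 \<in> rect_V a b c d}" "distinct hs"
begin

abbreviation "R \<equiv> rect_V a b c d"
abbreviation "ES zs \<equiv> map (vedge R x) zs @ map (hedge R x) hs"

text \<open>No other left or right half-edge lies between the two halves of a horizontal edge, so as
  long as no vertical edge has been placed the two signs agree.\<close>

lemma edge_exp_hedges:
  assumes T: "T \<in> evens R" and "set ws \<subseteq> set hs" "distinct ws"
  shows "hg.edge_exp (map (hedge R x) ws) (T \<inter> set (hg.halves (map (hedge R x) ws)))
    = (\<Prod>v\<in>{v\<in>set ws. (v, 2) \<in> T}. x (v, 2))"
  using assms(2,3)
proof (induction ws)
  case (Cons w ws)
  obtain i j where w: "w = (i, j)" by (cases w)
  let ?k = "((i, j), 2)" and ?k' = "((i + 1, j), 0)"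
  let ?es = "map (hedge R x) ws"
  let ?T = "T \<inter> set (hg.halves (map (hedge R x) (w # ws)))"
  let ?T' = "T \<inter> set (hg.halves ?es)"
  have Cons_eq: "map (hedge R x) (w # ws) = (?k, pair ?k, yw R x ?k) # ?es" by (simp add: hedge_def w)
  have new: "?k \<notin> set (hg.halves ?es)" "?k' \<notin> set (hg.halves ?es)"
    using Cons.prems w by (auto simp: set_halves_hedge)
  have step: "hg.edge_exp (map (hedge R x) (w # ws)) ?T =
      (if ?k \<in> T then yw R x ?k * (hg.sg ?k ?T' * hg.sg ?k' ?T') else 1) * hg.edge_exp ?es ?T'"
    using edge_exp_Cons_evens[OF T, of ?k ?es "yw R x ?k"] new unfolding Cons_eq by (simp add: hlt_def)
  have IH: "hg.edge_exp ?es ?T' = (\<Prod>v\<in>{v\<in>set ws. (v, 2) \<in> T}. x (v, 2))"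
    using Cons by simp
  show ?case
  proof (cases "?k \<in> T")
    case False
    then have "{v\<in>set (w # ws). (v, 2) \<in> T} = {v\<in>set ws. (v, 2) \<in> T}" using w by auto
    then show ?thesis using IH False step by simp
  next
    case True
    have "nbr w 2 \<in> R" using Cons.prems hs by auto
    then have y: "yw R x ?k = x ?k" by (simp add: yw_def Hs_def bsgn_def w nbr_def)
    have sign: "hg.sg ?k ?T' * hg.sg ?k' ?T' = 1"
      unfolding hg.sg_def prod.distrib[symmetric]
    proof (rule prod.neutral, rule ballI)
      fix k assume k: "k \<in> ?T'"
      then have "k \<noteq> ?k" "k \<noteq> ?k'" using new by auto
      moreover have "snd k = 0 \<or> snd k = 2" using k by (cases k, cases "fst k") (auto simp: set_halves_hedge)
      ultimately have "hlt k ?k \<longleftrightarrow> hlt k ?k'" by (cases k) (auto simp: hlt_def)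
      then show "sgb (hlt k ?k) * sgb (hlt k ?k') = 1" by simp
    qed
    have "{v\<in>set (w # ws). (v, 2) \<in> T} = insert w {v\<in>set ws. (v, 2) \<in> T}"
      using True w by auto
    moreover have "w \<notin> set ws" using Cons.prems by simp
    ultimately show ?thesis using IH y step sign True w by simp
  qed
qed simp

text \<open>The sign of \<open>vertical_sign\<close> cancels that of \<open>bsgn\<close>. A suffix
  \<open>zs\<close> of \<open>vs\<close> consists of exactly the vertical edges preceding the next
  one to be placed.\<close>

lemma edge_exp_vedges:
  assumes T: "T \<in> evens R" and "vs = ws @ zs"
  shows "hg.edge_exp (ES zs) (T \<inter> set (hg.halves (ES zs)))
    = (\<Prod>v\<in>{v\<in>set zs. (v, 3) \<in> T}. x (v, 3)) * (\<Prod>v\<in>{v\<in>set hs. (v, 2) \<in> T}. x (v, 2))"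
  using assms(2)
proof (induction zs arbitrary: ws)
  case Nil
  then show ?case using edge_exp_hedges[OF T, of hs] hs by simp
next
  case (Cons w zs)
  obtain i j where w: "w = (i, j)" by (cases w)
  let ?k = "((i, j), 3)" and ?k' = "((i, j + 1), 1)"
  let ?T = "T \<inter> set (hg.halves (ES (w # zs)))"
  let ?T' = "T \<inter> set (hg.halves (ES zs))"
  have Cons_eq: "ES (w # zs) = (?k, pair ?k, yw R x ?k) # ES zs" by (simp add: vedge_def w)
  have wzs: "w \<notin> set zs" using vs(2) Cons.prems by auto
  have new: "?k \<notin> set (hg.halves (ES zs))" "?k' \<notin> set (hg.halves (ES zs))"
    using wzs w by (auto simp: halves_append set_halves_hedge set_halves_vedge)
  have step: "hg.edge_exp (ES (w # zs)) ?T =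
      (if ?k \<in> T then yw R x ?k * (hg.sg ?k ?T' * hg.sg ?k' ?T') else 1) * hg.edge_exp (ES zs) ?T'"
    using edge_exp_Cons_evens[OF T, of ?k "ES zs" "yw R x ?k"] new unfolding Cons_eq by (simp add: hlt_def)
  have IH: "hg.edge_exp (ES zs) ?T' = (\<Prod>v\<in>{v\<in>set zs. (v, 3) \<in> T}. x (v, 3)) * (\<Prod>v\<in>{v\<in>set hs. (v, 2) \<in> T}. x (v, 2))"
    using Cons.IH[of "ws @ [w]"] Cons.prems by simp
  show ?case
  proof (cases "?k \<in> T")
    case False
    then have "{v\<in>set (w # zs). (v, 3) \<in> T} = {v\<in>set zs. (v, 3) \<in> T}" using w by auto
    then show ?thesis using IH False step by simp
  next
    case True
    have "nbr w 3 \<in> R" using Cons.prems vs by auto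
    then have y: "yw R x ?k = - x ?k" by (simp add: yw_def Hs_def bsgn_def w nbr_def)
    have sign: "hg.sg ?k ?T' * hg.sg ?k' ?T' = -1"
    proof -
      have srt: "v \<in> set zs \<longleftrightarrow> v \<in> set vs \<and> hlt (v, 0) (w, 0)" for v
        using vs(3) unfolding Cons.prems by (auto simp: sorted_wrt_append dest: hg.lt_asym)
      have mem: "k \<in> T \<Longrightarrow> k \<in> Hs R" "k \<in> T \<Longrightarrow> fst k \<in> R \<and> nbr (fst k) (snd k) \<in> R" for k
        using T evens_in[OF T] by (auto simp: evens_def)
      have "k \<in> ?T' \<longleftrightarrow> k \<in> T \<and> (snd k = 0 \<or> snd k = 2 \<or> (snd k = 3 \<and> hlt (fst k, 0) (w, 0)) \<or>
       (snd k = 1 \<and> hlt (nbr (fst k) 1, 0) (w, 0)))" for k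
      proof (cases "k \<in> T")
        case kT: True
        obtain p q e where k: "k = ((p, q), e)" by (metis prod.collapse)
        have "e < 4" using mem(1)[OF kT] k by (auto simp: Hs_def)
        then show ?thesis
          using mem(2)[OF kT] kT unfolding k
          by (elim direction_cases)
            (auto simp: halves_append set_halves_hedge set_halves_vedge srt vs(1) hs(1) nbr_def)
      qed simp
      then have "?T' = {k \<in> T. snd k = 0 \<or> snd k = 2 \<or> (snd k = 3 \<and> hlt (fst k, 0) ((i, j), 0)) \<or>
       (snd k = 1 \<and> hlt (nbr (fst k) 1, 0) ((i, j), 0))}"
        unfolding w by blast
      then show ?thesis using vertical_sign[OF T True] by simp
    qed
    have "{v\<in>set (w # zs). (v, 3) \<in> T} = insert w {v\<in>set zs. (v, 3) \<in> T}"
      using True w by auto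
    then show ?thesis using IH y step sign True w wzs by simp
  qed
qed

lemma edge_exp_evens:
  assumes T: "T \<in> evens R"
  shows "hg.edge_exp (ES vs) T = (\<Prod>v | (v, 2) \<in> T. x (v, 2)) * (\<Prod>v | (v, 3) \<in> T. x (v, 3))"
proof -
  have "T \<subseteq> set (hg.halves (ES vs))"
  proof
    fix k assume kT: "k \<in> T"
    obtain p q e where k: "k = ((p, q), e)" by (metis prod.collapse)
    have "k \<in> Hs R" using T kT by (auto simp: evens_def)
    then have "e < 4" using k by (auto simp: Hs_def)
    then show "k \<in> set (hg.halves (ES vs))"
      using evens_in[OF T kT] unfolding k
      by (elim direction_cases) (auto simp: halves_append set_halves_hedge set_halves_vedge vs(1) hs(1) nbr_def)
  qed
  then have 1: "T \<inter> set (hg.halves (ES vs)) = T" by auto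
  have 2: "{v \<in> set vs. (v, 3) \<in> T} = {v. (v, 3) \<in> T}" "{v \<in> set hs. (v, 2) \<in> T} = {v. (v, 2) \<in> T}"
    using evens_in[OF T] by (force simp: vs(1) hs(1))+
  show ?thesis using edge_exp_vedges[OF T, of "[]" vs] unfolding 1 2 by simp
qed

lemma edge_exp_not_evens:
  assumes "T \<subseteq> Hs R" "evenT T" "T \<notin> evens R"
  shows "hg.edge_exp (ES vs) T = 0"
proof (rule ccontr)
  assume nz: "hg.edge_exp (ES vs) T \<noteq> 0"
  have dist: "distinct (hg.halves (ES vs))" by (rule distinct_halves_edges[OF vs(2) hs(2)])
  from assms obtain k where k: "k \<in> T" "pair k \<notin> T" by (auto simp: evens_def)
  then have "k \<in> set (hg.halves (ES vs))" using hg.edge_exp_support[OF nz] by blast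
  then obtain u w y where e: "(u, w, y) \<in> set (ES vs)" "k = u \<or> k = w"
    by (rule hg.in_halvesE)
  then have "pair u = w \<and> pair w = u"
    by (auto simp: hedge_def vedge_def pair_pair)
  then show False using hg.edge_exp_closed[OF nz dist e(1)] e(2) k by auto
qed

end

text \<open>The Wick functional keeps only sets that are even at every vertex, and the edge
  exponential only sets closed under \<open>pair\<close>; together these are
  \<open>evens R\<close>.\<close>

theorem even_sum_trace:
  fixes a b c d :: int and x :: "half \<Rightarrow> real"
  assumes x: "\<And>k. \<bar>x k\<bar> \<le> x0" and x0: "x0 * (1 + sqrt 2) < 1"
    and sym: "\<And>k. snd k < 4 \<Longrightarrow> x (pair k) = x k"
  defines "R \<equiv> rect_V a b c d"
  shows "summable (\<lambda>r. mtrace (Hs R) (kw R x) (Suc r) / real (Suc r))"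
    "even_sum R x = exp (- (1/2) * (\<Sum>r. mtrace (Hs R) (kw R x) (Suc r) / real (Suc r)))"
proof -
  have fin: "finite (Hs R)" by (simp add: R_def Hs_def)
  have "\<exists>vs. set vs = {v \<in> R. nbr v 3 \<in> R} \<and> distinct vs \<and> sorted_wrt (\<lambda>v w. hlt (w, 0) (v, 0)) vs"
    by (rule ex_sorted_list) (auto simp: R_def hlt_def prod_eq_iff)
  then obtain vs where vs: "set vs = {v \<in> R. nbr v 3 \<in> R}" "distinct vs" "sorted_wrt (\<lambda>v w. hlt (w, 0) (v, 0)) vs"
    by blast
  have "finite {v \<in> R. nbr v 2 \<in> R}" by (simp add: R_def)
  then obtain hs where hs: "set hs = {v \<in> R. nbr v 2 \<in> R}" "distinct hs"
    using finite_distinct_list by blast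
  interpret re: rect_edges a b c d x vs hs
    using vs hs by unfold_locales (simp_all add: R_def)
  let ?es = "map (vedge R x) vs @ map (hedge R x) hs"
  have x00: "0 \<le> x0" using x[of undefined] by linarith
  interpret we: wick_edges hlt "Hs R" "\<lambda>T. of_bool (evenT T)" Am ?es pair "yw R x" "x0 * (1 + sqrt 2)"
  proof unfold_locales
    show "finite (Hs R)" by (rule fin)
    show "of_bool (evenT {}) = (1::real)" by (simp add: evenT_def even_at_def)
    show "(if h \<notin> T then hg.sg h T * of_bool (evenT (insert h T)) else 0) =
       (\<Sum>k\<in>T. Am h k * hg.sg k T * of_bool (evenT (T - {k})))" if "T \<subseteq> Hs R" "h \<in> Hs R" for T h
      using that by (intro wick_Am) (simp_all add: R_def)
    show "distinct (hg.halves ?es)" by (rule distinct_halves_edges[OF vs(2) hs(2)])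
    show "set (hg.halves ?es) \<subseteq> Hs R"
    proof
      fix k assume "k \<in> set (hg.halves ?es)"
      moreover obtain p q e where "k = ((p, q), e)" by (metis prod.collapse)
      ultimately show "k \<in> Hs R"
        by (auto simp: halves_append set_halves_hedge set_halves_vedge vs(1) hs(1) Hs_def nbr_def)
    qed
    show "pair u = w \<and> pair w = u \<and> yw R x u = y \<and> yw R x w = - y" if "(u, w, y) \<in> set ?es" for u w y
    proof -
      have "yw R x (pair (v, e)) = - yw R x (v, e)" if "v \<in> R" "nbr v e \<in> R" "e = 2 \<or> e = 3" for v e
        using that sym[of "(v, e)"] pair_pair[of "(v, e)"]
        by (auto simp: yw_def Hs_def pair_def opp_def bsgn_def)
      then show ?thesis
        using that vs(1) hs(1) by (auto simp: hedge_def vedge_def pair_pair)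
    qed
    show "yw R x k = 0" if "k \<in> Hs R" "k \<notin> set (hg.halves ?es)" for k
    proof -
      obtain p q e where k: "k = ((p, q), e)" by (metis prod.collapse)
      then have "e < 4" using that(1) by (auto simp: Hs_def)
      then show ?thesis using that unfolding k
        by (elim direction_cases)
          (auto simp: halves_append set_halves_hedge set_halves_vedge vs(1) hs(1) Hs_def yw_def nbr_def)
    qed
    show "0 \<le> x0 * (1 + sqrt 2)" using x00 by simp
    show "x0 * (1 + sqrt 2) < 1" by (rule x0)
    show "(\<Sum>h\<in>Hs R. (\<Sum>g\<in>Hs R. (\<Sum>k\<in>Hs R. Am h k * yw R x k * of_bool (pair k = g)) * f g)\<^sup>2)
       \<le> (x0 * (1 + sqrt 2))\<^sup>2 * (\<Sum>g\<in>Hs R. (f g)\<^sup>2)" for f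
      using kw_norm[of R x x0 f] x by (simp add: kw_def R_def)
  qed
  have tr: "we.step_matrix = kw R x" by (intro ext) (simp add: we.step_matrix_def kw_def)
  have "we.Z 1 = (\<Sum>T\<in>Pow (Hs R). of_bool (evenT T) * hg.edge_exp ?es T)"
    by (simp add: we.Z_def we.Phi_def)
  also have "\<dots> = (\<Sum>T\<in>evens R. (\<Prod>v | (v, 2) \<in> T. x (v, 2)) * (\<Prod>v | (v, 3) \<in> T. x (v, 3)))"
  proof (rule sum.mono_neutral_cong_right)
    show "\<forall>T\<in>Pow (Hs R) - evens R. of_bool (evenT T) * hg.edge_exp ?es T = 0"
      using re.edge_exp_not_evens by (auto simp: R_def)
    show "of_bool (evenT T) * hg.edge_exp ?es T = (\<Prod>v | (v, 2) \<in> T. x (v, 2)) * (\<Prod>v | (v, 3) \<in> T. x (v, 3))"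
      if "T \<in> evens R" for T
      using that re.edge_exp_evens[of T] unfolding R_def by (simp add: evens_def)
  qed (use fin in \<open>auto simp: evens_def\<close>)
  finally have "we.Z 1 = even_sum R x" by (simp add: even_sum_def)
  then show "summable (\<lambda>r. mtrace (Hs R) (kw R x) (Suc r) / real (Suc r))"
    "even_sum R x = exp (- (1/2) * (\<Sum>r. mtrace (Hs R) (kw R x) (Suc r) / real (Suc r)))"
    using we.Z_trace_formula unfolding tr by simp_all
qed

section \<open>Low-temperature expansion\<close>

text \<open>Negative iff the dual edge crosses the horizontal ray of the primal lattice going right from \<open>p\<close>.\<close>
definition ray_sign :: "pt \<Rightarrow> half \<Rightarrow> real" where
  "ray_sign p h = sgb (fst p \<le> fst (fst h) \<and>
     (snd h = 1 \<and> snd (fst h) = snd p \<or> snd h = 3 \<and> snd (fst h) = snd p - 1))"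

lemma ray_sign_pair: "snd h < 4 \<Longrightarrow> ray_sign p (pair h) = ray_sign p h"
  by (cases h, cases "fst h", elim direction_cases) (auto simp: ray_sign_def)

lemma abs_ray_sign: "\<bar>ray_sign p h\<bar> = 1"
  by (simp add: ray_sign_def)

text \<open>The inverse of \<open>contour\<close>: with plus spins outside, the spin at
  \<open>p\<close> is the parity of the contour edges met by the ray from \<open>p\<close>. The ray
  is horizontal, so only vertical dual edges count, each taken at its lower half.\<close>

definition spins :: "half set \<Rightarrow> pt \<Rightarrow> real" where
  "spins T p = (\<Prod>v | (v, 3) \<in> T. ray_sign p (v, 3))"

text \<open>The dual vertex \<open>(i, j)\<close> stands at \<open>(i + 1/2, j + 1/2)\<close>, so
  its left half-edge separates \<open>(i, j)\<close> from \<open>(i, j + 1)\<close>, and similarly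
  for the other directions.\<close>

definition contour :: "(pt \<Rightarrow> real) \<Rightarrow> half set" where
  "contour \<sigma> = {((i, j), e) | i j e. e = 0 \<and> \<sigma> (i, j) \<noteq> \<sigma> (i, j + 1) \<or> e = 1 \<and> \<sigma> (i, j) \<noteq> \<sigma> (i + 1, j)
     \<or> e = 2 \<and> \<sigma> (i + 1, j) \<noteq> \<sigma> (i + 1, j + 1) \<or> e = 3 \<and> \<sigma> (i, j + 1) \<noteq> \<sigma> (i + 1, j + 1)}"

lemma contour_iff [simp]:
  "((i, j), 0) \<in> contour \<sigma> \<longleftrightarrow> \<sigma> (i, j) \<noteq> \<sigma> (i, j + 1)"
  "((i, j), Suc 0) \<in> contour \<sigma> \<longleftrightarrow> \<sigma> (i, j) \<noteq> \<sigma> (i + 1, j)"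
  "((i, j), 2) \<in> contour \<sigma> \<longleftrightarrow> \<sigma> (i + 1, j) \<noteq> \<sigma> (i + 1, j + 1)"
  "((i, j), 3) \<in> contour \<sigma> \<longleftrightarrow> \<sigma> (i, j + 1) \<noteq> \<sigma> (i + 1, j + 1)"
  by (auto simp: contour_def)

lemma Omega_plus_iff:
  "\<sigma> \<in> Omega_plus a b c d \<longleftrightarrow> (\<forall>i j. \<sigma> (i, j) = 1 \<or> \<sigma> (i, j) = -1 \<and> a < i \<and> i < b \<and> c < j \<and> j < d)"
proof -
  have bd: "(i, j) \<in> rect_bdry a b c d \<longleftrightarrow> (i, j) \<in> rect_V a b c d \<and> \<not> (a < i \<and> i < b \<and> c < j \<and> j < d)" for i j
  proof
    assume "(i, j) \<in> rect_bdry a b c d"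
    then obtain p q where "(i, j) \<in> rect_V a b c d" "adj (i, j) (p, q)" "(p, q) \<notin> rect_V a b c d"
      by (auto simp: rect_bdry_def)
    then show "(i, j) \<in> rect_V a b c d \<and> \<not> (a < i \<and> i < b \<and> c < j \<and> j < d)"
      by (auto simp: rect_V_iff adj_def)
  next
    assume *: "(i, j) \<in> rect_V a b c d \<and> \<not> (a < i \<and> i < b \<and> c < j \<and> j < d)"
    then consider "i = a" | "i = b" | "j = c" | "j = d" by (fastforce simp: rect_V_iff)
    then have "\<exists>w'. adj (i, j) w' \<and> w' \<notin> rect_V a b c d"
    proof cases
      case 1 then show ?thesis by (intro exI[of _ "(i - 1, j)"]) (auto simp: adj_def rect_V_iff)
    next
      case 2 then show ?thesis by (intro exI[of _ "(i + 1, j)"]) (auto simp: adj_def rect_V_iff)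
    next
      case 3 then show ?thesis by (intro exI[of _ "(i, j - 1)"]) (auto simp: adj_def rect_V_iff)
    next
      case 4 then show ?thesis by (intro exI[of _ "(i, j + 1)"]) (auto simp: adj_def rect_V_iff)
    qed
    then show "(i, j) \<in> rect_bdry a b c d" using * by (auto simp: rect_bdry_def)
  qed
  show ?thesis
  proof
    assume s: "\<sigma> \<in> Omega_plus a b c d"
    show "\<forall>i j. \<sigma> (i, j) = 1 \<or> \<sigma> (i, j) = -1 \<and> a < i \<and> i < b \<and> c < j \<and> j < d"
    proof (intro allI)
      fix i j
      show "\<sigma> (i, j) = 1 \<or> \<sigma> (i, j) = -1 \<and> a < i \<and> i < b \<and> c < j \<and> j < d"
        using s bd[of i j] by (cases "(i, j) \<in> rect_V a b c d") (auto simp: Omega_plus_def)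
    qed
  next
    assume s: "\<forall>i j. \<sigma> (i, j) = 1 \<or> \<sigma> (i, j) = -1 \<and> a < i \<and> i < b \<and> c < j \<and> j < d"
    show "\<sigma> \<in> Omega_plus a b c d"
      unfolding Omega_plus_def mem_Collect_eq
    proof (intro conjI ballI allI impI)
      fix w :: pt
      obtain i j where w: "w = (i, j)" by (cases w)
      note sw = s[rule_format, of i j]
      show "\<sigma> w \<in> {-1, 1}" using sw w by auto
      show "\<sigma> w = 1" if "w \<notin> rect_V a b c d" using sw w that by (auto simp: rect_V_iff)
      show "\<sigma> w = 1" if "w \<in> rect_bdry a b c d" using sw w that by (auto simp: bd)
    qed
  qed
qed

text \<open>Around a face the spin changes an even number of times. The dual vertices are the faces
  of the rectangle, hence \<open>b - 1\<close> and \<open>d - 1\<close>; a contour edge has an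
  interior minus spin beside it, so both of its ends are such faces.\<close>

lemma contour_evens:
  assumes "\<sigma> \<in> Omega_plus a b c d"
  shows "contour \<sigma> \<in> evens (rect_V a (b - 1) c (d - 1))"
proof -
  have s: "\<sigma> (i, j) = 1 \<or> \<sigma> (i, j) = -1" and
    out: "\<sigma> (i, j) \<noteq> 1 \<Longrightarrow> a < i \<and> i < b \<and> c < j \<and> j < d" for i j
    using assms unfolding Omega_plus_iff by blast+
  have "even_at (contour \<sigma>) v" for v
  proof (cases v)
    case (Pair i j)
    show ?thesis
      using s[of i j] s[of "i + 1" j] s[of i "j + 1"] s[of "i + 1" "j + 1"]
      by (elim disjE) (simp_all add: even_at_def Pair)
  qed
  moreover have "k \<in> Hs (rect_V a (b - 1) c (d - 1)) \<and> pair k \<in> contour \<sigma>" if "k \<in> contour \<sigma>" for k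
  proof -
    obtain i j e where k: "k = ((i, j), e)" by (metis prod.collapse)
    have "e < 4" using that k by (auto simp: contour_def)
    then show ?thesis using that unfolding k
    proof (elim direction_cases)
      assume "e = 0" then show "((i, j), e) \<in> Hs (rect_V a (b - 1) c (d - 1)) \<and> pair ((i, j), e) \<in> contour \<sigma>"
        using that out[of i j] out[of i "j + 1"] by (cases "\<sigma> (i, j) = 1") (auto simp: k Hs_def rect_V_iff)
    next
      assume "e = 1" then show "((i, j), e) \<in> Hs (rect_V a (b - 1) c (d - 1)) \<and> pair ((i, j), e) \<in> contour \<sigma>"
        using that out[of i j] out[of "i + 1" "j"] by (cases "\<sigma> (i, j) = 1") (auto simp: k Hs_def rect_V_iff)
    next
      assume "e = 2" then show "((i, j), e) \<in> Hs (rect_V a (b - 1) c (d - 1)) \<and> pair ((i, j), e) \<in> contour \<sigma>"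
        using that out[of "i + 1" j] out[of "i + 1" "j + 1"] by (cases "\<sigma> (i + 1, j) = 1") (auto simp: k Hs_def rect_V_iff)
    next
      assume "e = 3" then show "((i, j), e) \<in> Hs (rect_V a (b - 1) c (d - 1)) \<and> pair ((i, j), e) \<in> contour \<sigma>"
        using that out[of i "j + 1"] out[of "i + 1" "j + 1"] by (cases "\<sigma> (i, j + 1) = 1") (auto simp: k Hs_def rect_V_iff)
    qed
  qed
  ultimately show ?thesis unfolding evens_def evenT_def by blast
qed

lemma spins_row:
  assumes T: "T \<in> evens (rect_V a b c d)"
  shows "spins T (i, j) = (\<Prod>p\<in>{i..b}. sgb (((p, j), 1) \<in> T))"
proof -
  have fin: "finite {v. (v, 3) \<in> T}"
    by (rule finite_subset[of _ "rect_V a b c d"]) (use evens_in(1)[OF T] in force, simp)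
  have "spins T (i, j) = (\<Prod>v | (v, 3) \<in> T. if i \<le> fst v \<and> snd v = j - 1 then -1 else 1)"
    unfolding spins_def by (intro prod.cong) (auto simp: ray_sign_def)
  also have "\<dots> = (\<Prod>v\<in>{v\<in>{v. (v, 3) \<in> T}. i \<le> fst v \<and> snd v = j - 1}. -1)"
    by (rule prod.inter_filter[OF fin, symmetric])
  also have "\<dots> = (\<Prod>p\<in>{p\<in>{i..b}. ((p, j), 1) \<in> T}. -1)"
  proof (rule prod.reindex_bij_witness[of _ "\<lambda>p. (p, j - 1)" fst])
    fix v assume v: "v \<in> {v\<in>{v. (v, 3) \<in> T}. i \<le> fst v \<and> snd v = j - 1}"
    then show "(fst v, j - 1) = v" by (simp add: prod_eq_iff)
    show "fst v \<in> {p\<in>{i..b}. ((p, j), 1) \<in> T}"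
      using v evens_in(1)[OF T, of "(v, 3)"] evens_sides(2)[OF T, of "fst v" "j - 1"]
      by (cases v) (auto simp: rect_V_iff)
  next
    fix p assume "p \<in> {p\<in>{i..b}. ((p, j), 1) \<in> T}"
    then show "(p, j - 1) \<in> {v\<in>{v. (v, 3) \<in> T}. i \<le> fst v \<and> snd v = j - 1}" "fst (p, j - 1) = p"
      using evens_sides(2)[OF T, of p "j - 1"] by auto
  qed simp
  also have "\<dots> = (\<Prod>p\<in>{i..b}. sgb (((p, j), 1) \<in> T))"
    by (rule prod.inter_filter) simp
  finally show ?thesis .
qed

text \<open>The product telescopes along the row until it reaches the plus spin at the right
  boundary.\<close>

lemma spins_contour:
  assumes s: "\<sigma> \<in> Omega_plus a b c d"
  shows "spins (contour \<sigma>) = \<sigma>"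
proof
  fix p :: pt
  obtain i j where p: "p = (i, j)" by (cases p)
  have pm: "\<sigma> (i, j) = 1 \<or> \<sigma> (i, j) = -1" and out: "b \<le> i \<Longrightarrow> \<sigma> (i, j) = 1" for i j
    using s[unfolded Omega_plus_iff, rule_format, of i j] by auto
  have sp: "spins (contour \<sigma>) (i, j) = (\<Prod>p\<in>{i..b - 1}. sgb (((p, j), 1) \<in> contour \<sigma>))"
    by (rule spins_row[OF contour_evens[OF s]])
  have tel: "(\<Prod>p\<in>{i..<m}. sgb (((p, j), 1) \<in> contour \<sigma>)) = \<sigma> (i, j) * \<sigma> (m, j)" if "i \<le> m" for m
    using that
  proof (induction m rule: int_ge_induct)
    case base
    then show ?case using pm[of i j] by auto
  next
    case (step m)
    have "{i..<m + 1} = insert m {i..<m}" using step by auto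
    then show ?case using step pm[of i j] pm[of m j] pm[of "m + 1" j] by auto
  qed
  have "{i..b - 1} = {i..<b}" by auto
  then show "spins (contour \<sigma>) p = \<sigma> p"
    using tel[of b] out[of b j] out[of i j] unfolding p sp by (cases "i \<le> b") auto
qed

lemma spins_Omega:
  assumes T: "T \<in> evens (rect_V a (b - 1) c (d - 1))"
  shows "spins T \<in> Omega_plus a b c d"
  unfolding Omega_plus_iff
proof (intro allI)
  fix i j
  note sp = spins_row[OF T, of i j]
  have pmS: "(\<Prod>p\<in>S. sgb (Q p)) = 1 \<or> (\<Prod>p\<in>S. sgb (Q p)) = -1" for S :: "int set" and Q
    by (induction S rule: infinite_finite_induct) auto
  have pm: "spins T (i, j) = 1 \<or> spins T (i, j) = -1" unfolding sp by (rule pmS)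
  have D: "((p, q), 1) \<in> T \<Longrightarrow> a \<le> p \<and> p < b \<and> c < q \<and> q < d" for p q
    using evens_in[OF T, of "((p, q), 1)"] by (auto simp: rect_V_iff nbr_def)
  show "spins T (i, j) = 1 \<or> spins T (i, j) = -1 \<and> a < i \<and> i < b \<and> c < j \<and> j < d"
  proof (cases "a < i \<and> i < b \<and> c < j \<and> j < d")
    case False
    then consider "\<not> (c < j \<and> j < d) \<or> b \<le> i" | "i \<le> a" "a < b" | "i \<le> a" "b \<le> a" by linarith
    then have "(\<Prod>p\<in>{i..b - 1}. sgb (((p, j), 1) \<in> T)) = 1"
    proof cases
      \<comment> \<open>A ray starting at or left of column \<open>a\<close> meets the entire row of
        vertical edges, which is even.\<close>
      case 2
      have "(\<Prod>p\<in>{i..b - 1}. sgb (((p, j), 1) \<in> T)) = (\<Prod>p\<in>{a..b - 1}. sgb (((p, j), 1) \<in> T))"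
        using 2 D by (intro prod.mono_neutral_right) auto
      also have "\<dots> = (\<Prod>p\<in>{a..b - 1}. sgb (((p, j - 1), 3) \<in> T))"
        using evens_sides(2)[OF T, of _ "j - 1"] by simp
      also have "\<dots> = 1" using 2 by (intro row_even[OF T]) auto
      finally show ?thesis .
    qed (use D in \<open>force intro!: prod.neutral\<close>)+
    then show ?thesis unfolding sp by blast
  qed (use pm in auto)
qed

text \<open>Rays from horizontal neighbours differ by one edge. Rays from vertical neighbours
  enclose part of a row of dual vertices, whose only horizontal exit is the left half-edge at its
  end; \<open>row_cut\<close> compares the two.\<close>

lemma contour_spins:
  assumes T: "T \<in> evens (rect_V a b c d)"
  shows "contour (spins T) = T"
proof -
  have pm: "spins T p = 1 \<or> spins T p = -1" for p
    using spins_Omega[of T a "b + 1" c "d + 1"] T unfolding Omega_plus_iff by (cases p) auto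
  have ne: "spins T p \<noteq> spins T q \<longleftrightarrow> Q" if "spins T p * spins T q = sgb Q" for p q Q
    using that pm[of p] pm[of q] by (auto split: if_splits)
  have h: "spins T (i, j) \<noteq> spins T (i + 1, j) \<longleftrightarrow> ((i, j), 1) \<in> T" for i j
  proof (rule ne)
    have 1: "((i, j), 1) \<notin> T" if "\<not> i \<le> b"
      using evens_in[OF T, of "((i, j), 1)"] that by (auto simp: rect_V_iff nbr_def)
    have sq: "(\<Prod>p\<in>S. sgb (Q p)) * (\<Prod>p\<in>S. sgb (Q p)) = 1" for S :: "int set" and Q
      unfolding prod.distrib[symmetric] by (rule prod.neutral) simp
    show "spins T (i, j) * spins T (i + 1, j) = sgb (((i, j), 1) \<in> T)"
    proof (cases "i \<le> b")
      case True
      then have "{i..b} = insert i {i + 1..b}" by auto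
      then show ?thesis using sq[of "\<lambda>p. ((p, j), 1) \<in> T" "{i + 1..b}"] by (simp add: spins_row[OF T] mult.assoc)
    qed (simp add: spins_row[OF T] 1[unfolded One_nat_def])
  qed
  have v: "spins T (i, j) \<noteq> spins T (i, j + 1) \<longleftrightarrow> ((i, j), 0) \<in> T" for i j
  proof (rule ne)
    have out: "((p, j), e) \<notin> T" if "p < a \<or> b < p" for p e
      using evens_in[OF T, of "((p, j), e)"] that by (auto simp: rect_V_iff)
    define q where "q p = sgb (((p, j), 3) \<in> T) * sgb (((p, j), 1) \<in> T)" for p
    have q: "spins T (i, j) * spins T (i, j + 1) = (\<Prod>p\<in>{i..b}. q p)"
      unfolding spins_row[OF T] prod.distrib[symmetric] q_def
      using evens_sides(2)[OF T, of _ j] by (intro prod.cong) auto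
    have full: "(\<Prod>p\<in>{a..<b + 1}. q p) = 1" if "a \<le> b"
      using row_cut[OF T, of "b + 1" j] out[of "b + 1"] that by (simp add: q_def)
    consider "b < i" | "i < a" "a \<le> b" | "i < a" "b < a" | "a \<le> i" "i \<le> b" by linarith
    then have "(\<Prod>p\<in>{i..b}. q p) = sgb (((i, j), 0) \<in> T)"
    proof cases
      case 2
      have "(\<Prod>p\<in>{i..b}. q p) = (\<Prod>p\<in>{a..<b + 1}. q p)"
        using 2 out by (intro prod.mono_neutral_right) (auto simp: q_def)
      then show ?thesis using full out[of i] 2 by simp
    next
      case 3
      have "(\<Prod>p\<in>{i..b}. q p) = 1" using 3 out by (intro prod.neutral) (auto simp: q_def)
      then show ?thesis using out[of i] 3 by simp
    next
      case 4
      have "{a..<b + 1} = {a..<i} \<union> {i..b}" using 4 by auto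
      then have "(\<Prod>p\<in>{a..<i}. q p) * (\<Prod>p\<in>{i..b}. q p) = 1"
        using full 4 by (subst prod.union_disjoint[symmetric]) auto
      moreover have "(\<Prod>p\<in>{a..<i}. q p) = sgb (((i, j), 0) \<in> T)"
        using row_cut[OF T, of i j] 4 by (simp add: q_def)
      ultimately show ?thesis by (auto split: if_splits)
    qed (use out[of i] in simp)
    then show "spins T (i, j) * spins T (i, j + 1) = sgb (((i, j), 0) \<in> T)" using q by simp
  qed
  have "k \<in> contour (spins T) \<longleftrightarrow> k \<in> T" for k
  proof (cases "snd k < 4")
    case True
    obtain i j e where k: "k = ((i, j), e)" by (metis prod.collapse)
    with True have "e < 4" by simp
    then show ?thesis unfolding k
      using h[of i j] h[of i "j + 1"] v[of i j] v[of "i + 1" j] evens_sides[OF T, of i j]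
      by (elim direction_cases) simp_all
  next
    case False
    then show ?thesis using T by (auto simp: evens_def Hs_def contour_def)
  qed
  then show ?thesis by blast
qed

section \<open>Boltzmann weights in terms of contours\<close>

lemma rect_E_eq:
  "rect_E a b c d = (\<lambda>(i, j). {(i, j), (i + 1, j)}) ` ({a..b - 1} \<times> {c..d})
     \<union> (\<lambda>(i, j). {(i, j), (i, j + 1)}) ` ({a..b} \<times> {c..d - 1})" (is "_ = ?f ` ?H \<union> ?g ` ?V")
proof
  show "rect_E a b c d \<subseteq> ?f ` ?H \<union> ?g ` ?V"
  proof
    fix e assume "e \<in> rect_E a b c d"
    then obtain i j p q where e: "e = {(i, j), (p, q)}" "(i, j) \<in> rect_V a b c d" "(p, q) \<in> rect_V a b c d"
      "adj (i, j) (p, q)" by (auto simp: rect_E_def)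
    from e(4) have "p = i + 1 \<and> q = j \<or> i = p + 1 \<and> q = j \<or> p = i \<and> q = j + 1 \<or> p = i \<and> j = q + 1"
      by (simp add: adj_def) arith
    then consider "p = i + 1" "q = j" | "i = p + 1" "q = j" | "p = i" "q = j + 1" | "p = i" "j = q + 1"
      by blast
    then show "e \<in> ?f ` ?H \<union> ?g ` ?V"
    proof cases
      case 1 then show ?thesis using e by (intro UnI1 image_eqI[of _ _ "(i, j)"]) (auto simp: rect_V_iff)
    next
      case 2 then show ?thesis using e by (intro UnI1 image_eqI[of _ _ "(p, q)"]) (auto simp: rect_V_iff)
    next
      case 3 then show ?thesis using e by (intro UnI2 image_eqI[of _ _ "(i, j)"]) (auto simp: rect_V_iff)
    next
      case 4 then show ?thesis using e by (intro UnI2 image_eqI[of _ _ "(p, q)"]) (auto simp: rect_V_iff)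
    qed
  qed
  show "?f ` ?H \<union> ?g ` ?V \<subseteq> rect_E a b c d"
  proof (intro Un_least subsetI)
    fix e assume "e \<in> ?f ` ?H"
    then obtain i j where "e = {(i, j), (i + 1, j)}" "(i, j) \<in> ?H" by auto
    then show "e \<in> rect_E a b c d"
      unfolding rect_E_def by (intro CollectI exI[of _ "(i, j)"] exI[of _ "(i + 1, j)"]) (auto simp: rect_V_iff adj_def)
  next
    fix e assume "e \<in> ?g ` ?V"
    then obtain i j where "e = {(i, j), (i, j + 1)}" "(i, j) \<in> ?V" by auto
    then show "e \<in> rect_E a b c d"
      unfolding rect_E_def by (intro CollectI exI[of _ "(i, j)"] exI[of _ "(i, j + 1)"]) (auto simp: rect_V_iff adj_def)
  qed
qed

text \<open>Every edge contributes \<open>exp \<beta>\<close>, with an extra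
  \<open>exp (-2 * \<beta>)\<close> if its spins differ. Horizontal lattice edges are crossed by
  vertical dual edges and conversely.\<close>

lemma ising_weight_contour:
  assumes s: "\<sigma> \<in> Omega_plus a b c d"
  shows "ising_weight \<beta> a b c d \<sigma> =
    exp \<beta> ^ card ({a..b - 1} \<times> {c..d}) * exp \<beta> ^ card ({a..b} \<times> {c..d - 1}) *
    (exp (-2 * \<beta>) ^ card {v. (v, 2) \<in> contour \<sigma>} * exp (-2 * \<beta>) ^ card {v. (v, 3) \<in> contour \<sigma>})"
proof -
  let ?H = "{a..b - 1} \<times> {c..d}" and ?V = "{a..b} \<times> {c..d - 1}"
  let ?f = "\<lambda>(i, j). {(i, j), (i + 1, j)} :: pt set" and ?g = "\<lambda>(i, j). {(i, j), (i, j + 1)} :: pt set"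
  let ?W = "\<lambda>e. exp (\<beta> * (\<Prod>z\<in>e. \<sigma> z))" and ?x = "exp (-2 * \<beta>)"
  have pm: "\<sigma> (i, j) = 1 \<or> \<sigma> (i, j) = -1" and out: "\<sigma> (i, j) \<noteq> 1 \<Longrightarrow> a < i \<and> i < b \<and> c < j \<and> j < d" for i j
    using s unfolding Omega_plus_iff by blast+
  have W: "exp (\<beta> * (\<sigma> p * \<sigma> q)) = exp \<beta> * (if \<sigma> p \<noteq> \<sigma> q then ?x else 1)" for p q
    using pm[of "fst p" "snd p"] pm[of "fst q" "snd q"] by (auto simp flip: exp_add)
  have "inj_on ?f ?H" "inj_on ?g ?V"
    by (auto simp: inj_on_def doubleton_eq_iff)
  have "?f ` ?H \<inter> ?g ` ?V = {}"
    by (auto simp: doubleton_eq_iff)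
  then have "ising_weight \<beta> a b c d \<sigma> = (\<Prod>e\<in>?f ` ?H. ?W e) * (\<Prod>e\<in>?g ` ?V. ?W e)"
    unfolding ising_weight_def rect_E_eq by (intro prod.union_disjoint) auto
  also have "(\<Prod>e\<in>?f ` ?H. ?W e) = (\<Prod>v\<in>?H. exp \<beta> * (if \<sigma> v \<noteq> \<sigma> (fst v + 1, snd v) then ?x else 1))"
    by (subst prod.reindex[OF \<open>inj_on ?f ?H\<close>]) (auto intro!: prod.cong simp: W)
  also have "\<dots> = exp \<beta> ^ card ?H * (\<Prod>v\<in>?H. if \<sigma> v \<noteq> \<sigma> (fst v + 1, snd v) then ?x else 1)"
    by (simp add: prod.distrib)
  also have "(\<Prod>v\<in>?H. if \<sigma> v \<noteq> \<sigma> (fst v + 1, snd v) then ?x else 1) = ?x ^ card {v. (v, 3) \<in> contour \<sigma>}"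
  proof -
    have "(\<Prod>v\<in>?H. if \<sigma> v \<noteq> \<sigma> (fst v + 1, snd v) then ?x else 1)
        = (\<Prod>v\<in>{v\<in>?H. \<sigma> v \<noteq> \<sigma> (fst v + 1, snd v)}. ?x)"
      by (rule prod.inter_filter[symmetric]) simp
    also have "\<dots> = (\<Prod>v\<in>{v. (v, 3) \<in> contour \<sigma>}. ?x)"
    \<comment> \<open>The dual edge going up from \<open>(i, j)\<close> crosses the lattice edge
      from \<open>(i, j + 1)\<close> to \<open>(i + 1, j + 1)\<close>, hence the shift.\<close>
    proof (rule prod.reindex_bij_witness[of _ "\<lambda>v. (fst v, snd v + 1)" "\<lambda>v. (fst v, snd v - 1)"])
      fix v assume "v \<in> {v. (v, 3) \<in> contour \<sigma>}"
      then show "(fst v, snd v + 1) \<in> {v\<in>?H. \<sigma> v \<noteq> \<sigma> (fst v + 1, snd v)}"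
        using out[of "fst v" "snd v + 1"] out[of "fst v + 1" "snd v + 1"]
        by (cases v; cases "\<sigma> (fst v, snd v + 1) = 1") auto
    qed (auto simp: contour_def)
    finally show ?thesis by simp
  qed
  also have "(\<Prod>e\<in>?g ` ?V. ?W e) = (\<Prod>v\<in>?V. exp \<beta> * (if \<sigma> v \<noteq> \<sigma> (fst v, snd v + 1) then ?x else 1))"
    by (subst prod.reindex[OF \<open>inj_on ?g ?V\<close>]) (auto intro!: prod.cong simp: W)
  also have "\<dots> = exp \<beta> ^ card ?V * (\<Prod>v\<in>?V. if \<sigma> v \<noteq> \<sigma> (fst v, snd v + 1) then ?x else 1)"
    by (simp add: prod.distrib)
  also have "(\<Prod>v\<in>?V. if \<sigma> v \<noteq> \<sigma> (fst v, snd v + 1) then ?x else 1) = ?x ^ card {v. (v, 2) \<in> contour \<sigma>}"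
  proof -
    have "(\<Prod>v\<in>?V. if \<sigma> v \<noteq> \<sigma> (fst v, snd v + 1) then ?x else 1)
        = (\<Prod>v\<in>{v\<in>?V. \<sigma> v \<noteq> \<sigma> (fst v, snd v + 1)}. ?x)"
      by (rule prod.inter_filter[symmetric]) simp
    also have "\<dots> = (\<Prod>v\<in>{v. (v, 2) \<in> contour \<sigma>}. ?x)"
    proof (rule prod.reindex_bij_witness[of _ "\<lambda>v. (fst v + 1, snd v)" "\<lambda>v. (fst v - 1, snd v)"])
      fix v assume "v \<in> {v. (v, 2) \<in> contour \<sigma>}"
      then show "(fst v + 1, snd v) \<in> {v\<in>?V. \<sigma> v \<noteq> \<sigma> (fst v, snd v + 1)}"
        using out[of "fst v + 1" "snd v"] out[of "fst v + 1" "snd v + 1"]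
        by (cases v; cases "\<sigma> (fst v + 1, snd v) = 1") auto
    qed (auto simp: contour_def)
    finally show ?thesis by simp
  qed
  finally show ?thesis by (simp add: mult_ac)
qed

text \<open>A product of spins is a product of ray parities of the contour, so it only flips signs
  of weights along the rays. The factor \<open>C\<close> common to all configurations cancels in the
  quotient.\<close>

theorem ising_exp_even_sum:
  fixes a b c d :: int and \<beta> :: real
  assumes "finite A"
  defines "R \<equiv> rect_V a (b - 1) c (d - 1)" and "x \<equiv> exp (-2 * \<beta>)"
  shows "ising_exp \<beta> a b c d (\<lambda>\<sigma>. \<Prod>p\<in>A. \<sigma> p) =
     even_sum R (\<lambda>h. x * (\<Prod>p\<in>A. ray_sign p h)) / even_sum R (\<lambda>h. x)"
proof -
  define C where "C = exp \<beta> ^ card ({a..b - 1} \<times> {c..d}) * exp \<beta> ^ card ({a..b} \<times> {c..d - 1})"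
  have "C \<noteq> 0" by (simp add: C_def)
  have *: "(\<Sum>\<sigma>\<in>Omega_plus a b c d. (\<Prod>p\<in>B. \<sigma> p) * ising_weight \<beta> a b c d \<sigma>)
     = C * even_sum R (\<lambda>h. x * (\<Prod>p\<in>B. ray_sign p h))" for B
  proof -
    have "(\<Sum>\<sigma>\<in>Omega_plus a b c d. (\<Prod>p\<in>B. \<sigma> p) * ising_weight \<beta> a b c d \<sigma>)
      = (\<Sum>T\<in>evens R. C * ((\<Prod>v | (v, 2) \<in> T. x * (\<Prod>p\<in>B. ray_sign p (v, 2))) *
           (\<Prod>v | (v, 3) \<in> T. x * (\<Prod>p\<in>B. ray_sign p (v, 3)))))"
    proof (rule sum.reindex_bij_witness[of _ spins contour])
      fix \<sigma> assume s: "\<sigma> \<in> Omega_plus a b c d"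
      show "spins (contour \<sigma>) = \<sigma>" by (rule spins_contour[OF s])
      show "contour \<sigma> \<in> evens R" unfolding R_def by (rule contour_evens[OF s])
      have 1: "(\<Prod>v | (v, 2) \<in> contour \<sigma>. x * (\<Prod>p\<in>B. ray_sign p (v, 2))) = x ^ card {v. (v, 2) \<in> contour \<sigma>}"
        by (simp add: ray_sign_def)
      have 2: "(\<Prod>v | (v, 3) \<in> contour \<sigma>. x * (\<Prod>p\<in>B. ray_sign p (v, 3)))
         = x ^ card {v. (v, 3) \<in> contour \<sigma>} * (\<Prod>p\<in>B. spins (contour \<sigma>) p)"
        unfolding spins_def by (subst prod.swap) (simp add: prod.distrib)
      show "C * ((\<Prod>v | (v, 2) \<in> contour \<sigma>. x * (\<Prod>p\<in>B. ray_sign p (v, 2))) *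
           (\<Prod>v | (v, 3) \<in> contour \<sigma>. x * (\<Prod>p\<in>B. ray_sign p (v, 3)))) =
          (\<Prod>p\<in>B. \<sigma> p) * ising_weight \<beta> a b c d \<sigma>"
        unfolding 1 2 spins_contour[OF s] ising_weight_contour[OF s] C_def x_def[symmetric] by (simp add: mult_ac)
    next
      fix T assume T: "T \<in> evens R"
      show "contour (spins T) = T" using T unfolding R_def by (rule contour_spins)
      show "spins T \<in> Omega_plus a b c d" using T unfolding R_def by (rule spins_Omega)
    qed
    then show ?thesis by (simp add: even_sum_def sum_distrib_left)
  qed
  show ?thesis
    unfolding ising_exp_def * using *[of "{}"] \<open>C \<noteq> 0\<close> by simp
qed

section \<open>Traces as sums over closed paths\<close>

primrec walk_weight :: "('h \<Rightarrow> 'h \<Rightarrow> real) \<Rightarrow> 'h \<Rightarrow> 'h list \<Rightarrow> 'h \<Rightarrow> real" where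
  "walk_weight M h [] k = M h k"
| "walk_weight M h (g # gs) k = M h g * walk_weight M g gs k"

abbreviation lists_of :: "'h set \<Rightarrow> nat \<Rightarrow> 'h list set" where
  "lists_of H n \<equiv> {hs. set hs \<subseteq> H \<and> length hs = n}"

lemma sum_lists_Suc:
  fixes f :: "'h list \<Rightarrow> real"
  shows "(\<Sum>hs\<in>lists_of H (Suc n). f hs) = (\<Sum>h\<in>H. \<Sum>gs\<in>lists_of H n. f (h # gs))"
proof -
  have "(\<Sum>hs\<in>lists_of H (Suc n). f hs) = (\<Sum>p\<in>H \<times> lists_of H n. f (fst p # snd p))"
    by (rule sum.reindex_bij_witness[of _ "\<lambda>p. fst p # snd p" "\<lambda>hs. (hd hs, tl hs)"])
      (auto simp: length_Suc_conv)
  then show ?thesis by (simp add: sum.cartesian_product')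
qed

lemma mpow_walks:
  assumes "finite H" "k \<in> H"
  shows "mpow H M (Suc n) h k = (\<Sum>gs\<in>lists_of H n. walk_weight M h gs k)"
proof (induction n arbitrary: h)
  case 0
  have "(\<Sum>g\<in>H. M h g * of_bool (g = k)) = (\<Sum>g\<in>H. if g = k then M h k else 0)"
    by (intro sum.cong) auto
  moreover have "lists_of H 0 = {[]}" by auto
  ultimately show ?case using assms by simp
next
  case (Suc n)
  have "mpow H M (Suc (Suc n)) h k = (\<Sum>g\<in>H. M h g * mpow H M (Suc n) g k)" by simp
  then show ?case by (simp only: Suc.IH sum_lists_Suc walk_weight.simps sum_distrib_left)
qed

lemma walk_weight_prod:
  "walk_weight M h gs k = (\<Prod>i<Suc (length gs). M ((h # gs) ! i) ((gs @ [k]) ! i))"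
proof (induction gs arbitrary: h)
  case (Cons g gs)
  show ?case unfolding prod.lessThan_Suc_shift[of _ "length (g # gs)"] by (simp add: Cons)
qed simp

lemma mtrace_cyclic:
  assumes "finite H" "0 < n"
  shows "mtrace H M n = (\<Sum>hs\<in>lists_of H n. \<Prod>i<n. M (hs ! i) (hs ! (Suc i mod n)))"
proof -
  obtain m where n: "n = Suc m" using assms by (cases n) auto
  have "mtrace H M n = (\<Sum>h\<in>H. \<Sum>gs\<in>lists_of H m. walk_weight M h gs h)"
    unfolding mtrace_def n using assms by (intro sum.cong refl mpow_walks)
  also have "\<dots> = (\<Sum>h\<in>H. \<Sum>gs\<in>lists_of H m. \<Prod>i<n. M ((h # gs) ! i) ((h # gs) ! (Suc i mod n)))"
  proof (intro sum.cong refl)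
    fix h gs assume "gs \<in> lists_of H m"
    then have l: "length gs = m" by simp
    show "walk_weight M h gs h = (\<Prod>i<n. M ((h # gs) ! i) ((h # gs) ! (Suc i mod n)))"
      unfolding walk_weight_prod l n
    proof (rule prod.cong[OF refl])
      fix i assume "i \<in> {..<Suc m}"
      then have "(gs @ [h]) ! i = (h # gs) ! (Suc i mod Suc m)"
        using l by (cases "i = m") (auto simp: nth_append)
      then show "M ((h # gs) ! i) ((gs @ [h]) ! i) = M ((h # gs) ! i) ((h # gs) ! (Suc i mod Suc m))"
        by simp
    qed
  qed
  finally show ?thesis by (simp add: n sum_lists_Suc del: prod.lessThan_Suc)
qed

section \<open>Directions of steps and closed paths\<close>

definition dirof :: "pt \<Rightarrow> pt \<Rightarrow> nat" where
  "dirof p q = (if fst q < fst p then 0 else if snd q < snd p then 1 else if fst p < fst q then 2 else 3)"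

lemma dirof_less: "dirof p q < 4"
  by (simp add: dirof_def)

lemma adj_cases:
  assumes "adj (i, j) q"
  obtains "q = (i - 1, j)" | "q = (i, j - 1)" | "q = (i + 1, j)" | "q = (i, j + 1)"
proof -
  obtain k l where q: "q = (k, l)" by (cases q)
  have "k = i - 1 \<and> l = j \<or> k = i \<and> l = j - 1 \<or> k = i + 1 \<and> l = j \<or> k = i \<and> l = j + 1"
    using assms unfolding adj_def q by simp arith
  then show ?thesis using that q by blast
qed

lemma nbr_dirof: "adj p q \<Longrightarrow> nbr p (dirof p q) = q"
  by (cases p, hypsubst, erule adj_cases) (auto simp: nbr_def dirof_def)

lemma dirof_sym: "adj p q \<Longrightarrow> dirof q p = opp (dirof p q)"
  by (cases p, hypsubst, erule adj_cases) (auto simp: dirof_def opp_def)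

lemma dirof_nbr: "e < 4 \<Longrightarrow> dirof p (nbr p e) = e"
  by (elim direction_cases) (auto simp: nbr_def dirof_def)

lemma adj_nbr: "adj p (nbr p e)"
  by (auto simp: nbr_def adj_def)

lemma opp_less: "opp e < 4"
  by (simp add: opp_def)

lemma opp_opp: "e < 4 \<Longrightarrow> opp (opp e) = e"
  by (elim direction_cases) (auto simp: opp_def)

lemma pair_dirof: "adj p q \<Longrightarrow> pair (p, dirof p q) = (q, dirof q p)"
  by (simp add: pair_def nbr_dirof dirof_sym)

lemma adj_sym: "adj p q \<longleftrightarrow> adj q p"
  by (auto simp: adj_def)

lemma cv_mod: "cv l (i mod length l) = cv l i"
  by (simp add: cv_def)

lemma cv_cong: "i mod length l = k mod length l \<Longrightarrow> cv l i = cv l k"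
  by (simp add: cv_def)

lemma cv_nth: "i < length l \<Longrightarrow> cv l i = l ! i"
  by (simp add: cv_def)

lemma closed_pathD:
  assumes "closed_path l"
  shows "l \<noteq> []" "adj (cv l i) (cv l (Suc i))" "cv l (Suc (Suc i)) \<noteq> cv l i"
proof -
  show ne: "l \<noteq> []" using assms by (simp add: closed_path_def)
  have m: "i mod length l < length l" using ne by simp
  have 1: "cv l (i mod length l + k) = cv l (i + k)" for k
    by (rule cv_cong) (rule mod_add_left_eq)
  show "adj (cv l i) (cv l (Suc i))" "cv l (Suc (Suc i)) \<noteq> cv l i"
    using assms[unfolded closed_path_def, THEN conjunct2, rule_format, OF m] 1[of 1] 1[of 2]
    by (simp_all add: cv_mod)
qed

text \<open>Entry \<open>i\<close> is the half-edge through which the path arrives at its vertex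
  \<open>i\<close>. The predecessor is written \<open>i + length l - 1\<close> because
  \<open>i - 1\<close> would truncate at \<open>0\<close>.\<close>

definition back_halves :: "pt list \<Rightarrow> half list" where
  "back_halves l = map (\<lambda>i. (cv l i, dirof (cv l i) (cv l (i + length l - 1)))) [0..<length l]"

lemma length_back_halves [simp]: "length (back_halves l) = length l"
  by (simp add: back_halves_def)

lemma back_halves_nth:
  assumes "l \<noteq> []"
  shows "back_halves l ! (Suc i mod length l) = (cv l (Suc i), dirof (cv l (Suc i)) (cv l i))"
proof -
  let ?r = "length l"
  have r: "0 < ?r" using assms by simp
  have "(Suc i mod ?r + (?r - 1)) mod ?r = (Suc i + (?r - 1)) mod ?r" by (rule mod_add_left_eq)
  also have "Suc i + (?r - 1) = i + ?r" using r by simp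
  finally have "(Suc i mod ?r + ?r - 1) mod ?r = i mod ?r" using r by simp
  then have "cv l (Suc i mod ?r + ?r - 1) = cv l i" by (rule cv_cong)
  then show ?thesis using r by (simp add: back_halves_def cv_mod)
qed

lemma map_fst_back_halves: "map fst (back_halves l) = l"
  by (rule nth_equalityI) (auto simp: back_halves_def cv_nth)

text \<open>A path moving in direction \<open>e\<close> arrives through the half-edge \<open>opp e\<close>.\<close>
definition turn_weight :: "nat \<Rightarrow> nat \<Rightarrow> real" where
  "turn_weight e f = Am ((0, 0), opp e) ((0, 0), f) * bsgn f"

lemma Hs_iff: "k \<in> Hs R \<longleftrightarrow> fst k \<in> R \<and> snd k < 4"
  by (cases k) (auto simp: Hs_def)

lemma kw_eq:
  assumes h: "h \<in> Hs R" and g: "g \<in> Hs R" and R: "finite R"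
  shows "kw R x h g = Am h (pair g) * (bsgn (opp (snd g)) * x (pair g))"
proof -
  have fin: "finite (Hs R)" using R by (simp add: Hs_def)
  have pg: "pair (pair g) = g" using g by (intro pair_pair Hs_snd)
  have "kw R x h g = (\<Sum>k\<in>Hs R. if k = pair g then Am h k * yw R x k else 0)"
    unfolding kw_def
  proof (intro sum.cong refl)
    fix k assume "k \<in> Hs R"
    then have "pair (pair k) = k" by (intro pair_pair Hs_snd)
    then have "pair k = g \<longleftrightarrow> k = pair g" using pg by auto
    then show "Am h k * yw R x k * of_bool (pair k = g) = (if k = pair g then Am h k * yw R x k else 0)"
      by simp
  qed
  also have "\<dots> = (if pair g \<in> Hs R then Am h (pair g) * yw R x (pair g) else 0)"
    using fin by simp
  also have "\<dots> = Am h (pair g) * (bsgn (opp (snd g)) * x (pair g))"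
  proof (cases "pair g \<in> Hs R")
    case True
    then show ?thesis using g by (simp add: yw_def pg) (simp add: pair_def)
  next
    \<comment> \<open>Then \<open>g\<close> is entered from a vertex outside \<open>R\<close>, which
      cannot be the vertex of \<open>h\<close>.\<close>
    case False
    have "Hs R = R \<times> {..<4}" by (auto simp: Hs_def)
    then have "fst (pair g) \<notin> R" using False by (auto simp: pair_def opp_less)
    then have "Am h (pair g) = 0" using h by (auto simp: Am_def Hs_def)
    then show ?thesis using False by simp
  qed
  finally show ?thesis .
qed

definition closed_paths :: "pt set \<Rightarrow> nat \<Rightarrow> pt list set" where
  "closed_paths R r = {l. closed_path l \<and> length l = r \<and> set l \<subseteq> R}"

definition path_dir :: "pt list \<Rightarrow> nat \<Rightarrow> nat" where
  "path_dir l i = dirof (cv l i) (cv l (Suc i))"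

lemma mod_Suc_lift:
  assumes "\<forall>i<r. P i (Suc i mod r)" "0 < (r::nat)"
  shows "P (i mod r) (Suc i mod r)"
  using assms mod_Suc_eq[of i r] by (metis mod_less_divisor)

text \<open>A cyclic term is nonzero only if the partner of each half-edge is a different half-edge
  at the vertex of the preceding one. These are exactly the closed paths without backtracking, and
  the vertices determine the half-edges.\<close>

lemma mtrace_kw_closed_paths:
  assumes R: "finite R" and r: "0 < r"
  shows "mtrace (Hs R) (kw R x) r = (\<Sum>l\<in>closed_paths R r. \<Prod>i<r.
     turn_weight (path_dir l i) (path_dir l (Suc i)) * x (cv l (Suc i), path_dir l (Suc i)))"
proof -
  have fin: "finite (Hs R)" using R by (simp add: Hs_def)
  let ?w = "\<lambda>hs. \<Prod>i<r. kw R x (hs ! i) (hs ! (Suc i mod r))"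
  let ?good = "{hs \<in> lists_of (Hs R) r. \<forall>i<r. Am (hs ! i) (pair (hs ! (Suc i mod r))) \<noteq> 0}"
  have "mtrace (Hs R) (kw R x) r = (\<Sum>hs\<in>lists_of (Hs R) r. ?w hs)"
    by (rule mtrace_cyclic[OF fin r])
  also have "\<dots> = (\<Sum>hs\<in>?good. ?w hs)"
  proof (rule sum.mono_neutral_right)
    show "finite (lists_of (Hs R) r)" using fin by (rule finite_lists_length_eq)
    show "\<forall>hs\<in>lists_of (Hs R) r - ?good. ?w hs = 0"
    proof
      fix hs assume "hs \<in> lists_of (Hs R) r - ?good"
      then obtain i where i: "i < r" "Am (hs ! i) (pair (hs ! (Suc i mod r))) = 0"
        and hs: "set hs \<subseteq> Hs R" "length hs = r" by auto
      have "kw R x (hs ! i) (hs ! (Suc i mod r)) = 0"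
      proof -
        have "Suc i mod r < length hs" "i < length hs" using i hs r by simp_all
        then have "hs ! i \<in> Hs R" "hs ! (Suc i mod r) \<in> Hs R"
          by (auto intro!: subsetD[OF hs(1)] nth_mem simp del: mod_less)
        then show ?thesis using i(2) by (subst kw_eq[OF _ _ R]) simp_all
      qed
      then show "?w hs = 0" using i by (intro prod_zero) auto
    qed
  qed auto
  also have "\<dots> = (\<Sum>l\<in>closed_paths R r. \<Prod>i<r.
     turn_weight (path_dir l i) (path_dir l (Suc i)) * x (cv l (Suc i), path_dir l (Suc i)))"
  proof (rule sum.reindex_bij_witness[of _ "map fst" back_halves, symmetric])
    fix hs assume hs: "hs \<in> ?good"
    define l where "l = map fst hs"
    have len: "length l = r" "length hs = r" using hs by (auto simp: l_def)
    define hv where "hv i = hs ! (i mod r)" for i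
    have hvH: "hv i \<in> Hs R" for i using hs len r by (auto simp: hv_def intro!: subsetD[of "set hs" "Hs R"])
    have cvl: "cv l i = fst (hv i)" for i using r len by (simp add: cv_def l_def hv_def)
    have A: "Am (hv i) (pair (hv (Suc i))) \<noteq> 0" for i
      unfolding hv_def using hs r by (intro mod_Suc_lift[where P = "\<lambda>i k. Am (hs ! i) (pair (hs ! k)) \<noteq> 0"]) auto
    have pp: "pair (pair (hv i)) = hv i" for i using hvH by (intro pair_pair Hs_snd)
    have step: "cv l i = nbr (cv l (Suc i)) (snd (hv (Suc i)))" for i
      using A[of i] unfolding cvl by (auto simp: Am_def pair_def split: if_splits)
    have dir: "snd (hv (Suc i)) = dirof (cv l (Suc i)) (cv l i)" for i
      using step[of i] dirof_nbr[of "snd (hv (Suc i))" "cv l (Suc i)"] Hs_snd[OF hvH] by simp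
    have ad: "adj (cv l i) (cv l (Suc i))" for i
    proof -
      have "adj (cv l (Suc i)) (cv l i)"
        using adj_nbr[of "cv l (Suc i)" "snd (hv (Suc i))"] unfolding step[of i, symmetric] .
      then show ?thesis using adj_sym by blast
    qed
    have hv_eq: "hv (Suc i) = (cv l (Suc i), dirof (cv l (Suc i)) (cv l i))" for i
      using dir[of i] cvl[of "Suc i"] by (cases "hv (Suc i)") simp
    have nb: "cv l (Suc (Suc i)) \<noteq> cv l i" for i
    proof
      assume eq: "cv l (Suc (Suc i)) = cv l i"
      have "adj (cv l (Suc (Suc i))) (cv l (Suc i))" using ad[of "Suc i"] adj_sym by blast
      then have "pair (hv (Suc (Suc i))) = (cv l (Suc i), dirof (cv l (Suc i)) (cv l (Suc (Suc i))))"
        unfolding hv_eq by (rule pair_dirof)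
      then show False using A[of "Suc i"] eq by (simp add: Am_def hv_eq)
    qed
    have cl: "closed_path l"
      using len r ad nb by (auto simp: closed_path_def)
    show "map fst hs \<in> closed_paths R r"
      using cl len hs unfolding l_def by (auto simp: closed_paths_def Hs_def)
    show "back_halves (map fst hs) = hs"
    proof (rule nth_equalityI)
      fix i assume "i < length (back_halves (map fst hs))"
      then have "i < r" using len by (simp add: l_def)
      \<comment> \<open>The predecessor of \<open>i\<close> modulo \<open>r\<close>, free of
        truncated subtraction.\<close>
      define k where "k = i + r - 1"
      have k: "i = Suc k mod r" using \<open>i < r\<close> by (simp add: k_def)
      have "back_halves l ! (Suc k mod length l) = (cv l (Suc k), dirof (cv l (Suc k)) (cv l k))"
        by (rule back_halves_nth) (use len r in auto)
      also have "\<dots> = hv (Suc k)" by (rule hv_eq[symmetric])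
      finally show "back_halves (map fst hs) ! i = hs ! i" using k len by (simp add: l_def hv_def)
    qed (use len in \<open>simp add: l_def\<close>)
  next
    fix l assume l: "l \<in> closed_paths R r"
    then have cl: "closed_path l" and len: "length l = r" and lR: "set l \<subseteq> R" by (auto simp: closed_paths_def)
    note ne = closed_pathD(1)[OF cl]
    show "map fst (back_halves l) = l" by (rule map_fst_back_halves)
    have cvR: "cv l i \<in> R" for i using lR ne by (auto simp: cv_def intro!: subsetD[OF lR])
    have bh: "back_halves l ! (Suc i mod r) = (cv l (Suc i), dirof (cv l (Suc i)) (cv l i))" for i
      using back_halves_nth[OF ne] len by simp
    have pbh: "pair (back_halves l ! (Suc i mod r)) = (cv l i, path_dir l i)" for i
      unfolding bh path_dir_def by (rule pair_dirof) (use closed_pathD(2)[OF cl, of i] adj_sym in blast)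
    have H: "set (back_halves l) \<subseteq> Hs R"
    proof
      fix k assume "k \<in> set (back_halves l)"
      then obtain i where "k = (cv l i, dirof (cv l i) (cv l (i + length l - 1)))"
        by (auto simp: back_halves_def)
      then show "k \<in> Hs R" by (simp add: Hs_iff cvR dirof_less)
    qed
    define bv where "bv i = back_halves l ! (i mod r)" for i
    have bv: "bv (Suc i) = (cv l (Suc i), opp (path_dir l i))" for i
      unfolding bv_def bh path_dir_def using dirof_sym[OF closed_pathD(2)[OF cl, of i]] by simp
    have tw: "Am (bv (Suc i)) (pair (bv (Suc (Suc i)))) = Am ((0, 0), opp (path_dir l i)) ((0, 0), path_dir l (Suc i))" for i
    proof -
      have "pair (bv (Suc (Suc i))) = (cv l (Suc i), path_dir l (Suc i))" unfolding bv_def by (rule pbh)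
      then show ?thesis by (simp add: bv Am_def)
    qed
    have ndir: "opp (path_dir l i) \<noteq> path_dir l (Suc i)" for i
    proof
      assume eq: "opp (path_dir l i) = path_dir l (Suc i)"
      have "cv l i = nbr (cv l (Suc i)) (opp (path_dir l i))"
      proof -
        have "adj (cv l (Suc i)) (cv l i)" using closed_pathD(2)[OF cl, of i] adj_sym by blast
        from nbr_dirof[OF this] show ?thesis
          using dirof_sym[OF closed_pathD(2)[OF cl, of i]] by (simp add: path_dir_def)
      qed
      also have "\<dots> = cv l (Suc (Suc i))"
        unfolding eq unfolding path_dir_def by (rule nbr_dirof[OF closed_pathD(2)[OF cl]])
      finally show False using closed_pathD(3)[OF cl, of i] by simp
    qed
    have per: "bv (i + r) = bv i" for i by (simp add: bv_def)
    have A: "Am (bv i) (pair (bv (Suc i))) \<noteq> 0" for i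
    proof -
      have "bv i = bv (Suc (i + r - 1))" "bv (Suc i) = bv (Suc (Suc (i + r - 1)))"
        using per[of i] per[of "Suc i"] r by simp_all
      then show ?thesis using tw[of "i + r - 1"] ndir[of "i + r - 1"] by (auto simp: Am_def)
    qed
    show "back_halves l \<in> ?good"
    proof (intro CollectI conjI allI impI)
      show "Am (back_halves l ! i) (pair (back_halves l ! (Suc i mod r))) \<noteq> 0" if "i < r" for i
        using A[of i] that by (simp add: bv_def)
    qed (use H len in simp_all)
    \<comment> \<open>The entry from \<open>bv i\<close> to \<open>bv (Suc i)\<close> describes the
      turn at vertex \<open>i\<close>. Shifting the cyclic product by one expresses it by
      \<open>path_dir l i\<close> and \<open>path_dir l (Suc i)\<close>, avoiding the index
      \<open>i - 1\<close>.\<close>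
    have shift: "(\<Prod>i<r. q i) = (\<Prod>i<r. q (Suc i))" if "q r = q 0" for q :: "nat \<Rightarrow> real"
    proof -
      obtain m where m: "r = Suc m" using r by (cases r) auto
      show ?thesis unfolding m prod.lessThan_Suc_shift[of q] using that m by (simp add: mult.commute)
    qed
    have "?w (back_halves l) = (\<Prod>i<r. kw R x (bv i) (bv (Suc i)))"
      by (intro prod.cong) (auto simp: bv_def)
    also have "\<dots> = (\<Prod>i<r. kw R x (bv (Suc i)) (bv (Suc (Suc i))))"
      by (rule shift) (use per[of 0] per[of "Suc 0"] in simp)
    also have "\<dots> = (\<Prod>i<r. turn_weight (path_dir l i) (path_dir l (Suc i)) * x (cv l (Suc i), path_dir l (Suc i)))"
    proof (rule prod.cong[OF refl])
      fix i assume "i \<in> {..<r}"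
      have bvH: "bv i \<in> Hs R" for i unfolding bv_def using H len r by (auto intro!: subsetD[OF H])
      have "pair (bv (Suc (Suc i))) = (cv l (Suc i), path_dir l (Suc i))" unfolding bv_def by (rule pbh)
      moreover have "opp (snd (bv (Suc (Suc i)))) = path_dir l (Suc i)"
        unfolding bv by (simp add: opp_opp path_dir_def dirof_less)
      ultimately show "kw R x (bv (Suc i)) (bv (Suc (Suc i))) =
        turn_weight (path_dir l i) (path_dir l (Suc i)) * x (cv l (Suc i), path_dir l (Suc i))"
        unfolding kw_eq[OF bvH bvH R] tw turn_weight_def by simp
    qed
    finally show "?w (back_halves l) =
      (\<Prod>i<r. turn_weight (path_dir l i) (path_dir l (Suc i)) * x (cv l (Suc i), path_dir l (Suc i)))" .
  qed
  finally show ?thesis .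
qed

text \<open>Square roots of the directions \<open>dir_vec e\<close>. The phase of half a turning
  angle is a quotient of two such roots up to sign, so conjugation by \<open>phase\<close> makes the
  matrix real.\<close>

definition phase :: "nat \<Rightarrow> complex" where
  "phase e = (if e = 0 then \<i> else if e = 1 then cis (3 * (pi / 4)) else if e = 2 then 1 else cis (pi / 4))"

definition dir_vec :: "nat \<Rightarrow> complex" where
  "dir_vec e = (if e = 0 then -1 else if e = 1 then -\<i> else if e = 2 then 1 else \<i>)"

lemma step_vec_dir: "closed_path l \<Longrightarrow> step_vec l i = dir_vec (path_dir l i)"
  using closed_pathD(2)[of l i] unfolding step_vec_def path_dir_def
  by (cases "cv l i", simp, elim adj_cases) (auto simp: to_complex_def dir_vec_def dirof_def complex_eq_iff)

lemma turn_angle_dir_vec: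
  assumes "e < 4" "f < 4" "f \<noteq> opp e"
  shows "turn_angle (dir_vec e) (dir_vec f) = (if f = e then 0 else if f = (e + 1) mod 4 then pi / 2 else - (pi / 2))"
proof -
  have "dir_vec f / dir_vec e = (if f = e then 1 else if f = (e + 1) mod 4 then \<i> else -\<i>)"
    by (insert assms(3), (rule direction_cases[OF assms(1)]; rule direction_cases[OF assms(2)]; simp add: dir_vec_def opp_def))
  then show ?thesis by (simp add: turn_angle_def Arg_minus_ii Arg_ii)
qed

text \<open>The real matrix entries are the Kac--Ward phases conjugated by \<open>phase\<close>; the extra sign on vertical
  steps cancels along closed paths, which have an even number of them.\<close>
lemma turn_weight_phase:
  assumes "e < 4" "f < 4" "f \<noteq> opp e"
  shows "complex_of_real (turn_weight e f) * phase f * (if f = 1 \<or> f = 3 then -1 else 1)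
    = cis (turn_angle (dir_vec e) (dir_vec f) / 2) * phase e"
proof -
  define s where "s = sqrt 2 / 2"
  have s: "s * s = 1 / 2" by (simp add: s_def)
  have c1: "cis (pi / 4) = Complex s s"
    by (simp add: complex_eq_iff cos_45 sin_45 s_def)
  have c2: "cis (- (pi / 4)) = Complex s (- s)"
    by (simp add: complex_eq_iff cos_45 sin_45 s_def)
  have "3 * (pi / 4) = pi - pi / 4" by simp
  then have c3: "cis (3 * (pi / 4)) = Complex (- s) s"
    by (simp only: cis.code cos_pi_minus sin_pi_minus cos_45 sin_45 s_def)
  have t: "cis (turn_angle (dir_vec e) (dir_vec f) / 2) =
      (if f = e then 1 else if f = (e + 1) mod 4 then Complex s s else Complex s (- s))"
    unfolding turn_angle_dir_vec[OF assms] using c1 c2 by simp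
  have ph: "phase e = (if e = 0 then \<i> else if e = 1 then Complex (- s) s else if e = 2 then 1 else Complex s s)" for e
    unfolding phase_def c1 c3 by simp
  show ?thesis
    unfolding t ph
    by (insert assms(3) s, (rule direction_cases[OF assms(1)]; rule direction_cases[OF assms(2)];
      simp add: turn_weight_def Am_def bsgn_def opp_def complex_eq_iff))
qed

section \<open>Loops as orbits of closed paths\<close>

lemma prod_shift:
  fixes f :: "nat \<Rightarrow> 'a::comm_monoid_mult"
  assumes "\<And>i. f (i + r) = f i"
  shows "(\<Prod>i<r. f (i + k)) = (\<Prod>i<r. f i)"
proof (induction k)
  case (Suc k)
  have "(\<Prod>i<r. f (Suc (i + k))) = (\<Prod>i<r. f (i + k))"
  proof (cases r)
    case (Suc m)
    have "f (Suc m + k) = f k" using assms[of k] Suc by (simp add: add.commute)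
    then have "(\<Prod>i<Suc m. f (Suc (i + k))) = (\<Prod>i<m. f (Suc (i + k))) * f k" by simp
    also have "\<dots> = (\<Prod>i<Suc m. f (i + k))"
      by (subst prod.lessThan_Suc_shift) (simp add: mult.commute)
    finally show ?thesis using Suc by simp
  qed simp
  then show ?case using Suc by simp
qed simp

lemma sum_shift:
  fixes f :: "nat \<Rightarrow> 'a::comm_monoid_add"
  assumes "\<And>i. f (i + r) = f i"
  shows "(\<Sum>i<r. f (i + k)) = (\<Sum>i<r. f i)"
proof (induction k)
  case (Suc k)
  have "(\<Sum>i<r. f (Suc (i + k))) = (\<Sum>i<r. f (i + k))"
  proof (cases r)
    case (Suc m)
    have "f (Suc m + k) = f k" using assms[of k] Suc by (simp add: add.commute)
    then have "(\<Sum>i<Suc m. f (Suc (i + k))) = (\<Sum>i<m. f (Suc (i + k))) + f k" by simp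
    also have "\<dots> = (\<Sum>i<Suc m. f (i + k))"
      by (subst sum.lessThan_Suc_shift) (simp add: add.commute)
    finally show ?thesis using Suc by simp
  qed simp
  then show ?case using Suc by simp
qed simp

lemma cv_add_length: "cv l (i + length l) = cv l i"
  by (simp add: cv_def)

lemma path_dir_add_length: "path_dir l (i + length l) = path_dir l i"
  using cv_add_length[of l i] cv_add_length[of l "Suc i"] by (simp add: path_dir_def)

lemma path_dir_no_backtrack:
  assumes "closed_path l" shows "path_dir l (Suc i) \<noteq> opp (path_dir l i)"
proof
  assume eq: "path_dir l (Suc i) = opp (path_dir l i)"
  note ad = closed_pathD(2)[OF assms]
  have "cv l (Suc (Suc i)) = nbr (cv l (Suc i)) (path_dir l (Suc i))"
    using nbr_dirof[OF ad[of "Suc i"]] by (simp add: path_dir_def)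
  also have "\<dots> = nbr (cv l (Suc i)) (dirof (cv l (Suc i)) (cv l i))"
    unfolding eq using dirof_sym[OF ad[of i]] by (simp add: path_dir_def)
  also have "\<dots> = cv l i"
    using ad[of i] adj_sym nbr_dirof by blast
  finally show False using closed_pathD(3)[OF assms] by blast
qed

lemma prod_cis: "(\<Prod>i<n. cis (t i)) = cis (\<Sum>i<n. t i)" for n :: nat
  by (induction n) (simp_all add: cis_mult)

lemma phase_nonzero: "phase e \<noteq> 0"
  by (simp add: phase_def)

text \<open>\<open>\<Gamma>\<close> is a gauge: a real weight times \<open>\<Gamma> (Suc i)\<close>
  equals the half-angle phase times \<open>\<Gamma> i\<close>. Being nonzero and periodic along the
  path, it drops out of the product. In particular \<open>loop_sgn\<close> is real on closed
  paths.\<close>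

lemma loop_sgn_turn_weight:
  assumes cl: "closed_path l"
  shows "complex_of_real (\<Prod>i<length l. turn_weight (path_dir l i) (path_dir l (Suc i))) = - loop_sgn l"
proof -
  let ?r = "length l"
  \<comment> \<open>The parity of the row changes exactly at vertical steps and so absorbs their
    extra sign.\<close>
  define \<kappa> where "\<kappa> v = (if even (snd v) then 1 else -1 :: complex)" for v :: pt
  define \<Gamma> where "\<Gamma> i = phase (path_dir l i) * \<kappa> (cv l (Suc i))" for i
  let ?t = "\<lambda>i. turn_angle (step_vec l i) (step_vec l (Suc i))"
  have step: "complex_of_real (turn_weight (path_dir l i) (path_dir l (Suc i))) * \<Gamma> (Suc i) = cis (?t i / 2) * \<Gamma> i" for i
  proof -
    let ?e = "path_dir l i" and ?f = "path_dir l (Suc i)"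
    have "complex_of_real (turn_weight ?e ?f) * phase ?f * (if ?f = 1 \<or> ?f = 3 then -1 else 1) =
        cis (?t i / 2) * phase ?e"
      unfolding step_vec_dir[OF cl]
      by (rule turn_weight_phase) (auto simp: path_dir_def dirof_less path_dir_no_backtrack[OF cl, unfolded path_dir_def])
    moreover have "(if ?f = 1 \<or> ?f = 3 then -1 else 1) * \<kappa> (cv l (Suc i)) = \<kappa> (cv l (Suc (Suc i)))"
      using closed_pathD(2)[OF cl, of "Suc i"] unfolding path_dir_def
      by (cases "cv l (Suc i)", simp, elim adj_cases) (auto simp: \<kappa>_def dirof_def)
    moreover have "A * (B * (n * K)) = C * (D * K)" if "A * B * n = C * D" for A B C D n K :: complex
      using that by (simp add: mult.assoc[symmetric])
    ultimately show ?thesis unfolding \<Gamma>_def by (metis (no_types))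
  qed
  have nz: "(\<Prod>i<?r. \<Gamma> i) \<noteq> 0" by (simp add: \<Gamma>_def \<kappa>_def phase_nonzero)
  have per: "\<Gamma> (i + ?r) = \<Gamma> i" for i
    using path_dir_add_length[of l i] cv_add_length[of l "Suc i"] by (simp add: \<Gamma>_def)
  have "(\<Prod>i<?r. \<Gamma> (Suc i)) = (\<Prod>i<?r. \<Gamma> i)"
    using prod_shift[of \<Gamma> ?r 1, OF per] by simp
  moreover have "(\<Prod>i<?r. complex_of_real (turn_weight (path_dir l i) (path_dir l (Suc i)))) * (\<Prod>i<?r. \<Gamma> (Suc i))
     = (\<Prod>i<?r. cis (?t i / 2)) * (\<Prod>i<?r. \<Gamma> i)"
    unfolding prod.distrib[symmetric] using step by simp
  ultimately have "(\<Prod>i<?r. complex_of_real (turn_weight (path_dir l i) (path_dir l (Suc i)))) = (\<Prod>i<?r. cis (?t i / 2))"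
    using nz by simp
  also have "\<dots> = cis (\<Sum>i<?r. ?t i / 2)"
    by (rule prod_cis)
  also have "(\<Sum>i<?r. ?t i / 2) = winding l / 2" by (simp add: winding_def sum_divide_distrib)
  finally show ?thesis by (simp add: loop_sgn_def cis_conv_exp)
qed

section \<open>Rotation and reversal of closed paths\<close>

lemma cv_rotate:
  assumes "l \<noteq> []" shows "cv (rotate k l) i = cv l (i + k)"
proof -
  have "cv (rotate k l) i = l ! ((k + i mod length l) mod length l)"
    using assms by (simp add: cv_def nth_rotate)
  then show ?thesis by (simp add: cv_def mod_add_right_eq add.commute)
qed

text \<open>Adding \<open>N\<close> full periods keeps the reversed index from truncating at
  \<open>0\<close>; later uses take \<open>N\<close> large enough for their subtractions.\<close>

lemma cv_rev:
  assumes "i < N * length l" shows "cv (rev l) i = cv l (N * length l - Suc i)"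
proof -
  let ?r = "length l"
  have r: "0 < ?r" using assms by (cases "length l = 0") auto
  have m: "i mod ?r < ?r" using r by simp
  have "i div ?r < N" using assms r by (simp add: div_less_iff_less_mult)
  then obtain k where k: "N = i div ?r + Suc k" using less_iff_Suc_add by auto
  have "N * ?r - Suc i = k * ?r + (?r - Suc (i mod ?r))"
  proof -
    have "N * ?r = (i div ?r) * ?r + k * ?r + ?r" unfolding k by (simp add: algebra_simps)
    moreover have "i = (i div ?r) * ?r + i mod ?r" by simp
    ultimately show ?thesis using m by linarith
  qed
  then have "cv l (N * ?r - Suc i) = cv l (?r - Suc (i mod ?r))"
    by (intro cv_cong) simp
  then show ?thesis using m r by (simp add: cv_def rev_nth)
qed

lemma closed_path_length:
  assumes "closed_path l" shows "2 \<le> length l"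
proof -
  have "length l \<noteq> 1"
    using closed_pathD(2)[OF assms, of 0] by (auto simp: cv_def adj_def)
  then show ?thesis using closed_pathD(1)[OF assms] by (cases l) (auto simp: Suc_le_eq)
qed

lemma closed_path_rotate:
  assumes "closed_path l" shows "closed_path (rotate k l)"
  using assms closed_pathD[OF assms] by (simp add: closed_path_def cv_rotate)

lemma closed_path_rev:
  assumes cl: "closed_path l" shows "closed_path (rev l)"
  unfolding closed_path_def
proof (intro conjI allI impI)
  let ?r = "length l"
  show "rev l \<noteq> []" using closed_pathD(1)[OF cl] by simp
  fix i assume "i < length (rev l)"
  then have i: "Suc (Suc i) < 2 * ?r" using closed_path_length[OF cl] by simp
  define k where "k = 2 * ?r - Suc (Suc (Suc i))"
  have k: "2 * ?r - Suc (Suc i) = Suc k" "2 * ?r - Suc i = Suc (Suc k)" using i by (auto simp: k_def)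
  have c: "cv (rev l) i = cv l (Suc (Suc k))" "cv (rev l) (Suc i) = cv l (Suc k)" "cv (rev l) (Suc (Suc i)) = cv l k"
    using cv_rev[of i 2 l] cv_rev[of "Suc i" 2 l] cv_rev[of "Suc (Suc i)" 2 l] i k by (simp_all add: k_def)
  show "adj (cv (rev l) i) (cv (rev l) (i + 1))" "cv (rev l) (i + 2) \<noteq> cv (rev l) i"
    using closed_pathD(2)[OF cl, of "Suc k"] closed_pathD(3)[OF cl, of k] adj_sym by (auto simp: c)
qed

lemma loop_sgn_rotate:
  assumes cl: "closed_path l" shows "loop_sgn (rotate k l) = loop_sgn l"
proof -
  have pd: "path_dir (rotate k l) i = path_dir l (i + k)" for i
    using closed_pathD(1)[OF cl] by (simp add: path_dir_def cv_rotate)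
  have "(\<Prod>i<length l. turn_weight (path_dir l (i + k)) (path_dir l (Suc (i + k))))
    = (\<Prod>i<length l. turn_weight (path_dir l i) (path_dir l (Suc i)))"
    using path_dir_add_length[of l] path_dir_add_length[of l "Suc _"]
    by (intro prod_shift[where f = "\<lambda>i. turn_weight (path_dir l i) (path_dir l (Suc i))"]) simp
  then have "- loop_sgn (rotate k l) = - loop_sgn l"
    unfolding loop_sgn_turn_weight[OF cl, symmetric] loop_sgn_turn_weight[OF closed_path_rotate[OF cl], symmetric]
    by (simp add: pd)
  then show ?thesis by simp
qed

lemma turn_angle_opp:
  assumes "e < 4" "f < 4" "f \<noteq> opp e"
  shows "turn_angle (dir_vec (opp f)) (dir_vec (opp e)) = - turn_angle (dir_vec e) (dir_vec f)"
proof -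
  have 1: "opp e \<noteq> opp (opp f)" using assms opp_opp by metis
  show ?thesis
    unfolding turn_angle_dir_vec[OF assms] turn_angle_dir_vec[OF opp_less opp_less 1]
    by (insert assms(3), (rule direction_cases[OF assms(1)]; rule direction_cases[OF assms(2)]; simp add: opp_def))
qed

lemma path_dir_rev:
  assumes cl: "closed_path l" and "Suc i < 2 * length l"
  shows "path_dir (rev l) i = opp (path_dir l (2 * length l - Suc (Suc i)))"
proof -
  let ?k = "2 * length l - Suc (Suc i)"
  have "2 * length l - Suc i = Suc ?k" using assms by simp
  then have "cv (rev l) i = cv l (Suc ?k)" "cv (rev l) (Suc i) = cv l ?k"
    using cv_rev[of i 2 l] cv_rev[of "Suc i" 2 l] assms by simp_all
  then show ?thesis using dirof_sym[OF closed_pathD(2)[OF cl, of ?k]] by (simp add: path_dir_def)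
qed

text \<open>Every turn is traversed with the opposite angle. The summands are indexed over two
  periods so that no subtraction truncates.\<close>

lemma winding_rev:
  assumes cl: "closed_path l" shows "winding (rev l) = - winding l"
proof -
  let ?r = "length l"
  let ?t = "\<lambda>i. turn_angle (dir_vec (path_dir l i)) (dir_vec (path_dir l (Suc i)))"
  have r: "2 \<le> ?r" by (rule closed_path_length[OF cl])
  have per: "?t (i + ?r) = ?t i" for i
    using path_dir_add_length[of l i] path_dir_add_length[of l "Suc i"] by simp
  have "winding (rev l) = (\<Sum>i<?r. - ?t (?r - Suc i + (?r - 2)))"
    unfolding winding_def length_rev
  proof (rule sum.cong[OF refl])
    fix i assume "i \<in> {..<?r}"
    then have i: "i < ?r" by simp
    let ?k = "?r - Suc i + (?r - 2)"
    have k: "2 * ?r - Suc (Suc i) = Suc ?k" "2 * ?r - Suc (Suc (Suc i)) = ?k" using i r by simp_all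
    have "path_dir (rev l) i = opp (path_dir l (Suc ?k))" "path_dir (rev l) (Suc i) = opp (path_dir l ?k)"
      using path_dir_rev[OF cl, of i] path_dir_rev[OF cl, of "Suc i"] i r unfolding k by simp_all
    then show "turn_angle (step_vec (rev l) i) (step_vec (rev l) (i + 1)) = - ?t ?k"
      using turn_angle_opp[of "path_dir l ?k" "path_dir l (Suc ?k)"] path_dir_no_backtrack[OF cl, of ?k]
      by (simp add: step_vec_dir[OF closed_path_rev[OF cl]] path_dir_def dirof_less)
  qed
  also have "\<dots> = - (\<Sum>i<?r. ?t (?r - Suc i + (?r - 2)))" by (rule sum_negf)
  also have "(\<Sum>i<?r. ?t (?r - Suc i + (?r - 2))) = (\<Sum>i<?r. ?t (i + (?r - 2)))"
    by (rule sum.nat_diff_reindex)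
  also have "\<dots> = (\<Sum>i<?r. ?t i)" by (rule sum_shift[of ?t, OF per])
  finally show ?thesis by (simp add: winding_def step_vec_dir[OF cl])
qed

text \<open>Reversal negates the winding and hence conjugates the sign, which is real by
  \<open>loop_sgn_turn_weight\<close>.\<close>

lemma loop_sgn_rev:
  assumes cl: "closed_path l" shows "loop_sgn (rev l) = loop_sgn l"
proof -
  have "loop_sgn (rev l) = cnj (loop_sgn l)"
    by (simp add: loop_sgn_def winding_rev[OF cl] exp_cnj)
  also have "loop_sgn l = - complex_of_real (\<Prod>i<length l. turn_weight (path_dir l i) (path_dir l (Suc i)))"
    using loop_sgn_turn_weight[OF cl] by simp
  finally show ?thesis using loop_sgn_turn_weight[OF cl] by simp
qed

section \<open>Orbits under rotation and reversal\<close>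

definition rots :: "'a list \<Rightarrow> 'a list set" where
  "rots l = range (\<lambda>k. rotate k l)"

definition orbit :: "'a list \<Rightarrow> 'a list set" where
  "orbit l = rots l \<union> rots (rev l)"

lemma rotate_inverse: "\<exists>m. rotate m (rotate k l) = l"
proof (cases "l = []")
  case False
  have "rotate (length l - k mod length l) (rotate k l) = rotate ((length l - k mod length l + k) mod length l) l"
    by (simp add: rotate_rotate rotate_conv_mod[symmetric])
  also have "(length l - k mod length l + k) mod length l = (length l - k mod length l + k mod length l) mod length l"
    by (simp add: mod_add_right_eq)
  also have "\<dots> = 0" using False by (simp add: less_imp_le)
  finally show ?thesis by (intro exI) simp
qed simp

lemma rots_rotate: "rots (rotate k l) = rots l"
proof
  show "rots (rotate k l) \<subseteq> rots l" by (auto simp: rots_def rotate_rotate)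
  obtain m where m: "rotate m (rotate k l) = l" using rotate_inverse by blast
  have "rotate j l = rotate (j + m) (rotate k l)" for j
    using m rotate_rotate[of j m "rotate k l"] by simp
  then show "rots l \<subseteq> rots (rotate k l)" unfolding rots_def by blast
qed

lemma rev_rotate: "\<exists>m. rev (rotate k l) = rotate m (rev l)"
proof (cases "l = []")
  case False
  let ?r = "length l"
  let ?n = "?r - k mod ?r"
  have "rotate (?r - ?n mod ?r) l = rotate k l"
  proof (cases "k mod ?r = 0")
    case True
    then show ?thesis using rotate_conv_mod[of k l] by simp
  next
    case nz: False
    have "k mod ?r < ?r" using False by simp
    then have "?r - ?n mod ?r = k mod ?r" using nz by simp
    then show ?thesis using rotate_conv_mod[of k l] by simp
  qed
  then have "rotate ?n (rev l) = rev (rotate k l)" by (simp add: rotate_rev)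
  then show ?thesis by metis
qed simp

lemma rots_rev: "rots (rev l) = rev ` rots l"
proof
  show "rev ` rots l \<subseteq> rots (rev l)" using rev_rotate by (fastforce simp: rots_def)
  show "rots (rev l) \<subseteq> rev ` rots l"
  proof
    fix m assume "m \<in> rots (rev l)"
    then obtain k where k: "m = rotate k (rev l)" by (auto simp: rots_def)
    obtain j where "rev m = rotate j (rev (rev l))" using rev_rotate k by blast
    then have "m = rev (rotate j l)" by (simp add: rev_swap)
    then show "m \<in> rev ` rots l" by (auto simp: rots_def)
  qed
qed

lemma orbit_self: "l \<in> orbit l"
  by (auto simp: orbit_def rots_def intro: range_eqI[of _ _ 0])

lemma orbit_eq: "m \<in> orbit l \<Longrightarrow> orbit m = orbit l"
proof -
  assume "m \<in> orbit l"
  then consider k where "m = rotate k l" | k where "m = rotate k (rev l)" by (auto simp: orbit_def rots_def)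
  then show ?thesis
  proof cases
    case 1
    then show ?thesis by (simp add: orbit_def rots_rotate rots_rev[of l] rots_rev[of "rotate k l"])
  next
    case 2
    then have "rots m = rots (rev l)" by (simp add: rots_rotate)
    moreover from this have "rots (rev m) = rots l" by (simp add: rots_rev image_image)
    ultimately show ?thesis by (auto simp: orbit_def)
  qed
qed

lemma rots_lessThan:
  assumes "l \<noteq> []" shows "rots l = (\<lambda>k. rotate k l) ` {..<length l}"
proof
  show "rots l \<subseteq> (\<lambda>k. rotate k l) ` {..<length l}"
    unfolding rots_def
  proof (rule image_subsetI)
    fix k show "rotate k l \<in> (\<lambda>k. rotate k l) ` {..<length l}"
      using assms rotate_conv_mod[of k l] by (intro image_eqI[of _ _ "k mod length l"]) simp_all
  qed
qed (auto simp: rots_def)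

lemma orbit_lessThan:
  assumes "l \<noteq> []"
  shows "m \<in> orbit l \<longleftrightarrow> (\<exists>k<length l. m = rotate k l \<or> m = rotate k (rev l))"
  using rots_lessThan[OF assms] rots_lessThan[of "rev l"] assms by (auto simp: orbit_def)

text \<open>Otherwise the path would be invariant under a reflection of its index cycle. If the
  reflection fixes an index, the path backtracks there; if it exchanges two consecutive indices,
  they carry the same vertex.\<close>

lemma rotate_not_rev:
  assumes cl: "closed_path l" shows "rotate m l \<noteq> rev l"
proof
  assume eq0: "rotate m l = rev l"
  let ?r = "length l"
  define k where "k = m mod ?r"
  have r: "2 \<le> ?r" by (rule closed_path_length[OF cl])
  have "0 < ?r" using r by linarith
  then have k: "k < ?r" by (simp add: k_def)
  have eq: "rotate k l = rev l" using eq0 rotate_conv_mod[of m l] by (simp add: k_def)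
  \<comment> \<open>The two indices always add up to \<open>k + 4 * ?r - 1\<close>; four periods
    leave room for the subtractions below.\<close>
  have sym: "cv l (i + k) = cv l (4 * ?r - Suc i)" if "i < 4 * ?r" for i
    using cv_rev[OF that] cv_rotate[OF closed_pathD(1)[OF cl], of k i] eq by simp
  \<comment> \<open>The centre of the reflection, rounded down.\<close>
  define a where "a = (k + 4 * ?r - 1) div 2"
  show False
  proof (cases "even (k + 4 * ?r - 1)")
    case True
    then have a: "2 * a = k + 4 * ?r - 1" unfolding a_def by (rule even_two_times_div_two)
    have "k \<le> a - 1" "a - 1 - k < 4 * ?r" "4 * ?r - Suc (a - 1 - k) = Suc a" "Suc (Suc (a - 1)) = Suc a"
      using a k r by linarith+
    then have "cv l (a - 1) = cv l (Suc (Suc (a - 1)))"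
      using sym[of "a - 1 - k"] by simp
    then show False using closed_pathD(3)[OF cl, of "a - 1"] by simp
  next
    case False
    then have a: "2 * a + 1 = k + 4 * ?r - 1" unfolding a_def by (rule odd_two_times_div_two_succ)
    have "k \<le> a" "a - k < 4 * ?r" "4 * ?r - Suc (a - k) = Suc a" using a k r by linarith+
    then have "cv l a = cv l (Suc a)"
      using sym[of "a - k"] by simp
    then show False using closed_pathD(2)[OF cl, of a] by (simp add: adj_def)
  qed
qed

definition period :: "'a list \<Rightarrow> nat" where
  "period l = (LEAST p. 0 < p \<and> rotate p l = l)"

lemma period_props:
  assumes "l \<noteq> []"
  shows "0 < period l" "rotate (period l) l = l" "0 < p \<Longrightarrow> rotate p l = l \<Longrightarrow> period l \<le> p"
proof -
  have ex: "0 < length l \<and> rotate (length l) l = l" using assms by simp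
  show "0 < period l" "rotate (period l) l = l"
    using LeastI[of "\<lambda>p. 0 < p \<and> rotate p l = l", OF ex] by (simp_all add: period_def)
  show "0 < p \<Longrightarrow> rotate p l = l \<Longrightarrow> period l \<le> p"
    unfolding period_def by (rule Least_le) simp
qed

text \<open>Rotations by multiples of the period act trivially, and by minimality those below it
  give different lists.\<close>

lemma card_rots:
  assumes "l \<noteq> []" shows "card (rots l) = period l" "finite (rots l)"
proof -
  let ?p = "period l"
  note pp = period_props[OF assms]
  have mult: "rotate (q * ?p) l = l" for q
    by (induction q) (simp_all add: pp(2) rotate_rotate[symmetric] add.commute)
  have "rotate k l = rotate (k mod ?p) l" for k
  proof -
    have "rotate k l = rotate (k mod ?p + (k div ?p) * ?p) l" by (simp add: add.commute)
    also have "\<dots> = rotate (k mod ?p) l" by (simp only: rotate_rotate[symmetric] mult)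
    finally show ?thesis .
  qed
  then have "rots l = (\<lambda>k. rotate k l) ` {..<?p}"
    using pp(1) unfolding rots_def by (auto simp: image_iff) (metis lessThan_iff mod_less_divisor)
  moreover have "inj_on (\<lambda>k. rotate k l) {..<?p}"
  proof (rule linorder_inj_onI)
    fix i j assume ij: "i < j" "i \<in> {..<?p}" "j \<in> {..<?p}"
    show "rotate i l \<noteq> rotate j l"
    proof
      assume eq: "rotate i l = rotate j l"
      have "j - i + ?p = ?p - i + j" using ij by simp
      then have "rotate (j - i + ?p) l = rotate (?p - i) (rotate j l)" by (simp only: rotate_rotate)
      also have "\<dots> = rotate ?p l" unfolding eq[symmetric] using ij by (simp add: rotate_rotate)
      finally have "rotate (j - i) l = l" using pp(2) by (simp add: rotate_rotate[symmetric])
      then show False using pp(3)[of "j - i"] ij by simp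
    qed
  qed auto
  ultimately show "card (rots l) = period l" "finite (rots l)" by (simp_all add: card_image)
qed

text \<open>The factor \<open>2\<close> counts orientations: by \<open>rotate_not_rev\<close> the
  rotations of \<open>l\<close> and of \<open>rev l\<close> are disjoint.\<close>

lemma card_orbit:
  assumes cl: "closed_path l" shows "card (orbit l) = 2 * period l" "finite (orbit l)"
proof -
  have ne: "l \<noteq> []" by (rule closed_pathD(1)[OF cl])
  have fin: "finite (rots l)" "finite (rots (rev l))" using card_rots ne by auto
  have "card (rots (rev l)) = card (rots l)"
    unfolding rots_rev by (rule card_image) (simp add: inj_on_def)
  moreover have "rots l \<inter> rots (rev l) = {}"
  proof (rule ccontr)
    assume "rots l \<inter> rots (rev l) \<noteq> {}"
    then obtain j k where jk: "rotate j l = rotate k (rev l)" by (auto simp: rots_def)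
    obtain i where "rotate i (rotate k (rev l)) = rev l" using rotate_inverse by blast
    then have "rotate (i + j) l = rev l" using jk by (simp add: rotate_rotate[symmetric])
    then show False using rotate_not_rev[OF cl] by blast
  qed
  ultimately show "card (orbit l) = 2 * period l" "finite (orbit l)"
    unfolding orbit_def using fin card_rots[OF ne] by (simp_all add: card_Un_disjoint)
qed

section \<open>Loops as lexicographically least representatives\<close>

lemma lex_le_antisym:
  assumes "lex_le l m" "lex_le m l" shows "l = m"
proof (rule ccontr)
  assume "l \<noteq> m"
  then have "(l, m) \<in> lexord {(p, q). pt_less p q}" "(m, l) \<in> lexord {(p, q). pt_less p q}"
    using assms by (auto simp: lex_le_def)
  moreover have "asym (lexord {(p, q). pt_less p q})"
    by (intro lexord_asym asymI) (auto simp: pt_less_def)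
  ultimately show False by (meson asymD)
qed

lemma ex_lex_least:
  assumes "finite S" "S \<noteq> {}" shows "\<exists>l\<in>S. \<forall>m\<in>S. lex_le l m"
proof -
  let ?r = "{(p, q). pt_less p q}"
  have tr: "trans ?r" by (rule transI) (auto simp: pt_less_def)
  have lin: "(x, y) \<in> lexord ?r \<or> (y, x) \<in> lexord ?r" if "x \<noteq> y" for x y
  proof -
    have "\<forall>p q. (p, q) \<in> ?r \<or> p = q \<or> (q, p) \<in> ?r" by (auto simp: pt_less_def prod_eq_iff)
    from lexord_linear[OF this, of x y] that show ?thesis by blast
  qed
  have "\<exists>xs. set xs = S \<and> distinct xs \<and> sorted_wrt (\<lambda>x y. (x, y) \<in> lexord ?r) xs"
    by (rule ex_sorted_list[OF assms(1)]) (erule (1) lexord_trans[OF _ _ tr], rule lin)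
  then obtain xs where xs: "set xs = S" "sorted_wrt (\<lambda>x y. (x, y) \<in> lexord ?r) xs" by blast
  then obtain y ys where "xs = y # ys" using assms(2) by (cases xs) auto
  then show ?thesis using xs by (intro bexI[of _ y]) (auto simp: lex_le_def)
qed

lemma is_loop_iff: "is_loop l \<longleftrightarrow> closed_path l \<and> (\<forall>m\<in>orbit l. lex_le l m)"
proof (cases "l = []")
  case False
  have "(\<forall>k<length l. lex_le l (rotate k l) \<and> lex_le l (rotate k (rev l))) \<longleftrightarrow> (\<forall>m\<in>orbit l. lex_le l m)"
    unfolding Ball_def orbit_lessThan[OF False] by metis
  then show ?thesis unfolding is_loop_def by simp
qed (simp add: is_loop_def closed_path_def)

lemma orbit_closed_path:
  assumes "closed_path l" "m \<in> orbit l"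
  shows "closed_path m" "loop_sgn m = loop_sgn l" "length m = length l"
  using assms closed_path_rotate closed_path_rev loop_sgn_rotate loop_sgn_rev
  by (auto simp: orbit_def rots_def)

text \<open>Each orbit contains exactly one loop, its lexicographic minimum, and has
  \<open>2 * period l\<close> elements. The period produces the division by \<open>loop_mult\<close>
  in the loop weight.\<close>

lemma sum_closed_paths_loops:
  fixes g :: "pt list \<Rightarrow> complex"
  assumes fin: "finite P" and cl: "\<And>l. l \<in> P \<Longrightarrow> closed_path l" and orb: "\<And>l. l \<in> P \<Longrightarrow> orbit l \<subseteq> P"
    and g: "\<And>l m. l \<in> P \<Longrightarrow> m \<in> orbit l \<Longrightarrow> g m = g l"
  shows "(\<Sum>l\<in>P. g l) = (\<Sum>l\<in>{l\<in>P. is_loop l}. 2 * of_nat (period l) * g l)"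
proof -
  let ?L = "{l\<in>P. is_loop l}"
  have U: "P = (\<Union>l\<in>?L. orbit l)"
  proof
    show "P \<subseteq> (\<Union>l\<in>?L. orbit l)"
    proof
      fix l assume l: "l \<in> P"
      obtain m where m: "m \<in> orbit l" "\<forall>k\<in>orbit l. lex_le m k"
        using ex_lex_least[of "orbit l"] card_orbit(2)[OF cl[OF l]] orbit_self by blast
      then have "m \<in> ?L" using orb[OF l] cl orbit_eq[OF m(1)] by (auto simp: is_loop_iff)
      moreover have "l \<in> orbit m" using orbit_eq[OF m(1)] orbit_self by blast
      ultimately show "l \<in> (\<Union>l\<in>?L. orbit l)" by blast
    qed
  qed (use orb in blast)
  have disj: "orbit l \<inter> orbit m = {}" if "l \<in> ?L" "m \<in> ?L" "l \<noteq> m" for l m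
  proof (rule ccontr)
    assume "orbit l \<inter> orbit m \<noteq> {}"
    then have "orbit l = orbit m" using orbit_eq by blast
    then have "m \<in> orbit l" "l \<in> orbit m" using orbit_self by auto
    then have "lex_le l m" "lex_le m l" using that by (auto simp: is_loop_iff)
    then show False using lex_le_antisym that by blast
  qed
  have "(\<Sum>l\<in>P. g l) = (\<Sum>l\<in>?L. \<Sum>m\<in>orbit l. g m)"
    by (subst U, rule sum.UNION_disjoint) (use fin disj cl card_orbit in auto)
  also have "\<dots> = (\<Sum>l\<in>?L. \<Sum>m\<in>orbit l. g l)"
    using g by (intro sum.cong refl) auto
  also have "\<dots> = (\<Sum>l\<in>?L. 2 * of_nat (period l) * g l)"
    using card_orbit(1) cl by (intro sum.cong refl) simp
  finally show ?thesis .
qed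

section \<open>Parity of crossings\<close>

definition ray_parity :: "pt \<Rightarrow> pt list \<Rightarrow> real" where
  "ray_parity p l = (\<Prod>i<length l. ray_sign p (cv l i, path_dir l i))"

lemma prod_sgb: "finite S \<Longrightarrow> (\<Prod>i\<in>S. sgb (Q i)) = (-1) ^ card {i \<in> S. Q i}"
proof -
  assume "finite S"
  then have "(\<Prod>i\<in>S. sgb (Q i)) = (\<Prod>i\<in>{i \<in> S. Q i}. -1)"
    by (rule prod.inter_filter[symmetric])
  then show ?thesis by simp
qed

lemma ray_parity_cases: "ray_parity p l = 1 \<or> ray_parity p l = -1"
  unfolding ray_parity_def ray_sign_def prod_sgb[OF finite_lessThan] by (simp add: minus_one_power_iff)

lemma ray_parity_square: "ray_parity p l * ray_parity p l = 1"
  using ray_parity_cases[of p l] by auto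

text \<open>Each index is once the start and once the end of a step, so a closed path crosses the
  boundary of any vertex set an even number of times.\<close>

lemma closed_path_cut:
  assumes "closed_path l"
  shows "(\<Prod>i<length l. sgb (Q (cv l i)) * sgb (Q (cv l (Suc i)))) = 1"
proof -
  have "(\<Prod>i<length l. sgb (Q (cv l (Suc i)))) = (\<Prod>i<length l. sgb (Q (cv l i)))"
    using prod_shift[of "\<lambda>i. sgb (Q (cv l i))" "length l" 1] by (simp add: cv_add_length)
  moreover have "(\<Prod>i<length l. sgb (Q (cv l i))) * (\<Prod>i<length l. sgb (Q (cv l i))) = 1"
    unfolding prod.distrib[symmetric] by (rule prod.neutral) simp
  ultimately show ?thesis by (simp only: prod.distrib)
qed

text \<open>The two rays differ by exactly the edge between their starting points.\<close>

lemma ray_sign_horizontal: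
  assumes "adj w w'"
  shows "ray_sign (i, j) (w, dirof w w') * ray_sign (i + 1, j) (w, dirof w w') = sgb (crosses w w' ((i, j), (i + 1, j)))"
proof (cases w)
  case (Pair m n)
  from assms[unfolded Pair] show ?thesis
    unfolding Pair by (cases rule: adj_cases; auto simp: ray_sign_def dirof_def crosses_def; presburger)
qed

text \<open>The two rays and the edge between their starting points bound a half-infinite strip,
  whose dual vertices are those of row \<open>j\<close> from column \<open>i\<close> on. A step
  crosses this boundary iff exactly one of its ends lies in the strip.\<close>

lemma ray_sign_vertical:
  assumes "adj w w'"
  shows "ray_sign (i, j) (w, dirof w w') * ray_sign (i, j + 1) (w, dirof w w') * sgb (crosses w w' ((i, j), (i, j + 1)))
    = sgb (i \<le> fst w \<and> snd w = j) * sgb (i \<le> fst w' \<and> snd w' = j)"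
proof (cases w)
  case (Pair m n)
  from assms[unfolded Pair] show ?thesis
    unfolding Pair by (cases rule: adj_cases; auto simp: ray_sign_def dirof_def crosses_def; presburger)
qed

lemma crosses_commute: "crosses w w' (p, q) = crosses w w' (q, p)"
  by (auto simp: crosses_def)

lemma ray_parity_adj:
  assumes cl: "closed_path l" and pq: "adj p q"
  shows "ray_parity p l * ray_parity q l = (\<Prod>i<length l. sgb (crosses (cv l i) (cv l (Suc i)) (p, q)))"
proof -
  note ad = closed_pathD(2)[OF cl]
  have H: "ray_parity (i, j) l * ray_parity (i + 1, j) l =
      (\<Prod>k<length l. sgb (crosses (cv l k) (cv l (Suc k)) ((i, j), (i + 1, j))))" for i j
    unfolding ray_parity_def path_dir_def prod.distrib[symmetric] ray_sign_horizontal[OF ad] ..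
  have V: "ray_parity (i, j) l * ray_parity (i, j + 1) l =
      (\<Prod>k<length l. sgb (crosses (cv l k) (cv l (Suc k)) ((i, j), (i, j + 1))))" for i j
  proof -
    have "ray_parity (i, j) l * ray_parity (i, j + 1) l *
      (\<Prod>k<length l. sgb (crosses (cv l k) (cv l (Suc k)) ((i, j), (i, j + 1)))) = 1"
      unfolding ray_parity_def path_dir_def prod.distrib[symmetric] ray_sign_vertical[OF ad]
      by (rule closed_path_cut[OF cl])
    moreover have "x = y" if "x * y = 1" "x = 1 \<or> x = -1" for x y :: real using that by auto
    ultimately show ?thesis
      using ray_parity_cases[of "(i, j)" l] ray_parity_cases[of "(i, j + 1)" l] by auto
  qed
  obtain i j where p: "p = (i, j)" by (cases p)
  from pq[unfolded p] show ?thesis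
  proof (cases rule: adj_cases)
    case 1
    then show ?thesis using H[of "i - 1" j] p by (simp add: mult.commute crosses_commute)
  next
    case 2
    then show ?thesis using V[of i "j - 1"] p by (simp add: mult.commute crosses_commute)
  next
    case 3
    then show ?thesis using H[of i j] p by simp
  next
    case 4
    then show ?thesis using V[of i j] p by simp
  qed
qed

text \<open>\<open>crossings\<close> counts a step once even if it crosses several edges. Where it
  crosses at most one, the count has the parity given by the product of signs.\<close>

lemma prod_sgb_unique:
  fixes n :: nat
  assumes "\<And>k k'. k < n \<Longrightarrow> k' < n \<Longrightarrow> Q k \<Longrightarrow> Q k' \<Longrightarrow> k = k'"
  shows "(\<Prod>k<n. sgb (Q k)) = sgb (\<exists>k<n. Q k)"
proof (cases "\<exists>k<n. Q k")
  case True
  then obtain m where m: "m < n" "Q m" by blast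
  then have "{k \<in> {..<n}. Q k} = {m}" using assms by auto
  then show ?thesis using True by (simp add: prod_sgb)
qed auto

lemma same_midpoint:
  assumes "adj p q" "adj p' q'" "fst p + fst q = fst p' + fst q'" "snd p + snd q = snd p' + snd q'"
  shows "p = p' \<and> q = q' \<or> p = q' \<and> q = p'"
proof (cases p)
  case (Pair i j)
  show ?thesis
  proof (cases p')
    case p': (Pair i' j')
    show ?thesis unfolding Pair p'
      by (insert assms(3,4), (rule adj_cases[OF assms(1)[unfolded Pair]];
          rule adj_cases[OF assms(2)[unfolded p']]; auto simp: Pair p'; presburger))
  qed
qed

text \<open>Ray parities at neighbouring points differ by the crossings of the edge between them,
  and the product telescopes along the path. Self-avoidance ensures that no dual edge crosses two
  path edges.\<close>

lemma ray_parity_path: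
  assumes cl: "closed_path l" and inj: "inj_on g {..n}" and g: "\<And>k. k < n \<Longrightarrow> adj (g k) (g (Suc k))"
  shows "ray_parity (g 0) l * ray_parity (g n) l =
    (-1) ^ card {i. i < length l \<and> (\<exists>k<n. crosses (cv l i) (cv l (Suc i)) (g k, g (Suc k)))}"
proof -
  have tel: "ray_parity (g 0) l * ray_parity (g m) l = (\<Prod>k<m. ray_parity (g k) l * ray_parity (g (Suc k)) l)" for m
  proof (induction m)
    case (Suc m)
    have "ray_parity (g 0) l * ray_parity (g (Suc m)) l =
       (ray_parity (g 0) l * ray_parity (g m) l) * (ray_parity (g m) l * ray_parity (g (Suc m)) l)"
      using ray_parity_square[of "g m" l] by (simp add: mult_ac)
    then show ?case using Suc by simp
  qed (simp add: ray_parity_square)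
  have "ray_parity (g 0) l * ray_parity (g n) l = (\<Prod>k<n. \<Prod>i<length l. sgb (crosses (cv l i) (cv l (Suc i)) (g k, g (Suc k))))"
    unfolding tel using ray_parity_adj[OF cl g] by (intro prod.cong) auto
  also have "\<dots> = (\<Prod>i<length l. \<Prod>k<n. sgb (crosses (cv l i) (cv l (Suc i)) (g k, g (Suc k))))"
    by (rule prod.swap)
  also have "\<dots> = (\<Prod>i<length l. sgb (\<exists>k<n. crosses (cv l i) (cv l (Suc i)) (g k, g (Suc k))))"
  proof (intro prod.cong refl prod_sgb_unique)
    fix i k k' assume k: "k < n" "k' < n" and c: "crosses (cv l i) (cv l (Suc i)) (g k, g (Suc k))"
      "crosses (cv l i) (cv l (Suc i)) (g k', g (Suc k'))"
    have "g k = g k' \<and> g (Suc k) = g (Suc k') \<or> g k = g (Suc k') \<and> g (Suc k) = g k'"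
      by (rule same_midpoint) (use g k c in \<open>auto simp: crosses_def\<close>)
    moreover have eq: "g a = g b \<Longrightarrow> a = b" if "a \<le> n" "b \<le> n" for a b
      using inj that by (auto dest: inj_onD)
    \<comment> \<open>If one edge were traversed in both directions, each of \<open>k\<close> and
      \<open>k'\<close> would be the successor of the other.\<close>
    moreover have "k = Suc k'" if "g k = g (Suc k')" using eq[of k "Suc k'"] that k by simp
    moreover have "Suc k = k'" if "g (Suc k) = g k'" using eq[of "Suc k" k'] that k by simp
    moreover have "k = k'" if "g k = g k'" using eq[of k k'] that k by simp
    ultimately show "k = k'" by linarith
  qed
  finally show ?thesis by (simp add: prod_sgb)
qed

lemma odd_iff_power: "odd n \<longleftrightarrow> (-1 :: real) ^ n = -1"
  by (simp add: minus_one_power_iff)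

section \<open>Localisation of odd paths\<close>

lemma cv_lipschitz:
  assumes "closed_path l"
  shows "\<bar>fst (cv l i) - fst (cv l j)\<bar> \<le> int (length l)" "\<bar>snd (cv l i) - snd (cv l j)\<bar> \<le> int (length l)"
proof -
  have step: "\<bar>fst (cv l (i + k)) - fst (cv l i)\<bar> \<le> int k \<and> \<bar>snd (cv l (i + k)) - snd (cv l i)\<bar> \<le> int k" for i k
  proof (induction k)
    case (Suc k)
    then show ?case using closed_pathD(2)[OF assms, of "i + k"] by (auto simp: adj_def)
  qed simp
  let ?r = "length l"
  have r: "0 < ?r" using closed_pathD(1)[OF assms] by simp
  define a where "a = i mod ?r"
  define b where "b = j mod ?r"
  have ab: "a < ?r" "b < ?r" using r by (simp_all add: a_def b_def)
  have c: "cv l i = cv l a" "cv l j = cv l b" by (simp_all add: a_def b_def cv_mod)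
  have "\<bar>fst (cv l a) - fst (cv l b)\<bar> \<le> int ?r \<and> \<bar>snd (cv l a) - snd (cv l b)\<bar> \<le> int ?r"
  proof (cases "a \<le> b")
    case True
    then show ?thesis using step[of a "b - a"] ab by auto
  next
    case False
    then show ?thesis using step[of b "a - b"] ab by auto
  qed
  then show "\<bar>fst (cv l i) - fst (cv l j)\<bar> \<le> int ?r" "\<bar>snd (cv l i) - snd (cv l j)\<bar> \<le> int ?r"
    unfolding c by auto
qed

text \<open>An odd path surrounds \<open>p\<close>: it has vertices to the left and to the right of
  \<open>p\<close> and in the rows just above and below, while no two of its vertices differ in a
  coordinate by more than its length.\<close>

lemma ray_parity_local:
  assumes cl: "closed_path l" and par: "ray_parity p l = -1"
  shows "\<bar>fst (cv l i) - fst p\<bar> \<le> int (length l)" "\<bar>snd (cv l i) - snd p\<bar> \<le> int (length l)"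
proof -
  note ad = closed_pathD(2)[OF cl]
  have r: "0 < length l" using closed_pathD(1)[OF cl] by simp
  have step: "snd (cv l (Suc k)) = snd (cv l k) - (if path_dir l k = 1 then 1 else 0) + (if path_dir l k = 3 then 1 else 0)" for k
    using ad[of k] unfolding path_dir_def
    by (cases "cv l k", simp, elim adj_cases) (auto simp: dirof_def)
  have neut: "\<exists>k. ray_sign p (cv l k, path_dir l k) \<noteq> 1"
  proof (rule ccontr)
    assume "\<nexists>k. ray_sign p (cv l k, path_dir l k) \<noteq> 1"
    then have "ray_parity p l = 1" unfolding ray_parity_def by (intro prod.neutral) auto
    then show False using par by simp
  qed
  then obtain k where k: "fst p \<le> fst (cv l k)"
     "path_dir l k = 1 \<and> snd (cv l k) = snd p \<or> path_dir l k = 3 \<and> snd (cv l k) = snd p - 1"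
    unfolding ray_sign_def by (auto split: if_splits)
  obtain k1 k2 where k12: "snd (cv l k1) = snd p" "snd (cv l k2) = snd p - 1"
  proof (cases "path_dir l k = 1")
    case True
    then show ?thesis using that[of k "Suc k"] k step[of k] by auto
  next
    case False
    then show ?thesis using that[of "Suc k" k] k step[of k] by auto
  qed
  \<comment> \<open>Otherwise crossing the ray would mean crossing the whole horizontal line through
    \<open>p\<close>, which a closed path does an even number of times.\<close>
  have "\<exists>k0. fst (cv l k0) < fst p"
  proof (rule ccontr)
    assume no: "\<nexists>k0. fst (cv l k0) < fst p"
    have "ray_sign p (cv l k, path_dir l k) = sgb (snd p \<le> snd (cv l k)) * sgb (snd p \<le> snd (cv l (Suc k)))" for k
    proof -
      have "fst p \<le> fst (cv l k)" using no by (meson not_le)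
      then show ?thesis unfolding ray_sign_def step[of k] by auto
    qed
    then have "ray_parity p l = 1"
      unfolding ray_parity_def using closed_path_cut[OF cl, of "\<lambda>w. snd p \<le> snd w"] by simp
    then show False using par by simp
  qed
  then obtain k0 where k0: "fst (cv l k0) < fst p" by blast
  show "\<bar>fst (cv l i) - fst p\<bar> \<le> int (length l)"
    using cv_lipschitz(1)[OF cl, of i k] cv_lipschitz(1)[OF cl, of i k0] k(1) k0
    unfolding abs_le_iff by linarith
  show "\<bar>snd (cv l i) - snd p\<bar> \<le> int (length l)"
    using cv_lipschitz(2)[OF cl, of i k1] cv_lipschitz(2)[OF cl, of i k2] k12
    unfolding abs_le_iff by linarith
qed

text \<open>\<open>uv_odd\<close> is existential in the path, so some path must exist. Each step
  lowers the distance \<open>d\<close> to \<open>v\<close>; carrying the bound by \<open>d u\<close>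
  through the induction makes the new first vertex distinct from the rest.\<close>

lemma ex_sa_path: "\<exists>g. sa_path u v g"
proof -
  define d where "d p = nat \<bar>fst p - fst v\<bar> + nat \<bar>snd p - snd v\<bar>" for p :: pt
  have "\<exists>g. sa_path u v g \<and> (\<forall>w\<in>set g. d w \<le> d u)" for u
  proof (induction "d u" arbitrary: u rule: less_induct)
    case less
    show ?case
    proof (cases "u = v")
      case True
      then show ?thesis by (intro exI[of _ "[v]"]) (simp add: sa_path_def)
    next
      case False
      define w where "w = (if fst u < fst v then (fst u + 1, snd u) else if fst v < fst u then (fst u - 1, snd u)
        else if snd u < snd v then (fst u, snd u + 1) else (fst u, snd u - 1))"
      have w: "adj u w" "d w < d u"
        using False by (auto simp: w_def adj_def d_def prod_eq_iff)
      from less[OF w(2)] obtain g where g: "sa_path w v g" "\<forall>x\<in>set g. d x \<le> d w" by blast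
      have "sa_path u v (u # g)"
        unfolding sa_path_def
      proof (intro conjI allI impI)
        show "distinct (u # g)" using g w by (auto simp: sa_path_def)
        show "last (u # g) = v" using g by (auto simp: sa_path_def)
        fix k assume k: "k + 1 < length (u # g)"
        show "adj ((u # g) ! k) ((u # g) ! (k + 1))"
        proof (cases k)
          case 0
          have "g ! 0 = w" using g(1) hd_conv_nth[of g] by (simp add: sa_path_def)
          then show ?thesis using w(1) 0 by simp
        next
          case (Suc m)
          then show ?thesis using g k by (simp add: sa_path_def)
        qed
      qed auto
      moreover have "\<forall>x\<in>set (u # g). d x \<le> d u" using g w by fastforce
      ultimately show ?thesis by blast
    qed
  qed
  then show ?thesis by blast
qed

lemma sa_path_parity:
  assumes cl: "closed_path l" and g: "sa_path u v g"
  shows "odd (crossings l (path_edges g)) \<longleftrightarrow> ray_parity u l * ray_parity v l = -1"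
proof -
  from g have "length g \<noteq> 0" "distinct g" by (simp_all add: sa_path_def)
  then obtain n where n: "length g = Suc n" using not0_implies_Suc by blast
  have "inj_on ((!) g) {..n}"
    using \<open>distinct g\<close> n by (simp add: inj_on_def nth_eq_iff_index_eq)
  then have "ray_parity (g ! 0) l * ray_parity (g ! n) l =
    (-1) ^ card {i. i < length l \<and> (\<exists>k<n. crosses (cv l i) (cv l (Suc i)) (g ! k, g ! Suc k))}"
    by (rule ray_parity_path[OF cl]) (use g n in \<open>auto simp: sa_path_def\<close>)
  moreover have "g ! 0 = u" "g ! n = v"
    using g n hd_conv_nth[of g] last_conv_nth[of g] by (auto simp: sa_path_def)
  moreover have "crossings l (path_edges g) =
      card {i. i < length l \<and> (\<exists>k<n. crosses (cv l i) (cv l (Suc i)) (g ! k, g ! Suc k))}"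
  proof -
    have *: "path_edges g = (\<lambda>k. (g ! k, g ! Suc k)) ` {..<n}"
      unfolding path_edges_def n by (simp add: image_def lessThan_def) (simp add: conj_commute)
    have "(\<exists>e\<in>path_edges g. Q e) \<longleftrightarrow> (\<exists>k<n. Q (g ! k, g ! Suc k))" for Q
      unfolding * by auto
    then show ?thesis unfolding crossings_def Suc_eq_plus1 by simp
  qed
  ultimately show ?thesis by (simp only: odd_iff_power)
qed

lemma uv_odd_iff: "closed_path l \<Longrightarrow> uv_odd u v l \<longleftrightarrow> ray_parity u l * ray_parity v l = -1"
  unfolding uv_odd_def using sa_path_parity ex_sa_path by blast

text \<open>An injective path stays out of a finite box from some \<open>n\<close> on. There its
  vertices have ray parity \<open>1\<close> by \<open>ray_parity_local\<close> and its edges cross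
  no step of \<open>l\<close>, so a finite initial part decides.\<close>

lemma inf_sa_path_parity:
  assumes cl: "closed_path l" and g: "inf_sa_path u g"
  shows "odd (crossings l (inf_path_edges g)) \<longleftrightarrow> ray_parity u l = -1"
proof -
  let ?r = "int (length l)"
  \<comment> \<open>The margin \<open>2\<close> covers the starting point of any path edge that
    crosses a step of \<open>l\<close>.\<close>
  define B where "B = {fst (cv l 0) - ?r - 2..fst (cv l 0) + ?r + 2} \<times> {snd (cv l 0) - ?r - 2..snd (cv l 0) + ?r + 2}"
  have inj: "inj g" and g0: "g 0 = u" and ad: "\<And>k. adj (g k) (g (Suc k))"
    using g by (auto simp: inf_sa_path_def)
  have "finite (g -` B)" using inj by (intro finite_vimageI) (auto simp: B_def)
  then obtain n where n: "\<And>k. g k \<in> B \<Longrightarrow> k < n"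
    using finite_nat_set_iff_bounded by (metis vimageI)
  have outB: "g k \<notin> B" if "n \<le> k" for k using n[of k] that by auto
  have "ray_parity (g n) l = 1"
  proof (rule ccontr)
    assume "ray_parity (g n) l \<noteq> 1"
    then have "ray_parity (g n) l = -1" using ray_parity_cases by blast
    from ray_parity_local[OF cl this, of 0] have "g n \<in> B"
      unfolding B_def by (cases "g n") auto
    then show False using outB by blast
  qed
  moreover have "ray_parity (g 0) l * ray_parity (g n) l =
    (-1) ^ card {i. i < length l \<and> (\<exists>k<n. crosses (cv l i) (cv l (Suc i)) (g k, g (Suc k)))}"
    by (rule ray_parity_path[OF cl]) (use inj ad in \<open>auto intro: inj_on_subset\<close>)
  moreover have "crossings l (inf_path_edges g) =
      card {i. i < length l \<and> (\<exists>k<n. crosses (cv l i) (cv l (Suc i)) (g k, g (Suc k)))}"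
  proof -
    have "k < n" if c: "crosses (cv l i) (cv l (Suc i)) (g k, g (Suc k))" for i k
    proof -
      have "\<bar>fst (g k) - fst (g (Suc k))\<bar> \<le> 1" "\<bar>snd (g k) - snd (g (Suc k))\<bar> \<le> 1"
        using ad[of k] by (auto simp: adj_def)
      moreover have "fst (cv l i) + fst (cv l (Suc i)) + 1 = fst (g k) + fst (g (Suc k))"
        "snd (cv l i) + snd (cv l (Suc i)) + 1 = snd (g k) + snd (g (Suc k))"
        using c by (simp_all add: crosses_def)
      ultimately have "\<bar>fst (g k) - fst (cv l 0)\<bar> \<le> ?r + 2 \<and> \<bar>snd (g k) - snd (cv l 0)\<bar> \<le> ?r + 2"
        using cv_lipschitz[OF cl, of i 0] cv_lipschitz[OF cl, of "Suc i" 0]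
        unfolding abs_le_iff by (intro conjI; linarith)
      then have "g k \<in> B" unfolding B_def by (cases "g k") auto
      then show ?thesis by (rule n)
    qed
    then have "{i. i < length l \<and> (\<exists>e\<in>inf_path_edges g. crosses (cv l i) (cv l (i + 1)) e)} =
      {i. i < length l \<and> (\<exists>k<n. crosses (cv l i) (cv l (Suc i)) (g k, g (Suc k)))}"
    proof -
      have "inf_path_edges g = range (\<lambda>k. (g k, g (Suc k)))" by (auto simp: inf_path_edges_def)
      then have "(\<exists>e\<in>inf_path_edges g. crosses w w' e) \<longleftrightarrow> (\<exists>k. crosses w w' (g k, g (Suc k)))" for w w'
        by simp
      then show ?thesis using \<open>\<And>k i. crosses (cv l i) (cv l (Suc i)) (g k, g (Suc k)) \<Longrightarrow> k < n\<close>
        unfolding Suc_eq_plus1[symmetric] by blast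
    qed
    then show ?thesis unfolding crossings_def by (rule arg_cong)
  qed
  ultimately show ?thesis using g0 by (simp only: odd_iff_power mult_1_right)
qed

lemma u_odd_iff: "closed_path l \<Longrightarrow> u_odd u l \<longleftrightarrow> ray_parity u l = -1"
proof -
  assume cl: "closed_path l"
  have "inf_sa_path u (\<lambda>k. (fst u + int k, snd u))"
    by (auto simp: inf_sa_path_def inj_def adj_def)
  then show ?thesis unfolding u_odd_def using inf_sa_path_parity[OF cl] by blast
qed

section \<open>Infinite-volume limit\<close>

lemma ray_parity_rotate:
  assumes cl: "closed_path l" shows "ray_parity p (rotate k l) = ray_parity p l"
proof -
  have ne: "l \<noteq> []" by (rule closed_pathD(1)[OF cl])
  have "(\<Prod>i<length l. ray_sign p (cv l (i + k), path_dir l (i + k))) = (\<Prod>i<length l. ray_sign p (cv l i, path_dir l i))"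
    by (rule prod_shift[where f = "\<lambda>i. ray_sign p (cv l i, path_dir l i)"])
      (simp add: cv_add_length path_dir_add_length)
  moreover have "path_dir (rotate k l) i = path_dir l (i + k)" for i
    by (simp add: path_dir_def cv_rotate[OF ne])
  ultimately show ?thesis by (simp add: ray_parity_def cv_rotate[OF ne])
qed

lemma ray_parity_rev:
  assumes cl: "closed_path l" shows "ray_parity p (rev l) = ray_parity p l"
proof -
  let ?r = "length l" and ?f = "\<lambda>i. ray_sign p (cv l i, path_dir l i)"
  have r: "2 \<le> ?r" by (rule closed_path_length[OF cl])
  have "ray_parity p (rev l) = (\<Prod>i<?r. ?f (?r - Suc i + (?r - 1)))"
    unfolding ray_parity_def length_rev
  proof (rule prod.cong[OF refl])
    fix i assume "i \<in> {..<?r}"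
    then have i: "i < ?r" by simp
    let ?k = "?r - Suc i + (?r - 1)"
    have k: "2 * ?r - Suc i = Suc ?k" "2 * ?r - Suc (Suc i) = ?k" using i r by simp_all
    have "cv (rev l) i = cv l (Suc ?k)" "path_dir (rev l) i = opp (path_dir l ?k)"
      using cv_rev[of i 2 l] path_dir_rev[OF cl, of i] i r unfolding k by simp_all
    moreover have "pair (cv l ?k, path_dir l ?k) = (cv l (Suc ?k), opp (path_dir l ?k))"
      using nbr_dirof[OF closed_pathD(2)[OF cl, of ?k]] by (simp add: pair_def path_dir_def)
    ultimately show "ray_sign p (cv (rev l) i, path_dir (rev l) i) = ?f ?k"
      using ray_sign_pair[of "(cv l ?k, path_dir l ?k)" p] by (simp add: path_dir_def dirof_less)
  qed
  also have "\<dots> = (\<Prod>i<?r. ?f (i + (?r - 1)))"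
    by (rule prod.nat_diff_reindex)
  also have "\<dots> = (\<Prod>i<?r. ?f i)"
    by (rule prod_shift[of ?f]) (simp add: cv_add_length path_dir_add_length)
  finally show ?thesis by (simp add: ray_parity_def)
qed

text \<open>Treats both correlations at once: \<open>A\<close> is \<open>{u}\<close> for the
  magnetization and \<open>{u, v}\<close> for the two-point function.\<close>

definition set_parity :: "pt set \<Rightarrow> pt list \<Rightarrow> real" where
  "set_parity A l = (\<Prod>p\<in>A. ray_parity p l)"

lemma set_parity_cases: "set_parity A l = 1 \<or> set_parity A l = -1"
  unfolding set_parity_def
proof (induction A rule: infinite_finite_induct)
  case (insert x F)
  then show ?case using ray_parity_cases[of x l] by auto
qed simp_all

lemma orbit_set_parity: "closed_path l \<Longrightarrow> m \<in> orbit l \<Longrightarrow> set_parity A m = set_parity A l"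
  using closed_path_rev by (auto simp: orbit_def rots_def set_parity_def ray_parity_rotate ray_parity_rev)

definition odd_paths :: "pt set \<Rightarrow> pt set \<Rightarrow> nat \<Rightarrow> pt list set" where
  "odd_paths A R r = {l \<in> closed_paths R r. set_parity A l = -1}"

lemma finite_closed_paths: "finite R \<Longrightarrow> finite (closed_paths R r)"
  by (rule finite_subset[OF _ finite_lists_length_eq[of R r]]) (auto simp: closed_paths_def)

text \<open>\<open>x_small\<close> says that \<open>x < sqrt 2 - 1\<close>, which for
  \<open>x = exp (-2 * \<beta>)\<close> is the condition \<open>beta_c < \<beta>\<close>.\<close>

locale low_temperature =
  fixes x :: real
  assumes x_pos: "0 < x" and x_small: "x * (1 + sqrt 2) < 1"
begin

definition weights :: "pt set \<Rightarrow> half \<Rightarrow> real" where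
  "weights A h = x * (\<Prod>p\<in>A. ray_sign p h)"

definition tr :: "pt set \<Rightarrow> pt set \<Rightarrow> nat \<Rightarrow> real" where
  "tr R A r = mtrace (Hs R) (kw R (weights A)) r"

lemma abs_weights: "\<bar>weights A h\<bar> = x"
proof -
  have "\<bar>\<Prod>p\<in>A. ray_sign p h\<bar> = 1" by (simp add: abs_prod abs_ray_sign)
  then show ?thesis using x_pos by (simp add: weights_def abs_mult)
qed

lemma tr_bound:
  assumes "finite R" shows "\<bar>tr R A r\<bar> \<le> 4 * real (card R) * (x * (1 + sqrt 2)) ^ r"
proof -
  have "\<bar>tr R A r\<bar> \<le> real (card (Hs R)) * (x * (1 + sqrt 2)) ^ r"
    unfolding tr_def
  proof (rule mtrace_bound)
    show "finite (Hs R)" using assms by (simp add: Hs_def)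
    show "0 \<le> x * (1 + sqrt 2)" using x_pos by simp
    show "(\<Sum>h\<in>Hs R. (\<Sum>g\<in>Hs R. kw R (weights A) h g * f g)\<^sup>2) \<le> (x * (1 + sqrt 2))\<^sup>2 * (\<Sum>g\<in>Hs R. (f g)\<^sup>2)" for f
      by (rule kw_norm[OF assms]) (simp add: abs_weights)
  qed
  moreover have "card (Hs R) = 4 * card R" by (simp add: Hs_def card_cartesian_product)
  ultimately show ?thesis by simp
qed

lemma tr_closed_paths:
  assumes R: "finite R" and r: "0 < r"
  shows "complex_of_real (tr R A r) =
    - (\<Sum>l\<in>closed_paths R r. complex_of_real (x ^ r * set_parity A l) * loop_sgn l)"
proof -
  have "tr R A r = (\<Sum>l\<in>closed_paths R r. \<Prod>i<r.
     turn_weight (path_dir l i) (path_dir l (Suc i)) * weights A (cv l (Suc i), path_dir l (Suc i)))"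
    unfolding tr_def by (rule mtrace_kw_closed_paths[OF R r])
  also have "\<dots> = (\<Sum>l\<in>closed_paths R r. (x ^ r * set_parity A l) * (\<Prod>i<r. turn_weight (path_dir l i) (path_dir l (Suc i))))"
  proof (rule sum.cong[OF refl])
    fix l assume "l \<in> closed_paths R r"
    then have len: "length l = r" by (simp add: closed_paths_def)
    have "(\<Prod>i<r. weights A (cv l (Suc i), path_dir l (Suc i))) = (\<Prod>i<r. weights A (cv l i, path_dir l i))"
      using prod_shift[of "\<lambda>i. weights A (cv l i, path_dir l i)" r 1]
        cv_add_length[of l] path_dir_add_length[of l] unfolding len by simp
    also have "\<dots> = x ^ r * set_parity A l"
      unfolding weights_def set_parity_def ray_parity_def prod.distrib len by (subst prod.swap) simp
    finally show "(\<Prod>i<r. turn_weight (path_dir l i) (path_dir l (Suc i)) * weights A (cv l (Suc i), path_dir l (Suc i)))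
      = (x ^ r * set_parity A l) * (\<Prod>i<r. turn_weight (path_dir l i) (path_dir l (Suc i)))"
      by (simp add: prod.distrib)
  qed
  finally have "complex_of_real (tr R A r) = (\<Sum>l\<in>closed_paths R r. complex_of_real (x ^ r * set_parity A l) *
      complex_of_real (\<Prod>i<r. turn_weight (path_dir l i) (path_dir l (Suc i))))" by simp
  also have "\<dots> = (\<Sum>l\<in>closed_paths R r. complex_of_real (x ^ r * set_parity A l) * (- loop_sgn l))"
    by (rule sum.cong[OF refl]) (use loop_sgn_turn_weight in \<open>auto simp: closed_paths_def\<close>)
  finally show ?thesis by (simp add: sum_negf)
qed

text \<open>Normalised so as to equal the sum of \<open>loop_w\<close> over odd loops:
  \<open>2\<close> is the difference of the two parities, another \<open>2\<close> counts
  orientations, and \<open>r\<close> is the denominator of \<open>period l / r\<close>, the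
  reciprocal of \<open>loop_mult\<close>.\<close>

definition coeff :: "pt set \<Rightarrow> pt set \<Rightarrow> nat \<Rightarrow> real" where
  "coeff R A r = (tr R A r - tr R {} r) / (4 * real r)"

lemma coeff_odd_paths:
  assumes R: "finite R" and r: "0 < r"
  shows "complex_of_real (coeff R A r) = complex_of_real (x ^ r / (2 * real r)) * (\<Sum>l\<in>odd_paths A R r. loop_sgn l)"
proof -
  have fin: "finite (closed_paths R r)" by (rule finite_closed_paths[OF R])
  have "complex_of_real (tr R A r - tr R {} r) =
     (\<Sum>l\<in>closed_paths R r. complex_of_real (x ^ r * (1 - set_parity A l)) * loop_sgn l)"
    unfolding of_real_diff tr_closed_paths[OF R r]
    by (simp add: set_parity_def[of "{}"] sum_subtractf[symmetric] algebra_simps)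
  also have "\<dots> = (\<Sum>l\<in>closed_paths R r. if set_parity A l = -1 then complex_of_real (2 * x ^ r) * loop_sgn l else 0)"
  proof (rule sum.cong[OF refl])
    fix l
    show "complex_of_real (x ^ r * (1 - set_parity A l)) * loop_sgn l =
      (if set_parity A l = -1 then complex_of_real (2 * x ^ r) * loop_sgn l else 0)"
      using set_parity_cases[of A l] by auto
  qed
  also have "\<dots> = (\<Sum>l\<in>odd_paths A R r. complex_of_real (2 * x ^ r) * loop_sgn l)"
    unfolding odd_paths_def by (rule sum.inter_filter[OF fin, symmetric])
  also have "\<dots> = complex_of_real (2 * x ^ r) * (\<Sum>l\<in>odd_paths A R r. loop_sgn l)"
    by (rule sum_distrib_left[symmetric])
  finally show ?thesis using r by (simp add: coeff_def field_simps)
qed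

lemma coeff_loops:
  assumes R: "finite R" and r: "0 < r"
  shows "complex_of_real (coeff R A r) = (\<Sum>l\<in>{l \<in> odd_paths A R r. is_loop l}. loop_w l (\<lambda>e. x))"
proof -
  let ?P = "odd_paths A R r"
  have P: "closed_path l" "length l = r" "set l \<subseteq> R" if "l \<in> ?P" for l
    using that by (auto simp: odd_paths_def closed_paths_def)
  have "(\<Sum>l\<in>?P. loop_sgn l) = (\<Sum>l\<in>{l\<in>?P. is_loop l}. 2 * of_nat (period l) * loop_sgn l)"
  proof (rule sum_closed_paths_loops)
    show "finite ?P" using finite_closed_paths[OF R] by (simp add: odd_paths_def)
    show "orbit l \<subseteq> ?P" if l: "l \<in> ?P" for l
    proof
      fix m assume m: "m \<in> orbit l"
      have "set m = set l" using m by (auto simp: orbit_def rots_def)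
      then show "m \<in> ?P"
        using orbit_closed_path[OF P(1)[OF l] m] orbit_set_parity[OF P(1)[OF l] m] l
        by (simp add: odd_paths_def closed_paths_def)
    qed
    show "closed_path l" if "l \<in> ?P" for l using P that by blast
    show "loop_sgn m = loop_sgn l" if "l \<in> ?P" "m \<in> orbit l" for l m
      by (rule orbit_closed_path(2)[OF P(1)[OF that(1)] that(2)])
  qed
  then have "complex_of_real (coeff R A r) =
     (\<Sum>l\<in>{l\<in>?P. is_loop l}. complex_of_real (x ^ r / (2 * real r)) * (2 * of_nat (period l) * loop_sgn l))"
    by (simp only: coeff_odd_paths[OF R r] sum_distrib_left)
  also have "\<dots> = (\<Sum>l\<in>{l \<in> ?P. is_loop l}. loop_w l (\<lambda>e. x))"
  proof (rule sum.cong[OF refl])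
    fix l assume "l \<in> {l \<in> ?P. is_loop l}"
    then have "length l = r" "l \<noteq> []" using P closed_pathD(1) by auto
    moreover from this have "0 < period l" using period_props(1) by blast
    ultimately show "complex_of_real (x ^ r / (2 * real r)) * (2 * of_nat (period l) * loop_sgn l) = loop_w l (\<lambda>e. x)"
      using r by (simp add: loop_w_def loop_mult_def period_def[symmetric] field_simps)
  qed
  finally show ?thesis .
qed

section \<open>Bounds uniform in the rectangle\<close>

definition lattice_box :: "int \<Rightarrow> nat \<Rightarrow> pt set" where
  "lattice_box D r = rect_V (- D - int r) (D + int r) (- D - int r) (D + int r)"

lemma finite_lattice_box [simp]: "finite (lattice_box D r)"
  by (simp add: lattice_box_def)

lemma odd_paths_box:
  assumes D: "\<And>p. p \<in> A \<Longrightarrow> \<bar>fst p\<bar> \<le> D \<and> \<bar>snd p\<bar> \<le> D"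
    and cl: "closed_path l" and odd: "set_parity A l = -1"
  shows "set l \<subseteq> lattice_box D (length l)"
proof
  have "\<exists>p\<in>A. ray_parity p l \<noteq> 1"
  proof (rule ccontr)
    assume "\<not> (\<exists>p\<in>A. ray_parity p l \<noteq> 1)"
    then have "set_parity A l = 1" unfolding set_parity_def by (intro prod.neutral) auto
    then show False using odd by simp
  qed
  then obtain p where p: "p \<in> A" "ray_parity p l = -1" using ray_parity_cases by blast
  fix w assume "w \<in> set l"
  then obtain i where i: "w = cv l i" by (metis cv_nth in_set_conv_nth)
  show "w \<in> lattice_box D (length l)"
    using ray_parity_local[OF cl p(2), of i] D[OF p(1)] unfolding i[symmetric]
    by (cases w) (auto simp: lattice_box_def rect_V_iff abs_le_iff)
qed

lemma odd_paths_inter_box: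
  assumes D: "\<And>p. p \<in> A \<Longrightarrow> \<bar>fst p\<bar> \<le> D \<and> \<bar>snd p\<bar> \<le> D"
  shows "odd_paths A R r = odd_paths A (R \<inter> lattice_box D r) r"
  using odd_paths_box[OF D] by (auto simp: odd_paths_def closed_paths_def)

text \<open>Paths that are odd for \<open>A\<close> stay near \<open>A\<close>, so only the part of
  \<open>R\<close> in the box matters, although each of the two traces involves closed paths in all
  of \<open>R\<close>.\<close>

lemma coeff_box:
  assumes D: "\<And>p. p \<in> A \<Longrightarrow> \<bar>fst p\<bar> \<le> D \<and> \<bar>snd p\<bar> \<le> D" and R: "finite R" and r: "0 < r"
  shows "coeff R A r = coeff (R \<inter> lattice_box D r) A r"
proof -
  have fin: "finite (R \<inter> lattice_box D r)" by simp
  have eq: "odd_paths A R r = odd_paths A (R \<inter> lattice_box D r) r"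
    by (rule odd_paths_inter_box) (rule D)
  have "complex_of_real (coeff R A r) = complex_of_real (coeff (R \<inter> lattice_box D r) A r)"
    by (simp only: coeff_odd_paths[OF R r, of A] coeff_odd_paths[OF fin r] eq)
  then show ?thesis by (simp only: of_real_eq_iff)
qed

text \<open>Two traces, each at most \<open>4\<close> times the area of the box times the geometric
  rate, divided by \<open>4\<close>.\<close>

definition cbound :: "int \<Rightarrow> nat \<Rightarrow> real" where
  "cbound D r = 2 * (2 * real_of_int D + 2 * real r + 1)\<^sup>2 * (x * (1 + sqrt 2)) ^ r"

text \<open>Counting odd paths would lose the cancellation among their signs and with it the
  critical rate. Instead \<open>coeff_box\<close> passes to the box, where both traces are bounded
  by the matrix norm; the area of the box is only quadratic in \<open>r\<close>.\<close>

lemma coeff_bound: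
  assumes D: "\<And>p. p \<in> A \<Longrightarrow> \<bar>fst p\<bar> \<le> D \<and> \<bar>snd p\<bar> \<le> D" and "0 \<le> D" and R: "finite R" and r: "0 < r"
  shows "\<bar>coeff R A r\<bar> \<le> cbound D r"
proof -
  let ?\<rho> = "x * (1 + sqrt 2)" and ?B = "R \<inter> lattice_box D r"
  have "card (lattice_box D r) = nat (2 * D + 2 * int r + 1) * nat (2 * D + 2 * int r + 1)"
    unfolding lattice_box_def rect_V_times card_cartesian_product using \<open>0 \<le> D\<close> by (simp add: algebra_simps)
  then have "real (card (lattice_box D r)) = (2 * real_of_int D + 2 * real r + 1)\<^sup>2"
    using \<open>0 \<le> D\<close> by (simp add: power2_eq_square)
  moreover have "card ?B \<le> card (lattice_box D r)" by (intro card_mono) auto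
  ultimately have card: "real (card ?B) \<le> (2 * real_of_int D + 2 * real r + 1)\<^sup>2" by linarith
  have \<rho>: "0 \<le> ?\<rho> ^ r" using x_pos by simp
  have t: "\<bar>tr ?B C r\<bar> \<le> 4 * (2 * real_of_int D + 2 * real r + 1)\<^sup>2 * ?\<rho> ^ r" for C
  proof -
    have "\<bar>tr ?B C r\<bar> \<le> 4 * real (card ?B) * ?\<rho> ^ r" by (rule tr_bound) simp
    also have "\<dots> \<le> 4 * (2 * real_of_int D + 2 * real r + 1)\<^sup>2 * ?\<rho> ^ r"
      using card \<rho> by (intro mult_right_mono) auto
    finally show ?thesis .
  qed
  have "coeff R A r = coeff ?B A r" by (rule coeff_box[OF D R r])
  then have "\<bar>coeff R A r\<bar> = \<bar>tr ?B A r - tr ?B {} r\<bar> / (4 * real r)"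
    by (simp add: coeff_def[of ?B A r])
  also have "\<dots> \<le> \<bar>tr ?B A r - tr ?B {} r\<bar> / 4"
    using r by (intro divide_left_mono) auto
  also have "\<dots> \<le> (\<bar>tr ?B A r\<bar> + \<bar>tr ?B {} r\<bar>) / 4"
    by (intro divide_right_mono abs_triangle_ineq4) simp
  also have "\<dots> \<le> cbound D r" using t[of A] t[of "{}"] unfolding cbound_def by simp
  finally show ?thesis .
qed

text \<open>A quadratic polynomial times a geometric sequence. The comparison series is the second
  derivative of the geometric series, with coefficients \<open>(n + 1) * (n + 2)\<close>.\<close>

lemma summable_cbound:
  assumes "0 \<le> D" shows "summable (\<lambda>r. cbound D (Suc r))"
proof (rule summable_comparison_test')
  let ?\<rho> = "x * (1 + sqrt 2)" and ?D = "2 * real_of_int D + 3"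
  have \<rho>: "0 < ?\<rho>" "?\<rho> < 1" using x_pos x_small by (simp_all add: add_pos_pos)
  have 1: "summable (\<lambda>n. 1 * t ^ n)" if "norm t < 1" for t :: real
    using that by (simp add: summable_geometric)
  have 2: "summable (\<lambda>n. diffs (\<lambda>n. 1) n * t ^ n)" if "norm t < 1" for t :: real
    using that 1 by (rule termdiff_converges)
  have "summable (\<lambda>n. diffs (diffs (\<lambda>n. 1)) n * ?\<rho> ^ n)"
    by (rule termdiff_converges[of _ 1]) (use 2 \<rho> in auto)
  then show "summable (\<lambda>n. 2 * ?D\<^sup>2 * (diffs (diffs (\<lambda>n. 1)) n * ?\<rho> ^ n))"
    by (rule summable_mult)
  fix n :: nat
  have "0 \<le> ?D" using assms by simp
  have "2 * real_of_int D + 2 * real (Suc n) + 1 \<le> ?D * real (Suc n)"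
    using assms by (simp add: algebra_simps)
  then have "(2 * real_of_int D + 2 * real (Suc n) + 1)\<^sup>2 \<le> (?D * real (Suc n))\<^sup>2"
    using assms by (intro power_mono) auto
  also have "\<dots> \<le> ?D\<^sup>2 * (real (Suc n) * real (Suc (Suc n)))"
    unfolding power_mult_distrib by (intro mult_left_mono) (simp_all add: power2_eq_square)
  finally have q: "(2 * real_of_int D + 2 * real (Suc n) + 1)\<^sup>2 \<le> ?D\<^sup>2 * (real (Suc n) * real (Suc (Suc n)))" .
  have "0 \<le> ?\<rho> ^ Suc n" using \<rho> by (intro zero_le_power) simp
  then have "norm (cbound D (Suc n)) = 2 * ((2 * real_of_int D + 2 * real (Suc n) + 1)\<^sup>2 * ?\<rho> ^ Suc n)"
    unfolding cbound_def real_norm_def abs_mult by (simp only: abs_of_nonneg) simp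
  also have "\<dots> \<le> 2 * ((?D\<^sup>2 * (real (Suc n) * real (Suc (Suc n)))) * ?\<rho> ^ n)"
  proof (intro mult_left_mono mult_mono q)
    show "?\<rho> ^ Suc n \<le> ?\<rho> ^ n" using \<rho> by (intro power_decreasing) auto
  qed (use \<rho> in auto)
  finally show "norm (cbound D (Suc n)) \<le> 2 * ?D\<^sup>2 * (diffs (diffs (\<lambda>n. 1)) n * ?\<rho> ^ n)"
    by (simp add: diffs_def mult_ac)
qed

text \<open>Both sums are exponentials of trace series. Their termwise difference is
  \<open>4 * coeff\<close>, which turns the factor \<open>-1/2\<close> into
  \<open>-2\<close>.\<close>

lemma even_sum_ratio:
  fixes a b c d :: int
  defines "R \<equiv> rect_V a b c d"
  shows "even_sum R (weights A) / even_sum R (weights {}) = exp (-2 * (\<Sum>r. coeff R A (Suc r)))"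
proof -
  have Z: "summable (\<lambda>r. tr R B (Suc r) / real (Suc r))"
     "even_sum R (weights B) = exp (- (1/2) * (\<Sum>r. tr R B (Suc r) / real (Suc r)))" for B
  proof -
    have w: "\<bar>weights B k\<bar> \<le> x" for k by (simp add: abs_weights)
    have sym: "weights B (pair k) = weights B k" if "snd k < 4" for k
      using that by (simp add: weights_def ray_sign_pair)
    show "summable (\<lambda>r. tr R B (Suc r) / real (Suc r))"
      "even_sum R (weights B) = exp (- (1/2) * (\<Sum>r. tr R B (Suc r) / real (Suc r)))"
      unfolding R_def tr_def using even_sum_trace[where x = "weights B" and a = a and b = b and c = c and d = d, OF w x_small sym]
      by blast+
  qed
  have "(\<Sum>r. tr R A (Suc r) / real (Suc r)) - (\<Sum>r. tr R {} (Suc r) / real (Suc r))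
     = (\<Sum>r. tr R A (Suc r) / real (Suc r) - tr R {} (Suc r) / real (Suc r))"
    by (rule suminf_diff[OF Z(1) Z(1)])
  also have "\<dots> = (\<Sum>r. 4 * coeff R A (Suc r))"
  proof (rule arg_cong[where f = suminf], rule ext)
    have four: "X / y = 4 * (X / (4 * y))" for X y :: real by simp
    fix r
    show "tr R A (Suc r) / real (Suc r) - tr R {} (Suc r) / real (Suc r) = 4 * coeff R A (Suc r)"
      unfolding coeff_def diff_divide_distrib[symmetric] by (rule four)
  qed
  also have "\<dots> = 4 * (\<Sum>r. coeff R A (Suc r))"
  proof (rule suminf_mult)
    have "summable (\<lambda>r. (1/4) * (tr R A (Suc r) / real (Suc r) - tr R {} (Suc r) / real (Suc r)))"
      by (intro summable_mult summable_diff Z)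
    moreover have "coeff R A (Suc r) = (1/4) * (tr R A (Suc r) / real (Suc r) - tr R {} (Suc r) / real (Suc r))" for r
    proof -
      have "X / (4 * y) = (1/4) * (X / y)" for X y :: real by simp
      then show ?thesis unfolding coeff_def diff_divide_distrib[symmetric] .
    qed
    ultimately show "summable (\<lambda>r. coeff R A (Suc r))" by (simp only:)
  qed
  finally show ?thesis unfolding Z(2) by (simp add: exp_diff[symmetric] algebra_simps)
qed

text \<open>Dominated convergence made explicit: once the dual rectangle contains the box of order
  \<open>m\<close>, the first \<open>m\<close> coefficients equal their limits, and both tails are
  dominated by that of \<open>cbound\<close>.\<close>

lemma coeff_limit:
  assumes D: "\<And>p. p \<in> A \<Longrightarrow> \<bar>fst p\<bar> \<le> D \<and> \<bar>snd p\<bar> \<le> D" and "0 \<le> D"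
  shows "rect_tendsto (\<lambda>a b c d. exp (-2 * (\<Sum>r. coeff (rect_V a (b - 1) c (d - 1)) A (Suc r))))
     (exp (-2 * (\<Sum>r. coeff (lattice_box D (Suc r)) A (Suc r))))"
  unfolding rect_tendsto_def
proof (intro allI impI)
  fix \<epsilon> :: real assume "0 < \<epsilon>"
  let ?\<phi> = "\<lambda>r. coeff (lattice_box D (Suc r)) A (Suc r)"
  let ?b = "\<lambda>r. cbound D (Suc r)"
  have "isCont (\<lambda>s. exp (-2 * s)) (\<Sum>r. ?\<phi> r)" for s :: real by (intro continuous_intros)
  then obtain \<delta> where \<delta>: "0 < \<delta>" "\<And>s. \<bar>s - (\<Sum>r. ?\<phi> r)\<bar> < \<delta> \<Longrightarrow> \<bar>exp (-2 * s) - exp (-2 * (\<Sum>r. ?\<phi> r))\<bar> < \<epsilon>"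
    using \<open>0 < \<epsilon>\<close> unfolding continuous_at_eps_delta dist_real_def by meson
  \<comment> \<open>Half of \<open>\<delta>\<close>, because the tails of both series have to be
    bounded.\<close>
  obtain m where m: "\<And>n. m \<le> n \<Longrightarrow> norm (\<Sum>i. ?b (i + n)) < \<delta> / 2"
    using suminf_exist_split[OF _ summable_cbound[OF \<open>0 \<le> D\<close>], of "\<delta> / 2"] \<delta>(1) by auto
  show "\<exists>N. \<forall>a b c d. a \<le> - N \<and> N \<le> b \<and> c \<le> - N \<and> N \<le> d \<longrightarrow>
    \<bar>exp (-2 * (\<Sum>r. coeff (rect_V a (b - 1) c (d - 1)) A (Suc r))) - exp (-2 * (\<Sum>r. ?\<phi> r))\<bar> < \<epsilon>"
  \<comment> \<open>The box of order \<open>m\<close> reaches \<open>D + int m\<close>; the extra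
    \<open>1\<close> is there because the dual rectangle ends at \<open>b - 1\<close> and
    \<open>d - 1\<close>.\<close>
  proof (intro exI[of _ "D + int m + 1"] allI impI \<delta>(2))
    fix a b c d :: int assume N: "a \<le> - (D + int m + 1) \<and> D + int m + 1 \<le> b \<and> c \<le> - (D + int m + 1) \<and> D + int m + 1 \<le> d"
    let ?R = "rect_V a (b - 1) c (d - 1)"
    let ?\<psi> = "\<lambda>r. coeff ?R A (Suc r)"
    have b\<phi>: "\<bar>?\<phi> r\<bar> \<le> ?b r" and b\<psi>: "\<bar>?\<psi> r\<bar> \<le> ?b r" for r
      by (intro coeff_bound[OF D \<open>0 \<le> D\<close>]; simp)+
    have s\<phi>: "summable ?\<phi>" by (rule summable_comparison_test'[OF summable_cbound[OF \<open>0 \<le> D\<close>], of 0]) (use b\<phi> in simp)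
    have s\<psi>: "summable ?\<psi>" by (rule summable_comparison_test'[OF summable_cbound[OF \<open>0 \<le> D\<close>], of 0]) (use b\<psi> in simp)
    have eq: "?\<psi> r = ?\<phi> r" if "r < m" for r
    proof -
      have "lattice_box D (Suc r) \<subseteq> ?R" using N that by (auto simp: lattice_box_def rect_V_def)
      then show ?thesis using coeff_box[of A D ?R "Suc r"] D by (simp add: Int_absorb1)
    qed
    have sd: "summable (\<lambda>r. ?\<psi> r - ?\<phi> r)" by (intro summable_diff s\<phi> s\<psi>)
    have sb: "summable (\<lambda>r. ?b (r + m))" using summable_cbound[OF \<open>0 \<le> D\<close>] by (subst summable_iff_shift)
    have "(\<Sum>r. ?\<psi> r) - (\<Sum>r. ?\<phi> r) = (\<Sum>r. ?\<psi> r - ?\<phi> r)" by (rule suminf_diff[OF s\<psi> s\<phi>])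
    also have "\<dots> = (\<Sum>r. ?\<psi> (r + m) - ?\<phi> (r + m)) + (\<Sum>r<m. ?\<psi> r - ?\<phi> r)"
      by (rule suminf_split_initial_segment[OF sd])
    also have "(\<Sum>r<m. ?\<psi> r - ?\<phi> r) = 0" using eq by simp
    finally have e1: "(\<Sum>r. ?\<psi> r) - (\<Sum>r. ?\<phi> r) = (\<Sum>r. ?\<psi> (r + m) - ?\<phi> (r + m))" by simp
    have "norm (\<Sum>r. ?\<psi> (r + m) - ?\<phi> (r + m)) \<le> (\<Sum>r. 2 * ?b (r + m))"
    proof (rule norm_suminf_le)
      show "norm (?\<psi> (r + m) - ?\<phi> (r + m)) \<le> 2 * ?b (r + m)" for r
        using b\<phi>[of "r + m"] b\<psi>[of "r + m"] by simp
      show "summable (\<lambda>r. 2 * ?b (r + m))" by (intro summable_mult sb)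
    qed
    also have "\<dots> = 2 * (\<Sum>r. ?b (r + m))" by (rule suminf_mult[OF sb])
    also have "\<dots> < \<delta>" using m[of m] by simp
    finally show "\<bar>(\<Sum>r. ?\<psi> r) - (\<Sum>r. ?\<phi> r)\<bar> < \<delta>" unfolding e1 by simp
  qed
qed

lemma loop_sum_coeff:
  assumes D: "\<And>p. p \<in> A \<Longrightarrow> \<bar>fst p\<bar> \<le> D \<and> \<bar>snd p\<bar> \<le> D" and r: "0 < r"
  shows "(\<Sum>l\<in>{l. is_loop l \<and> length l = r \<and> set_parity A l = -1}. loop_w l (\<lambda>e. x)) =
     complex_of_real (coeff (lattice_box D r) A r)"
proof -
  have "{l. is_loop l \<and> length l = r \<and> set_parity A l = -1} = {l \<in> odd_paths A (lattice_box D r) r. is_loop l}"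
    using odd_paths_box[OF D] by (auto simp: odd_paths_def closed_paths_def is_loop_iff)
  then show ?thesis using coeff_loops[OF finite_lattice_box r] by simp
qed

theorem correlation_limit:
  assumes A: "finite A" and x: "x = exp (-2 * \<beta>)"
    and f: "\<And>r. f r = (\<Sum>l\<in>{l. is_loop l \<and> length l = r \<and> set_parity A l = -1}. loop_w l (\<lambda>e. x))"
  shows "summable (\<lambda>r. norm (f (Suc r))) \<and>
    (\<exists>L. rect_tendsto (\<lambda>a b c d. ising_exp \<beta> a b c d (\<lambda>\<sigma>. \<Prod>p\<in>A. \<sigma> p)) L \<and>
      complex_of_real L = exp (-2 * (\<Sum>r. f (Suc r))) \<and> 0 < L)"
proof -
  obtain D where D: "\<And>p. p \<in> A \<Longrightarrow> \<bar>fst p\<bar> \<le> D \<and> \<bar>snd p\<bar> \<le> D" "0 \<le> D"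
  proof -
    define D where "D = (\<Sum>p\<in>A. \<bar>fst p\<bar> + \<bar>snd p\<bar>)"
    have "\<bar>fst p\<bar> + \<bar>snd p\<bar> \<le> D" if "p \<in> A" for p
      unfolding D_def using that A by (intro member_le_sum) auto
    then have "\<bar>fst p\<bar> \<le> D \<and> \<bar>snd p\<bar> \<le> D" if "p \<in> A" for p using that by fastforce
    moreover have "0 \<le> D" unfolding D_def by (intro sum_nonneg) auto
    ultimately show ?thesis using that by blast
  qed
  let ?\<phi> = "\<lambda>r. coeff (lattice_box D (Suc r)) A (Suc r)"
  have f': "f (Suc r) = complex_of_real (?\<phi> r)" for r
    unfolding f by (rule loop_sum_coeff[OF D(1)]) simp_all
  have "\<bar>?\<phi> r\<bar> \<le> cbound D (Suc r)" for r by (rule coeff_bound[OF D]) simp_all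
  then have abs: "summable (\<lambda>r. \<bar>?\<phi> r\<bar>)"
    by (intro summable_comparison_test'[OF summable_cbound[OF \<open>0 \<le> D\<close>], of 0]) simp
  let ?L = "exp (-2 * (\<Sum>r. ?\<phi> r))"
  have "ising_exp \<beta> a b c d (\<lambda>\<sigma>. \<Prod>p\<in>A. \<sigma> p) = exp (-2 * (\<Sum>r. coeff (rect_V a (b - 1) c (d - 1)) A (Suc r)))" for a b c d
    unfolding ising_exp_even_sum[OF A] x[symmetric] even_sum_ratio[symmetric]
    by (simp add: weights_def[abs_def])
  then have "rect_tendsto (\<lambda>a b c d. ising_exp \<beta> a b c d (\<lambda>\<sigma>. \<Prod>p\<in>A. \<sigma> p)) ?L"
    using coeff_limit[of A D] D by simp
  moreover have "complex_of_real ?L = exp (-2 * (\<Sum>r. f (Suc r)))"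
    using suminf_of_real[OF summable_rabs_cancel[OF abs], where 'a = complex]
    by (simp add: f' exp_of_real[symmetric])
  ultimately show ?thesis using abs by (auto simp: f')
qed

end

theorem mainTheorem11:
  fixes \<beta> :: real and u v :: "int \<times> int"
  assumes "beta_c < \<beta>" and "u \<noteq> v"
  shows "summable (\<lambda>r. norm (f_u u (Suc r) (\<lambda>e. exp (-2 * \<beta>))))
    \<and> summable (\<lambda>r. norm (f_uv u v (Suc r) (\<lambda>e. exp (-2 * \<beta>))))
    \<and> (\<exists>L. rect_tendsto (\<lambda>a b c d. ising_exp \<beta> a b c d (\<lambda>\<sigma>. \<sigma> u)) L
          \<and> complex_of_real L = exp (-2 * (\<Sum>r. f_u u (Suc r) (\<lambda>e. exp (-2 * \<beta>))))
          \<and> 0 < L)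
    \<and> (\<exists>L. rect_tendsto (\<lambda>a b c d. ising_exp \<beta> a b c d (\<lambda>\<sigma>. \<sigma> u * \<sigma> v)) L
          \<and> complex_of_real L = exp (-2 * (\<Sum>r. f_uv u v (Suc r) (\<lambda>e. exp (-2 * \<beta>))))
          \<and> 0 < L)"
proof -
  define x where "x = exp (-2 * \<beta>)"
  have "x < sqrt 2 - 1"
  proof -
    have "-2 * \<beta> < ln (sqrt 2 - 1)" using assms(1) by (simp add: beta_c_def)
    then have "x < exp (ln (sqrt 2 - 1))" unfolding x_def by (rule exp_less_mono)
    then show ?thesis by simp
  qed
  then have "x * (1 + sqrt 2) < (sqrt 2 - 1) * (1 + sqrt 2)"
    by (intro mult_strict_right_mono) (auto simp: add_pos_pos)
  also have "\<dots> = 1" by (simp add: algebra_simps)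
  finally interpret low_temperature x by unfold_locales (simp_all add: x_def)
  have u: "f_u u r (\<lambda>e. x) = (\<Sum>l\<in>{l. is_loop l \<and> length l = r \<and> set_parity {u} l = -1}. loop_w l (\<lambda>e. x))" for r
    unfolding f_u_def by (rule sum.cong) (auto simp: u_odd_iff is_loop_iff set_parity_def)
  \<comment> \<open>Since \<open>u \<noteq> v\<close>, the parity of \<open>{u, v}\<close> is the
    product of two ray parities.\<close>
  have uv: "f_uv u v r (\<lambda>e. x) = (\<Sum>l\<in>{l. is_loop l \<and> length l = r \<and> set_parity {u, v} l = -1}. loop_w l (\<lambda>e. x))" for r
    unfolding f_uv_def by (rule sum.cong) (use assms(2) in \<open>auto simp: uv_odd_iff is_loop_iff set_parity_def\<close>)
  show ?thesis
    using correlation_limit[OF _ x_def u] correlation_limit[OF _ x_def uv] assms(2)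
    unfolding x_def[symmetric] by simp
qed

end
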